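(* Let $i\ge 1$ be an integer, $n \ge 100$ (with $i\le n$), $m \ge 9+i$, $p \ge 1$, and $A \in \mathcal{S}^n$, and set $$\delta = \frac{1}{2} \min_{k = 2,\dots,i} \frac{\lambda_{k-1}(A) - \lambda_{k}(A)}{\lambda_1(A) -\lambda_n(A)},$$ assumed to be positive if $i\ge2$. Then $$\mathbb{E}_{b \sim \mathcal{U}(S^{n-1})} \left[ \left( \frac{\lambda_i(A) - \lambda_i^{(m)}(A,b)}{\lambda_i(A)-\lambda_n(A)}\right)^p \right]^{1/p} \le .068 \, \frac{ \ln^2 \left( \delta^{-2(i-1)} n(m-i)^{8p}\right) }{(m-i)^2}$$ and $$\mathbb{P}_{b \sim \mathcal{U}(S^{n-1})} \left[ \frac{\lambda_i(A) - \lambda_i^{(m)}(A,b)}{\lambda_i(A)-\lambda_n(A)} \le .571 \; \frac{\ln^2\left( \delta^{-2(i-1)/3} n (m-i)^{2/3} \right)}{(m-i)^2} \right] \ge 1 - o(1/n).$$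
   Context: $\mathcal{S}^n$ is the set of real symmetric $n\times n$ matrices; the eigenvalues of $A\in\mathcal{S}^n$, with multiplicity, are $\lambda_1(A)\ge\dots\ge\lambda_n(A)$. $\mathcal{U}(S^{n-1})$ is the uniform probability measure on $S^{n-1}=\{x\in\mathbb{R}^n : \|x\|=1\}$. For a positive integer $m$ and nonzero $b\in\mathbb{R}^n$, the Krylov subspace is $\mathcal{K}_m(A,b)=\mathrm{span}\{b,Ab,\dots,A^{m-1}b\}$, and the $i$-th Ritz value (the approximation of $\lambda_i(A)$ after $m$ iterations of the Lanczos method) is $$\lambda_i^{(m)}(A,b)=\max_{\substack{U\subset\mathcal{K}_m(A,b)\\ \dim U=i}}\ \min_{x\in U,\,x\neq0}\frac{x^TAx}{x^Tx},$$ where $U$ ranges over linear subspaces; under the hypotheses it is defined for almost every $b$. When $i=1$ the factors $\delta^{-2(i-1)}$ and $\delta^{-2(i-1)/3}$ are equal to $1$. The relative error quotient is taken to be $0$ when $\lambda_i(A)=\lambda_n(A)$. The term $o(1/n)$ denotes, for each fixed $i$, a quantity $\eta_n$ depending only on $n$ (and $i$), not on $m$ or $A$, with $n\eta_n\to0$ as $n\to\infty$. *)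

theory Defs
  imports
    "HOL-Probability.Probability"
    "Jordan_Normal_Form.Char_Poly"
    "Jordan_Normal_Form.VS_Connect"
begin

text \<open>
  The dimension \<open>n\<close> is a natural number inside the statement (the term \<open>o(1/n)\<close> has to be
  uniform in everything but \<open>n\<close>), so vectors and matrices are those of \<open>Jordan_Normal_Form\<close>.
\<close>

definition sym_mats :: "nat \<Rightarrow> real mat set" where
  "sym_mats n = {A \<in> carrier_mat n n. transpose_mat A = A}"

text \<open>
  \<open>eigval A k\<close> is \<open>\<lambda>\<^sub>k(A)\<close>, counted from \<open>k = 1\<close> in decreasing order with multiplicity.
  The real roots are all the eigenvalues because \<open>A\<close> is symmetric.
\<close>

definition eigval :: "real mat \<Rightarrow> nat \<Rightarrow> real" where
  "eigval A k = rev (sorted_list_of_multiset (proots (char_poly A))) ! (k - 1)"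

definition vec_borel :: "nat \<Rightarrow> real Matrix.vec measure" where
  "vec_borel n = vimage_algebra (carrier_vec n)
     (\<lambda>x. \<lambda>j\<in>{..<n}. vec_index x j) (\<Pi>\<^sub>M j\<in>{..<n}. borel)"

definition unit_sphere :: "nat \<Rightarrow> real Matrix.vec set" where
  "unit_sphere n = {x \<in> carrier_vec n. sqrt (scalar_prod x x) = 1}"

text \<open>
  The uniform probability measure on the sphere is the normalised surface measure, given in polar
  coordinates: the law of \<open>x / \<parallel>x\<parallel>\<close> for \<open>x\<close> distributed according to normalised Lebesgue
  measure on the unit ball without its centre.
\<close>

definition punctured_ball :: "nat \<Rightarrow> (nat \<Rightarrow> real) set" where
  "punctured_ball n = {x \<in> {..<n} \<rightarrow>\<^sub>E UNIV. 0 < (\<Sum>j<n. (x j)\<^sup>2) \<and> (\<Sum>j<n. (x j)\<^sup>2) \<le> 1}"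

definition uniform_sphere :: "nat \<Rightarrow> real Matrix.vec measure" where
  "uniform_sphere n =
     distr
       (uniform_measure (restrict_space (\<Pi>\<^sub>M j\<in>{..<n}. lborel) (punctured_ball n)) (punctured_ball n))
       (restrict_space (vec_borel n) (unit_sphere n))
       (\<lambda>x. Matrix.vec n (\<lambda>j. x j / sqrt (\<Sum>k<n. (x k)\<^sup>2)))"

definition krylov :: "nat \<Rightarrow> real mat \<Rightarrow> real Matrix.vec \<Rightarrow> real Matrix.vec set" where
  "krylov m A b = LinearCombinations.module.span class_ring (module_vec TYPE(real) (dim_row A))
     ((\<lambda>j. (A ^\<^sub>m j) *\<^sub>v b) ` {..<m})"

definition rayleigh :: "real mat \<Rightarrow> real Matrix.vec \<Rightarrow> real" where
  "rayleigh A x = scalar_prod x (A *\<^sub>v x) / scalar_prod x x"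

definition subspaces_of_dim :: "nat \<Rightarrow> nat \<Rightarrow> real Matrix.vec set set" where
  "subspaces_of_dim n i = {U. VectorSpace.subspace class_ring U (module_vec TYPE(real) n) \<and>
     vectorspace.dim class_ring ((module_vec TYPE(real) n)\<lparr>carrier := U\<rparr>) = i}"

text \<open>
  Both extrema are attained when \<open>1 \<le> i \<le> dim (krylov m A b)\<close>, so they are the maximum and the
  minimum. If the Krylov space has dimension less than \<open>i\<close>, the value is meaningless.
\<close>

definition ritz :: "nat \<Rightarrow> nat \<Rightarrow> real mat \<Rightarrow> real Matrix.vec \<Rightarrow> real" where
  "ritz m i A b =
     (SUP U \<in> {U \<in> subspaces_of_dim (dim_row A) i. U \<subseteq> krylov m A b}.
        INF x \<in> U - {0\<^sub>v (dim_row A)}. rayleigh A x)"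

text \<open>The quotient is \<open>0\<close> when \<open>\<lambda>\<^sub>i = \<lambda>\<^sub>n\<close>, since \<open>x / 0 = 0\<close>.\<close>

definition rel_err :: "nat \<Rightarrow> nat \<Rightarrow> real mat \<Rightarrow> real Matrix.vec \<Rightarrow> real" where
  "rel_err m i A b = (eigval A i - ritz m i A b) / (eigval A i - eigval A (dim_row A))"

text \<open>
  The quantity \<open>\<delta>\<close>. For \<open>i = 1\<close> the minimum is over the empty set; the value \<open>1\<close> then makes every
  power of \<open>\<delta>\<close> equal to \<open>1\<close>. For \<open>\<lambda>\<^sub>1 = \<lambda>\<^sub>n\<close> and \<open>i \<ge> 2\<close> it is \<open>0\<close>, hence not positive.
\<close>

definition gap :: "nat \<Rightarrow> real mat \<Rightarrow> real" where
  "gap i A = (if i \<le> 1 then 1 else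
     1/2 * Min ((\<lambda>k. (eigval A (k - 1) - eigval A k) / (eigval A 1 - eigval A (dim_row A))) ` {2..i}))"

end

theory Submission
  imports Defs
begin

text \<open>
  In an orthonormal eigenbasis \<open>v\<^sub>1, \<dots>, v\<^sub>n\<close> of \<open>A\<close> (\<open>spectral_eigval\<close>), the vectors of the Krylov space are
  those with components \<open>p(\<lambda>\<^sub>j) \<langle>v\<^sub>j, b\<rangle>\<close>, where \<open>p\<close> is a polynomial of degree less than \<open>m\<close>. A lower bound for the
  \<open>i\<close>-th Ritz value needs one good \<open>i\<close>-dimensional space of such polynomials. Take \<open>p = q R\<close>, where \<open>q\<close> is
  a shifted Chebyshev polynomial of degree \<open>d = m - i\<close> of modulus at most \<open>1\<close> on the eigenvalues below
  \<open>\<lambda>\<^sub>i - \<epsilon> (\<lambda>\<^sub>i - \<lambda>\<^sub>n)\<close> and at least \<open>exp (2 d sqrt \<epsilon>) / 2\<close> at \<open>\<lambda>\<^sub>1, \<dots>, \<lambda>\<^sub>i\<close> (\<open>cheb_filter\<close>), and \<open>R\<close> is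
  any polynomial of degree less than \<open>i\<close>. Lagrange interpolation at \<open>\<lambda>\<^sub>1, \<dots>, \<lambda>\<^sub>i\<close> controls \<open>R\<close> on the whole
  spectrum by its values at these nodes, at the price of a power of the gap. If the components of
  the unit vector \<open>b\<close> along \<open>v\<^sub>1, \<dots>, v\<^sub>i\<close> are at least \<open>t\<close> in modulus, this yields
  a relative error of at most \<open>\<epsilon> + 4 L exp (- 4 d sqrt \<epsilon>) / t\<^sup>2\<close> with \<open>L = i / (2 gap) ^ (2 (i - 1))\<close>
  (\<open>rel_err_le_components\<close>).

  A component of a uniformly distributed unit vector in a fixed direction is smaller than \<open>t\<close> with
  probability at most \<open>2 t sqrt n\<close> (\<open>uniform_sphere_slab\<close>). By rotation invariance of the Lebesgue measure
  this is at most the relative volume of a slab of the ball about a coordinate hyperplane. Both claims follow by choosing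
  \<open>\<epsilon>\<close> of the order of the claimed bound, with a slightly smaller constant, and then \<open>t\<close>: on the
  exceptional set the error is at most \<open>1\<close> (\<open>moment_bound\<close>), respectively the exceptional set contains
  the complement of the event in question (\<open>tail_bound\<close>).

  Integrability needs that the Ritz value, a supremum over uncountably many subspaces, is a
  measurable function of \<open>b\<close>. It exceeds \<open>a\<close> iff for some rational \<open>q > a\<close> the form \<open>\<langle>x, (A - q) x\<rangle>\<close> is
  positive definite on an \<open>i\<close>-dimensional subspace, and such a subspace may be taken to be spanned
  by vectors \<open>p(A) b\<close> with rational coefficients of the polynomials \<open>p\<close> (\<open>above_iff_rational\<close>).
\<close>

section \<open>Linear combinations of finite families of vectors\<close>

text \<open>
  Subspaces are handled through families \<open>u 0, \<dots>, u (i - 1)\<close> and their explicit combinations: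
  everything later is a computation with finite sums of coefficients.
\<close>
definition comb :: "nat \<Rightarrow> nat \<Rightarrow> (nat \<Rightarrow> real) \<Rightarrow> (nat \<Rightarrow> real Matrix.vec) \<Rightarrow> real Matrix.vec" where
  "comb n i c u = Matrix.vec n (\<lambda>r. \<Sum>l<i. c l * vec_index (u l) r)"

definition indep :: "nat \<Rightarrow> nat \<Rightarrow> (nat \<Rightarrow> real Matrix.vec) \<Rightarrow> bool" where
  "indep n i u \<longleftrightarrow> (\<forall>c. comb n i c u = 0\<^sub>v n \<longrightarrow> (\<forall>l<i. c l = 0))"

lemma comb_carrier [simp]: "comb n i c u \<in> carrier_vec n"
  by (simp add: comb_def)

lemma dim_comb [simp]: "dim_vec (comb n i c u) = n"
  by (simp add: comb_def)

lemma index_comb [simp]: "r < n \<Longrightarrow> vec_index (comb n i c u) r = (\<Sum>l<i. c l * vec_index (u l) r)"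
  by (simp add: comb_def)

lemma comb_scalar_prod:
  assumes "w \<in> carrier_vec n" "\<And>l. l < i \<Longrightarrow> u l \<in> carrier_vec n"
  shows "scalar_prod (comb n i c u) w = (\<Sum>l<i. c l * scalar_prod (u l) w)"
proof -
  have "scalar_prod (comb n i c u) w = (\<Sum>r<n. (\<Sum>l<i. c l * vec_index (u l) r) * vec_index w r)"
    using assms by (simp add: scalar_prod_def atLeast0LessThan)
  also have "\<dots> = (\<Sum>l<i. \<Sum>r<n. c l * (vec_index (u l) r * vec_index w r))"
    by (subst sum.swap) (simp add: sum_distrib_right mult.assoc)
  also have "\<dots> = (\<Sum>l<i. c l * scalar_prod (u l) w)"
    using assms by (simp add: scalar_prod_def atLeast0LessThan sum_distrib_left)
  finally show ?thesis .
qed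

lemma scalar_prod_comb:
  assumes "w \<in> carrier_vec n" "\<And>l. l < i \<Longrightarrow> u l \<in> carrier_vec n"
  shows "scalar_prod w (comb n i c u) = (\<Sum>l<i. c l * scalar_prod w (u l))"
proof -
  have "scalar_prod w (comb n i c u) = scalar_prod (comb n i c u) w"
    using assms by (intro comm_scalar_prod[of _ n]) auto
  also have "\<dots> = (\<Sum>l<i. c l * scalar_prod w (u l))"
    using comb_scalar_prod[of w n i u c] assms comm_scalar_prod[OF assms(1)] by simp
  finally show ?thesis .
qed

lemma mult_mat_comb:
  assumes A: "A \<in> carrier_mat k n" and u: "\<And>l. l < i \<Longrightarrow> u l \<in> carrier_vec n"
  shows "A *\<^sub>v comb n i c u = comb k i c (\<lambda>l. A *\<^sub>v u l)"
proof (rule eq_vecI)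
  fix r assume "r < dim_vec (comb k i c (\<lambda>l. A *\<^sub>v u l))"
  then have r: "r < k" by simp
  then have "vec_index (A *\<^sub>v comb n i c u) r = scalar_prod (row A r) (comb n i c u)" using A by simp
  also have "\<dots> = (\<Sum>l<i. c l * scalar_prod (row A r) (u l))"
    using A r u by (intro scalar_prod_comb) auto
  also have "\<dots> = vec_index (comb k i c (\<lambda>l. A *\<^sub>v u l)) r" using r A by simp
  finally show "vec_index (A *\<^sub>v comb n i c u) r = vec_index (comb k i c (\<lambda>l. A *\<^sub>v u l)) r" .
qed (use A in auto)

lemma comb_comb:
  assumes "\<And>l. l < i \<Longrightarrow> u l = comb n m (P l) w"
  shows "comb n i c u = comb n m (\<lambda>j. \<Sum>l<i. c l * P l j) w"
proof (rule eq_vecI)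
  fix r assume "r < dim_vec (comb n m (\<lambda>j. \<Sum>l<i. c l * P l j) w)"
  then have r: "r < n" by simp
  then have "vec_index (comb n i c u) r = (\<Sum>l<i. c l * (\<Sum>j<m. P l j * vec_index (w j) r))"
    using assms by simp
  also have "\<dots> = (\<Sum>j<m. \<Sum>l<i. c l * P l j * vec_index (w j) r)"
    by (subst sum.swap) (simp add: sum_distrib_left mult.assoc)
  finally show "vec_index (comb n i c u) r = vec_index (comb n m (\<lambda>j. \<Sum>l<i. c l * P l j) w) r"
    using r by (simp add: sum_distrib_right)
qed auto

lemma comb_closed:
  assumes u: "\<And>l. l < i \<Longrightarrow> u l \<in> W" "\<And>l. l < i \<Longrightarrow> u l \<in> carrier_vec n"
    and 0: "0\<^sub>v n \<in> W" and add: "\<And>x y. x \<in> W \<Longrightarrow> y \<in> W \<Longrightarrow> x + y \<in> W"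
    and smult: "\<And>a x. x \<in> W \<Longrightarrow> a \<cdot>\<^sub>v x \<in> W"
  shows "comb n i c u \<in> W"
  using u
proof (induction i)
  case 0
  have "comb n 0 c u = 0\<^sub>v n" by (rule eq_vecI) auto
  then show ?case using \<open>0\<^sub>v n \<in> W\<close> by simp
next
  case (Suc i)
  have "comb n (Suc i) c u = comb n i c u + c i \<cdot>\<^sub>v u i"
    using Suc.prems(2)[of i] by (intro eq_vecI) auto
  then show ?case using Suc by (auto intro!: add smult)
qed

text \<open>
  Families may have repeated members while spans are taken of sets; a combination over the set is
  turned into one over the indices by choosing one index for each vector that occurs.
\<close>
lemma span_image_eq:
  assumes u: "\<And>l. l < i \<Longrightarrow> u l \<in> carrier_vec n"
  shows "LinearCombinations.module.span class_ring (module_vec TYPE(real) n) (u ` {..<i})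
           = range (\<lambda>c. comb n i c u)"
proof -
  interpret vec_space "TYPE(real)" n .
  have S: "u ` {..<i} \<subseteq> carrier_vec n" using u by auto
  show ?thesis
  proof
    show "span (u ` {..<i}) \<subseteq> range (\<lambda>c. comb n i c u)"
    proof
      fix x assume "x \<in> span (u ` {..<i})"
      then obtain a T where T: "finite T" "T \<subseteq> u ` {..<i}" "x = lincomb a T"
        unfolding span_def by auto
      then obtain L where L: "L \<subseteq> {..<i}" "inj_on u L" "T = u ` L"
        by (metis subset_image_inj)
      define c where "c = (\<lambda>l. if l \<in> L then a (u l) else 0)"
      have "x = comb n i c u"
      proof (rule eq_vecI)
        fix r assume "r < dim_vec (comb n i c u)"
        then have r: "r < n" by simp
        have "vec_index x r = (\<Sum>l\<in>L. a (u l) * vec_index (u l) r)"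
          unfolding T(3) using T(2) S L
          by (subst lincomb_index[OF r]) (auto simp: sum.reindex)
        also have "\<dots> = (\<Sum>l<i. c l * vec_index (u l) r)"
          using L(1) by (intro sum.mono_neutral_cong_left) (auto simp: c_def)
        finally show "vec_index x r = vec_index (comb n i c u) r" using r by simp
      qed (use T S in \<open>auto simp: lincomb_dim\<close>)
      then show "x \<in> range (\<lambda>c. comb n i c u)" by auto
    qed
  next
    show "range (\<lambda>c. comb n i c u) \<subseteq> span (u ` {..<i})"
    proof clarify
      fix c
      show "comb n i c u \<in> span (u ` {..<i})"
      proof (rule comb_closed)
        show "\<And>l. l < i \<Longrightarrow> u l \<in> span (u ` {..<i})" using in_own_span[OF S] by auto
        show "0\<^sub>v n \<in> span (u ` {..<i})"
          by (metis S finite_imageI finite_lessThan span_zero)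
        show "\<And>x y. x \<in> span (u ` {..<i}) \<Longrightarrow> y \<in> span (u ` {..<i}) \<Longrightarrow> x + y \<in> span (u ` {..<i})"
          using span_add1[OF S] by simp
        show "\<And>a x. x \<in> span (u ` {..<i}) \<Longrightarrow> a \<cdot>\<^sub>v x \<in> span (u ` {..<i})"
          using smult_in_span[OF S] by simp
      qed (use u in auto)
    qed
  qed
qed

lemma indep_iff_lin_indpt:
  assumes u: "\<And>l. l < i \<Longrightarrow> u l \<in> carrier_vec n"
  shows "indep n i u \<longleftrightarrow> inj_on u {..<i} \<and>
    \<not> LinearCombinations.module.lin_dep class_ring (module_vec TYPE(real) n) (u ` {..<i})"
proof -
  interpret vec_space "TYPE(real)" n .
  have S: "u ` {..<i} \<subseteq> carrier_vec n" using u by auto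
  show ?thesis
  proof (intro iffI conjI)
    assume ind: "indep n i u"
    show inj: "inj_on u {..<i}"
    proof (rule inj_onI, rule ccontr)
      fix k l assume kl: "k \<in> {..<i}" "l \<in> {..<i}" "u k = u l" "k \<noteq> l"
      define c :: "nat \<Rightarrow> real" where "c = (\<lambda>j. if j = k then 1 else if j = l then -1 else 0)"
      have "comb n i c u = 0\<^sub>v n"
      proof (rule eq_vecI)
        fix r assume "r < dim_vec (0\<^sub>v n :: real Matrix.vec)"
        then have r: "r < n" by simp
        have "(\<Sum>j<i. c j * vec_index (u j) r) = (\<Sum>j\<in>{k, l}. c j * vec_index (u j) r)"
          using kl by (intro sum.mono_neutral_right) (auto simp: c_def)
        also have "\<dots> = 0" using kl by (simp add: c_def)
        finally show "vec_index (comb n i c u) r = vec_index (0\<^sub>v n) r" using r by simp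
      qed auto
      then have "c k = 0" using ind kl unfolding indep_def by auto
      then show False by (simp add: c_def)
    qed
    show "\<not> lin_dep (u ` {..<i})"
    proof
      assume "lin_dep (u ` {..<i})"
      from finite_lin_dep[OF _ this] S obtain a v where
        a: "lincomb a (u ` {..<i}) = 0\<^sub>v n" "v \<in> u ` {..<i}" "a v \<noteq> 0" by auto
      have "comb n i (\<lambda>l. a (u l)) u = lincomb a (u ` {..<i})"
      proof (rule eq_vecI)
        fix r assume "r < dim_vec (lincomb a (u ` {..<i}))"
        then have r: "r < n" using a by simp
        show "vec_index (comb n i (\<lambda>l. a (u l)) u) r = vec_index (lincomb a (u ` {..<i})) r"
          by (subst lincomb_index[OF r S]) (use r inj in \<open>simp add: sum.reindex\<close>)
      qed (use a in auto)
      then show False using a ind unfolding indep_def by auto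
    qed
  next
    assume *: "inj_on u {..<i} \<and> \<not> lin_dep (u ` {..<i})"
    show "indep n i u" unfolding indep_def
    proof (intro allI impI, rule ccontr)
      fix c l assume c: "comb n i c u = 0\<^sub>v n" and l: "l < i" "c l \<noteq> 0"
      define a where "a = (\<lambda>x. c (the_inv_into {..<i} u x))"
      have au: "a (u l) = c l" if "l < i" for l
        using that * by (simp add: a_def the_inv_into_f_f)
      have "lincomb a (u ` {..<i}) = 0\<^sub>v n"
      proof (rule eq_vecI)
        fix r assume "r < dim_vec (0\<^sub>v n :: real Matrix.vec)"
        then have r: "r < n" by simp
        have "vec_index (lincomb a (u ` {..<i})) r = vec_index (comb n i c u) r"
          by (subst lincomb_index[OF r S]) (use r * au in \<open>simp add: sum.reindex\<close>)
        then show "vec_index (lincomb a (u ` {..<i})) r = vec_index (0\<^sub>v n) r" using c by simp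
      qed (use S in \<open>simp add: lincomb_dim\<close>)
      then have "lin_dep (u ` {..<i})"
        using l au by (intro lin_dep_crit[where A = "u ` {..<i}" and a = a and v = "u l"]) auto
      then show False using * by simp
    qed
  qed
qed

text \<open>
  This replaces the abstract dimension by a basis indexed by \<open>{..<i}\<close>. Inside a finite-dimensional
  space a maximal independent subset of the subspace exists because independent sets have at most
  \<open>n\<close> elements, and it is a basis.
\<close>
lemma subspaces_of_dim_iff:
  "U \<in> subspaces_of_dim n i \<longleftrightarrow>
     (\<exists>u. (\<forall>l<i. u l \<in> carrier_vec n) \<and> indep n i u \<and> U = range (\<lambda>c. comb n i c u))"
proof -
  interpret V: vec_space "TYPE(real)" n .
  show ?thesis
  proof
    assume "U \<in> subspaces_of_dim n i"
    then have U: "VectorSpace.subspace class_ring U V.V"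
      and dim: "vectorspace.dim class_ring (V.V\<lparr>carrier := U\<rparr>) = i"
      by (auto simp: subspaces_of_dim_def)
    interpret W: vectorspace class_ring "V.V\<lparr>carrier := U\<rparr>" by (rule V.subspace_is_vs[OF U])
    have sub: "submodule class_ring U V.V" using U by (simp add: subspace_def)
    then have UV: "U \<subseteq> carrier_vec n" by (auto simp: submodule_def module_vec_simps)
    have li: "W.lin_dep S = V.lin_dep S" if "S \<subseteq> U" for S
      using V.span_li_not_depend(2)[OF that sub] .
    have sp: "W.span S = V.span S" if "S \<subseteq> U" for S
      using V.span_li_not_depend(1)[OF that sub] .
    have "\<exists>S. finite S \<and> maximal S (\<lambda>S. S \<subseteq> carrier (V.V\<lparr>carrier := U\<rparr>) \<and> W.lin_indpt S)"
    proof (rule maximal_exists)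
      fix S assume "S \<subseteq> carrier (V.V\<lparr>carrier := U\<rparr>) \<and> W.lin_indpt S"
      then have S: "S \<subseteq> U" "V.lin_indpt S" using li by auto
      then show "finite S \<and> card S \<le> n"
        using V.li_le_dim[of S] UV by (auto simp: V.dim_is_n)
    next
      show "{} \<subseteq> carrier (V.V\<lparr>carrier := U\<rparr>) \<and> W.lin_indpt {}"
        by (simp add: W.lin_dep_def)
    qed
    then obtain S where S: "finite S" "W.basis S" using W.max_li_is_basis by blast
    then have card: "card S = i" using W.dim_basis dim by metis
    have SU: "S \<subseteq> U" using S(2) by (auto simp: W.basis_def)
    obtain u where "bij_betw u {..<i} S"
      using ex_bij_betw_nat_finite[OF S(1)] card by (auto simp: atLeast0LessThan)
    then have inj: "inj_on u {..<i}" and im: "S = u ` {..<i}" by (auto simp: bij_betw_def)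
    have u: "u l \<in> carrier_vec n" if "l < i" for l using that im SU UV by auto
    have "V.lin_indpt S" using S(2) li[OF SU] by (auto simp: W.basis_def)
    then have "indep n i u" using indep_iff_lin_indpt[of i u n] u inj im by auto
    moreover have "U = range (\<lambda>c. comb n i c u)"
    proof -
      have "U = W.span S" using S(2) by (auto simp: W.basis_def)
      also have "\<dots> = V.span (u ` {..<i})" using sp[OF SU] im by simp
      finally show ?thesis using span_image_eq[of i u n] u by simp
    qed
    ultimately show "\<exists>u. (\<forall>l<i. u l \<in> carrier_vec n) \<and> indep n i u \<and> U = range (\<lambda>c. comb n i c u)"
      using u by blast
  next
    assume "\<exists>u. (\<forall>l<i. u l \<in> carrier_vec n) \<and> indep n i u \<and> U = range (\<lambda>c. comb n i c u)"
    then obtain u where u: "\<And>l. l < i \<Longrightarrow> u l \<in> carrier_vec n" and ind: "indep n i u"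
      and U: "U = range (\<lambda>c. comb n i c u)" by blast
    define S where "S = u ` {..<i}"
    have S: "S \<subseteq> carrier_vec n" using u by (auto simp: S_def)
    have US: "U = V.span S" unfolding U S_def using span_image_eq[of i u n] u by simp
    have inj: "inj_on u {..<i}" and li: "V.lin_indpt S"
      using indep_iff_lin_indpt[of i u n] u ind by (auto simp: S_def)
    have sub: "VectorSpace.subspace class_ring U V.V" unfolding US
      by (rule V.span_is_subspace) (use S in simp)
    then have subm: "submodule class_ring U V.V" by (simp add: subspace_def)
    interpret W: vectorspace class_ring "V.V\<lparr>carrier := U\<rparr>" by (rule V.subspace_is_vs[OF sub])
    have SU: "S \<subseteq> U" unfolding US using V.in_own_span[OF S] .
    have "W.basis S" unfolding W.basis_def
      using V.span_li_not_depend[OF SU subm] li SU US by auto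
    then have "W.dim = card S" by (intro W.dim_basis) (auto simp: S_def)
    also have "\<dots> = i" using inj by (simp add: S_def card_image)
    finally show "U \<in> subspaces_of_dim n i" using sub by (simp add: subspaces_of_dim_def)
  qed
qed

lemma krylov_eq:
  assumes "A \<in> carrier_mat n n" "b \<in> carrier_vec n"
  shows "krylov m A b = range (\<lambda>c. comb n m c (\<lambda>j. (A ^\<^sub>m j) *\<^sub>v b))"
proof -
  have "(A ^\<^sub>m j) *\<^sub>v b \<in> carrier_vec n" for j
    using assms by (intro mult_mat_vec_carrier[of _ n n]) auto
  then show ?thesis
    unfolding krylov_def using span_image_eq[of m "\<lambda>j. (A ^\<^sub>m j) *\<^sub>v b" n] assms(1) by simp
qed

text \<open>
  The \<open>i\<close> columns of the system live in a space of dimension \<open>k < i\<close>, hence are dependent. This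
  yields polynomials annihilating a vector, vectors orthogonal to given ones, and the intersection
  argument of Courant and Fischer.
\<close>
lemma underdetermined_system:
  fixes M :: "nat \<Rightarrow> nat \<Rightarrow> real"
  assumes "k < i"
  shows "\<exists>c. (\<exists>l<i. c l \<noteq> 0) \<and> (\<forall>r<k. (\<Sum>l<i. c l * M r l) = 0)"
proof -
  interpret vec_space "TYPE(real)" k .
  define u where "u = (\<lambda>l. Matrix.vec k (\<lambda>r. M r l))"
  have u: "\<And>l. l < i \<Longrightarrow> u l \<in> carrier_vec k" by (auto simp: u_def)
  have "\<not> indep k i u"
  proof
    assume "indep k i u"
    with indep_iff_lin_indpt[OF u, of i] have inj: "inj_on u {..<i}" and li: "lin_indpt (u ` {..<i})" by auto
    have "card (u ` {..<i}) \<le> k" using li_le_dim(2)[of "u ` {..<i}"] li u by (auto simp: dim_is_n)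
    then show False using assms inj by (simp add: card_image)
  qed
  then obtain c l where c: "comb k i c u = 0\<^sub>v k" "l < i" "c l \<noteq> 0" unfolding indep_def by auto
  have "(\<Sum>l<i. c l * M r l) = 0" if "r < k" for r
    using arg_cong[OF c(1), of "\<lambda>x. vec_index x r"] that by (simp add: u_def)
  then show ?thesis using c by blast
qed

section \<open>The spectral theorem for real symmetric matrices\<close>

lemma pow_mat_mult_vec_carrier [simp]:
  "A \<in> carrier_mat n n \<Longrightarrow> x \<in> carrier_vec n \<Longrightarrow> (A ^\<^sub>m j) *\<^sub>v x \<in> carrier_vec n"
  by (rule mult_mat_vec_carrier[of _ n n]) auto

lemma pow_mat_Suc_mult_vec:
  assumes A: "A \<in> carrier_mat n n" and x: "x \<in> carrier_vec n"
  shows "(A ^\<^sub>m Suc j) *\<^sub>v x = A *\<^sub>v ((A ^\<^sub>m j) *\<^sub>v x)"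
  using x
proof (induction j arbitrary: x)
  case (Suc j)
  have Ax: "A *\<^sub>v x \<in> carrier_vec n" using A Suc.prems by simp
  have "(A ^\<^sub>m Suc (Suc j)) *\<^sub>v x = (A ^\<^sub>m Suc j) *\<^sub>v (A *\<^sub>v x)"
    unfolding pow_mat.simps(2)[of A "Suc j"] using A Suc.prems
    by (intro assoc_mult_mat_vec[of _ n n _ n]) auto
  also have "\<dots> = A *\<^sub>v ((A ^\<^sub>m j) *\<^sub>v (A *\<^sub>v x))" by (rule Suc.IH[OF Ax])
  also have "(A ^\<^sub>m j) *\<^sub>v (A *\<^sub>v x) = (A ^\<^sub>m Suc j) *\<^sub>v x"
    unfolding pow_mat.simps(2) using A Suc.prems by (intro assoc_mult_mat_vec[of _ n n _ n, symmetric]) auto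
  finally show ?case .
qed (use A in auto)

lemma sym_mats_scalar_prod:
  assumes "A \<in> sym_mats n" "x \<in> carrier_vec n" "y \<in> carrier_vec n"
  shows "scalar_prod (A *\<^sub>v x) y = scalar_prod x (A *\<^sub>v y)"
  using transpose_vec_mult_scalar[of A n n y x] assms by (auto simp: sym_mats_def)

text \<open>
  The vector \<open>p(A) x\<close>. The Krylov space is the set of these vectors for \<open>degree p < m\<close>.
\<close>
definition poly_app :: "nat \<Rightarrow> real mat \<Rightarrow> real poly \<Rightarrow> real Matrix.vec \<Rightarrow> real Matrix.vec" where
  "poly_app n A p x = comb n (Suc (degree p)) (coeff p) (\<lambda>j. (A ^\<^sub>m j) *\<^sub>v x)"

lemma poly_app_carrier [simp]: "poly_app n A p x \<in> carrier_vec n"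
  by (simp add: poly_app_def)

lemma comb_mono_bound:
  assumes "N \<le> N'" "\<And>l. N \<le> l \<Longrightarrow> l < N' \<Longrightarrow> c l = 0"
  shows "comb n N' c u = comb n N c u"
proof (rule eq_vecI)
  fix r assume "r < dim_vec (comb n N c u)"
  then have r: "r < n" by simp
  have "(\<Sum>l<N. c l * vec_index (u l) r) = (\<Sum>l<N'. c l * vec_index (u l) r)"
    using assms by (intro sum.mono_neutral_left) auto
  then show "vec_index (comb n N' c u) r = vec_index (comb n N c u) r" using r by simp
qed simp

lemma poly_app_eq:
  assumes "degree p < N"
  shows "poly_app n A p x = comb n N (coeff p) (\<lambda>j. (A ^\<^sub>m j) *\<^sub>v x)"
  unfolding poly_app_def using assms
  by (intro comb_mono_bound[symmetric]) (auto simp: coeff_eq_0)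

lemma poly_app_linear_factor:
  assumes A: "A \<in> carrier_mat n n" and x: "x \<in> carrier_vec n"
  shows "poly_app n A ([:- a, 1:] * q) x = A *\<^sub>v poly_app n A q x - a \<cdot>\<^sub>v poly_app n A q x"
proof -
  define N where "N = Suc (degree q)"
  have "degree ([:- a, 1:] * q) \<le> degree [:- a, 1:] + degree q" by (rule degree_mult_le)
  then have deg: "degree ([:- a, 1:] * q) < Suc N" by (simp add: N_def)
  have co: "coeff ([:- a, 1:] * q) j = (case j of 0 \<Rightarrow> 0 | Suc k \<Rightarrow> coeff q k) - a * coeff q j" for j
    by (simp add: coeff_pCons split: nat.split)
  have N: "coeff q N = 0" by (simp add: N_def coeff_eq_0)
  show ?thesis
  proof (rule eq_vecI)
    fix r assume "r < dim_vec (A *\<^sub>v poly_app n A q x - a \<cdot>\<^sub>v poly_app n A q x)"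
    then have r: "r < n" by (simp add: poly_app_def)
    let ?w = "\<lambda>j. vec_index ((A ^\<^sub>m j) *\<^sub>v x) r"
    have "A *\<^sub>v poly_app n A q x = comb n N (coeff q) (\<lambda>j. (A ^\<^sub>m Suc j) *\<^sub>v x)"
      unfolding poly_app_def N_def[symmetric] pow_mat_Suc_mult_vec[OF A x]
      using A x by (intro mult_mat_comb) auto
    then have 1: "vec_index (A *\<^sub>v poly_app n A q x) r = (\<Sum>j<N. coeff q j * ?w (Suc j))"
      using r by simp
    have 2: "vec_index (poly_app n A q x) r = (\<Sum>j<N. coeff q j * ?w j)"
      using r by (simp add: poly_app_def N_def)
    have "vec_index (poly_app n A ([:- a, 1:] * q) x) r = (\<Sum>j<Suc N. coeff ([:- a, 1:] * q) j * ?w j)"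
      unfolding poly_app_eq[OF deg] using r by (rule index_comb)
    also have "\<dots> = (\<Sum>j<Suc N. (case j of 0 \<Rightarrow> 0 | Suc k \<Rightarrow> coeff q k) * ?w j) - a * (\<Sum>j<Suc N. coeff q j * ?w j)"
      unfolding co by (simp only: left_diff_distrib sum_subtractf sum_distrib_left mult.assoc)
    also have "(\<Sum>j<Suc N. (case j of 0 \<Rightarrow> 0 | Suc k \<Rightarrow> coeff q k) * ?w j) = (\<Sum>j<N. coeff q j * ?w (Suc j))"
      unfolding sum.lessThan_Suc_shift by simp
    also have "(\<Sum>j<Suc N. coeff q j * ?w j) = (\<Sum>j<N. coeff q j * ?w j)" using N by simp
    finally show "vec_index (poly_app n A ([:- a, 1:] * q) x) r
        = vec_index (A *\<^sub>v poly_app n A q x - a \<cdot>\<^sub>v poly_app n A q x) r"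
      using r 1 2 A by (simp add: poly_app_def)
  qed (simp add: poly_app_def)
qed

lemma poly_app_quadratic_factor:
  assumes A: "A \<in> carrier_mat n n" and x: "x \<in> carrier_vec n"
  defines "y q \<equiv> poly_app n A q x"
  shows "y ([:a\<^sup>2 + b\<^sup>2, - 2 * a, 1:] * q)
    = A *\<^sub>v (A *\<^sub>v y q - a \<cdot>\<^sub>v y q) - a \<cdot>\<^sub>v (A *\<^sub>v y q - a \<cdot>\<^sub>v y q) + b\<^sup>2 \<cdot>\<^sub>v y q"
proof -
  have "[:a\<^sup>2 + b\<^sup>2, - 2 * a, 1:] * q = [:- a, 1:] * ([:- a, 1:] * q) + Polynomial.smult (b\<^sup>2) q"
    by (rule poly_eq_poly_eq_iff[THEN iffD1], rule ext) (simp add: algebra_simps power2_eq_square)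
  moreover have "y (p + Polynomial.smult c q) = y p + c \<cdot>\<^sub>v y q" for p c
  proof -
    define N where "N = Suc (max (degree p) (degree q))"
    have "degree (p + Polynomial.smult c q) \<le> max (degree p) (degree q)"
      by (rule degree_add_le) (auto intro: degree_smult_le[THEN order_trans])
    then have "degree (p + Polynomial.smult c q) < N" "degree p < N" "degree q < N" by (auto simp: N_def)
    note eq = this[THEN poly_app_eq]
    show ?thesis unfolding y_def eq
      by (rule eq_vecI) (auto simp: algebra_simps sum.distrib sum_distrib_left)
  qed
  ultimately show ?thesis unfolding y_def using poly_app_linear_factor[OF A x] by simp
qed

lemma scalar_prod_self_pos: "(x :: real Matrix.vec) \<in> carrier_vec n \<Longrightarrow> x \<noteq> 0\<^sub>v n \<Longrightarrow> 0 < scalar_prod x x"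
proof -
  assume x: "x \<in> carrier_vec n" "x \<noteq> 0\<^sub>v n"
  then obtain r where r: "r < n" "vec_index x r \<noteq> 0" by (metis carrier_vecD eq_vecI index_zero_vec)
  have "0 < (\<Sum>r<n. (vec_index x r)\<^sup>2)" using r by (intro sum_pos2[of _ r]) auto
  then show ?thesis using x by (simp add: scalar_prod_def power2_eq_square atLeast0LessThan)
qed

lemma diff_eq_0_vec:
  fixes u :: "real Matrix.vec"
  assumes "u \<in> carrier_vec n" "w \<in> carrier_vec n" "u - w = 0\<^sub>v n"
  shows "u = w"
proof (rule eq_vecI)
  fix r assume r: "r < dim_vec w"
  have "vec_index (u - w) r = vec_index (0\<^sub>v n) r" unfolding assms(3) ..
  then show "vec_index u r = vec_index w r" using assms(1,2) r by auto
qed (use assms in auto)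

lemma smult_eq_0_vec:
  fixes x :: "real Matrix.vec"
  assumes "x \<in> carrier_vec n" "a \<cdot>\<^sub>v x = 0\<^sub>v n" "a \<noteq> 0"
  shows "x = 0\<^sub>v n"
proof (rule eq_vecI)
  fix r assume r: "r < dim_vec (0\<^sub>v n :: real Matrix.vec)"
  have "vec_index (a \<cdot>\<^sub>v x) r = vec_index (0\<^sub>v n) r" unfolding assms(2) ..
  then show "vec_index x r = vec_index (0\<^sub>v n) r" using assms(1,3) r by auto
qed (use assms in auto)

text \<open>
  Let \<open>p\<close> be a nonzero polynomial of least degree with \<open>p(A) x = 0\<close>. A complex root of \<open>p\<close> gives a
  real linear or quadratic factor \<open>f\<close>, and \<open>y = (p / f)(A) x\<close> is nonzero by minimality while
  \<open>f(A) y = 0\<close>. A quadratic factor \<open>(X - a)\<^sup>2 + b\<^sup>2\<close> with \<open>b \<noteq> 0\<close> is impossible, since pairing with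
  \<open>y\<close> would give \<open>\<parallel>(A - a) y\<parallel>\<^sup>2 + b\<^sup>2 \<parallel>y\<parallel>\<^sup>2 = 0\<close> by symmetry; so \<open>f\<close> is linear and \<open>y\<close> is an
  eigenvector. That the eigenvector has the form \<open>q(A) x\<close> keeps it in every invariant subspace
  containing \<open>x\<close>, which is what the induction below needs.
\<close>
lemma sym_eigenvector_exists:
  assumes A: "A \<in> sym_mats n" and x: "x \<in> carrier_vec n" "x \<noteq> 0\<^sub>v n"
  shows "\<exists>p a. poly_app n A p x \<noteq> 0\<^sub>v n \<and> A *\<^sub>v poly_app n A p x = a \<cdot>\<^sub>v poly_app n A p x"
proof -
  have Ac: "A \<in> carrier_mat n n" using A by (simp add: sym_mats_def)
  define Z where "Z = {p. p \<noteq> 0 \<and> poly_app n A p x = 0\<^sub>v n}"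
  have "\<exists>p. p \<in> Z"
  proof -
    obtain c where c: "\<exists>l<Suc n. c l \<noteq> 0"
      "\<forall>r<n. (\<Sum>l<Suc n. c l * vec_index ((A ^\<^sub>m l) *\<^sub>v x) r) = 0"
      using underdetermined_system[of n "Suc n" "\<lambda>r l. vec_index ((A ^\<^sub>m l) *\<^sub>v x) r"] by auto
    define p where "p = (\<Sum>l<Suc n. monom (c l) l)"
    have co: "coeff p l = (if l < Suc n then c l else 0)" for l
      by (simp add: p_def coeff_sum coeff_monom sum.delta' del: sum.lessThan_Suc)
    have deg: "degree p < Suc n" using co by (metis leading_coeff_0_iff degree_0 zero_less_Suc)
    have "poly_app n A p x = 0\<^sub>v n" unfolding poly_app_eq[OF deg]
      by (rule eq_vecI) (use c co in \<open>simp_all add: \<close>)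
    moreover have "p \<noteq> 0" using c(1) co by (metis coeff_0)
    ultimately show ?thesis by (auto simp: Z_def)
  qed
  then obtain p where p: "p \<in> Z" "\<And>q. q \<in> Z \<Longrightarrow> degree p \<le> degree q"
    using exists_least_iff[of "\<lambda>d. \<exists>p\<in>Z. degree p = d"] by (metis not_le)
  have p0: "p \<noteq> 0" "poly_app n A p x = 0\<^sub>v n" using p by (auto simp: Z_def)
  have q0: "poly_app n A q x \<noteq> 0\<^sub>v n" if "p = f * q" "degree f > 0" for f q
  proof
    assume "poly_app n A q x = 0\<^sub>v n"
    then have "q \<in> Z" using that p0 by (auto simp: Z_def)
    moreover have "degree q < degree p" using that p0 by (simp add: degree_mult_eq)
    ultimately show False using p(2) by fastforce
  qed
  have "\<not> constant (poly (map_poly complex_of_real p))"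
  proof -
    have "degree p \<noteq> 0"
    proof
      assume "degree p = 0"
      then obtain a where a: "p = [:a:]" using degree_eq_zeroE by blast
      have "poly_app n A p x = a \<cdot>\<^sub>v x"
        by (rule eq_vecI) (use a x Ac in \<open>auto simp: poly_app_def\<close>)
      moreover have "a \<noteq> 0" using a p0 by auto
      ultimately have "x = 0\<^sub>v n" using p0(2) by (intro smult_eq_0_vec[OF x(1), of a]) simp_all
      then show False using x by simp
    qed
    then show ?thesis by (simp add: constant_degree)
  qed
  then obtain z where z: "poly (map_poly complex_of_real p) z = 0"
    using fundamental_theorem_of_algebra by blast
  define a b where "a = Re z" and "b = Im z"
  show ?thesis
  proof (cases "b = 0")
    case True
    then have "z = complex_of_real a" by (simp add: a_def b_def complex_eq_iff)
    then have "poly p a = 0" using z by (simp add: of_real_hom.poly_map_poly)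
    then obtain q where q: "p = [:- a, 1:] * q" by (auto simp: poly_eq_0_iff_dvd elim: dvdE)
    let ?y = "poly_app n A q x"
    have "A *\<^sub>v ?y - a \<cdot>\<^sub>v ?y = 0\<^sub>v n"
      using poly_app_linear_factor[OF Ac x(1), of a q] q p0(2) by simp
    moreover have "A *\<^sub>v ?y \<in> carrier_vec n" by (rule mult_mat_vec_carrier[OF Ac poly_app_carrier])
    ultimately have "A *\<^sub>v ?y = a \<cdot>\<^sub>v ?y" by (rule diff_eq_0_vec[of _ n, rotated 2]) simp_all
    then show ?thesis using q0[OF q] by auto
  next
    case False
    define f where "f = [:a\<^sup>2 + b\<^sup>2, - 2 * a, 1:]"
    have fz: "poly (map_poly complex_of_real f) z = 0"
    proof -
      have "z = Complex a b" by (simp add: a_def b_def)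
      then show ?thesis by (simp add: f_def complex_eq_iff power2_eq_square algebra_simps)
    qed
    define r where "r = p mod f"
    have r: "degree r < 2" using degree_mod_less'[of f p] by (cases "r = 0") (auto simp: f_def r_def)
    have p_eq: "p = p div f * f + r" by (simp add: r_def)
    interpret h: map_poly_comm_ring_hom "of_real :: real \<Rightarrow> complex" ..
    have "map_poly complex_of_real p
        = map_poly complex_of_real (p div f) * map_poly complex_of_real f + map_poly complex_of_real r"
      unfolding h.hom_add[symmetric] h.hom_mult[symmetric] by (rule arg_cong[OF p_eq])
    then have rz: "poly (map_poly complex_of_real r) z = 0" using z fz by simp
    have req: "r = [:coeff r 0, coeff r 1:]"
      using r by (intro poly_eqI) (auto simp: coeff_pCons coeff_eq_0 split: nat.split)
    have "poly (map_poly complex_of_real [:coeff r 0, coeff r 1:]) z = 0"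
      by (rule subst[OF req, of "\<lambda>r'. poly (map_poly complex_of_real r') z = 0", OF rz])
    then have "coeff r 1 * b = 0" "coeff r 0 + coeff r 1 * a = 0"
      unfolding of_real_hom.map_poly_pCons_hom
      by (auto simp: a_def b_def complex_eq_iff algebra_simps)
    then have "coeff r 1 = 0" "coeff r 0 = 0" using False by auto
    then have r0: "r = 0" using pCons_0_0 req by metis
    have q: "p = f * (p div f)"
      using p_eq unfolding r0 add_0_right mult.commute[of _ f] .
    let ?y = "poly_app n A (p div f) x"
    let ?w = "A *\<^sub>v ?y - a \<cdot>\<^sub>v ?y"
    have Ay: "A *\<^sub>v ?y \<in> carrier_vec n" by (rule mult_mat_vec_carrier[OF Ac poly_app_carrier])
    then have w: "?w \<in> carrier_vec n" by simp
    have Aw: "A *\<^sub>v ?w \<in> carrier_vec n" by (rule mult_mat_vec_carrier[OF Ac w])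
    have y: "?y \<noteq> 0\<^sub>v n" using q0[OF q] by (simp add: f_def)
    have "A *\<^sub>v ?w - a \<cdot>\<^sub>v ?w + b\<^sup>2 \<cdot>\<^sub>v ?y = 0\<^sub>v n"
      using poly_app_quadratic_factor[OF Ac x(1), of a b "p div f"] q p0(2) by (simp add: f_def)
    then have "0 = scalar_prod (A *\<^sub>v ?w - a \<cdot>\<^sub>v ?w + b\<^sup>2 \<cdot>\<^sub>v ?y) ?y" by simp
    also have "\<dots> = scalar_prod (A *\<^sub>v ?w) ?y - a * scalar_prod ?w ?y + b\<^sup>2 * scalar_prod ?y ?y"
      using Aw w by (simp add: add_scalar_prod_distrib[of _ n] minus_scalar_prod_distrib[of _ n])
    also have "scalar_prod (A *\<^sub>v ?w) ?y = scalar_prod ?w (A *\<^sub>v ?y)"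
      using A w by (intro sym_mats_scalar_prod) auto
    also have "scalar_prod ?w (A *\<^sub>v ?y) - a * scalar_prod ?w ?y = scalar_prod ?w ?w"
      using Ay w scalar_prod_minus_distrib[OF w, of "A *\<^sub>v ?y" "a \<cdot>\<^sub>v ?y"] by simp
    finally have "scalar_prod ?w ?w + b\<^sup>2 * scalar_prod ?y ?y = 0" by simp
    moreover have "0 < b\<^sup>2 * scalar_prod ?y ?y" using False y scalar_prod_self_pos[of ?y n] by simp
    moreover have "0 \<le> scalar_prod ?w ?w" by (simp add: scalar_prod_def sum_nonneg)
    ultimately show ?thesis by linarith
  qed
qed

definition orthonormal :: "nat \<Rightarrow> nat \<Rightarrow> (nat \<Rightarrow> real Matrix.vec) \<Rightarrow> bool" where
  "orthonormal n k v \<longleftrightarrow> (\<forall>j<k. v j \<in> carrier_vec n) \<and>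
     (\<forall>j<k. \<forall>l<k. scalar_prod (v j) (v l) = (if j = l then 1 else 0))"

text \<open>
  Induction on the number of eigenvectors: start from a vector orthogonal to those already found.
  The orthogonal complement of eigenvectors is invariant, so the eigenvector supplied by
  \<open>sym_eigenvector_exists\<close> stays orthogonal to them.
\<close>
lemma orthonormal_eigensystem:
  assumes A: "A \<in> sym_mats n"
  shows "k \<le> n \<Longrightarrow> \<exists>v \<mu>. orthonormal n k v \<and> (\<forall>j<k. A *\<^sub>v v j = \<mu> j \<cdot>\<^sub>v v j)"
proof (induction k)
  case 0
  show ?case by (simp add: orthonormal_def)
next
  case (Suc k)
  have Ac: "A \<in> carrier_mat n n" using A by (simp add: sym_mats_def)
  from Suc obtain v \<mu> where o: "orthonormal n k v" "\<forall>j<k. A *\<^sub>v v j = \<mu> j \<cdot>\<^sub>v v j" by auto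
  then have v: "\<And>j. j < k \<Longrightarrow> v j \<in> carrier_vec n"
    "\<And>j l. j < k \<Longrightarrow> l < k \<Longrightarrow> scalar_prod (v j) (v l) = (if j = l then 1 else 0)"
    "\<And>j. j < k \<Longrightarrow> A *\<^sub>v v j = \<mu> j \<cdot>\<^sub>v v j"
    by (simp_all add: orthonormal_def)
  obtain c where c: "\<exists>l<n. c l \<noteq> 0" "\<And>r. r < k \<Longrightarrow> (\<Sum>l<n. c l * vec_index (v r) l) = 0"
    using underdetermined_system[of k n "\<lambda>r l. vec_index (v r) l"] Suc.prems by auto
  define x where "x = Matrix.vec n c"
  have x: "x \<in> carrier_vec n" by (simp add: x_def)
  have x0: "x \<noteq> 0\<^sub>v n"
  proof
    assume "x = 0\<^sub>v n"
    then have "vec_index x l = 0" if "l < n" for l using that by simp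
    then show False using c(1) by (auto simp: x_def)
  qed
  have xv: "scalar_prod (v j) x = 0" if "j < k" for j
    using c(2)[OF that] v(1)[OF that] by (simp add: x_def scalar_prod_def atLeast0LessThan mult.commute)
  have pow: "scalar_prod (v j) ((A ^\<^sub>m l) *\<^sub>v x) = 0" if j: "j < k" for j l
  proof (induction l)
    case 0
    then show ?case using xv[OF j] Ac x by simp
  next
    case (Suc l)
    have "scalar_prod (v j) ((A ^\<^sub>m Suc l) *\<^sub>v x) = scalar_prod (A *\<^sub>v v j) ((A ^\<^sub>m l) *\<^sub>v x)"
      unfolding pow_mat_Suc_mult_vec[OF Ac x] using v(1)[OF j] Ac x
      by (intro sym_mats_scalar_prod[OF A, symmetric]) auto
    then show ?case using v(3)[OF j] v(1)[OF j] Ac x Suc by simp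
  qed
  obtain p a where y: "poly_app n A p x \<noteq> 0\<^sub>v n" "A *\<^sub>v poly_app n A p x = a \<cdot>\<^sub>v poly_app n A p x"
    using sym_eigenvector_exists[OF A x x0] by blast
  let ?y = "poly_app n A p x"
  have vy: "scalar_prod (v j) ?y = 0" if j: "j < k" for j
    unfolding poly_app_def using v(1)[OF j] Ac x pow[OF j] by (subst scalar_prod_comb) auto
  define s where "s = scalar_prod ?y ?y"
  have s: "s > 0" unfolding s_def using y(1) by (intro scalar_prod_self_pos[of _ n]) auto
  define w where "w = (1 / sqrt s) \<cdot>\<^sub>v ?y"
  have w: "w \<in> carrier_vec n" by (simp add: w_def)
  have ww: "scalar_prod w w = 1" using s
    by (simp add: w_def s_def[symmetric] field_simps)
  have vw: "scalar_prod (v j) w = 0" "scalar_prod w (v j) = 0" if j: "j < k" for j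
    using vy[OF j] v(1)[OF j] comm_scalar_prod[OF v(1)[OF j], of ?y] by (auto simp: w_def)
  have Aw: "A *\<^sub>v w = a \<cdot>\<^sub>v w"
  proof -
    have "A *\<^sub>v w = (1 / sqrt s) \<cdot>\<^sub>v (A *\<^sub>v ?y)"
      unfolding w_def using Ac by (intro mult_mat_vec) auto
    then show ?thesis unfolding y(2) by (simp add: w_def smult_smult_assoc mult.commute)
  qed
  have "orthonormal n (Suc k) (v(k := w))"
    unfolding orthonormal_def using v(1,2) w ww vw by (auto simp: less_Suc_eq)
  moreover have "\<forall>j<Suc k. A *\<^sub>v (v(k := w)) j = (\<mu>(k := a)) j \<cdot>\<^sub>v (v(k := w)) j"
    using v(3) Aw by (auto simp: less_Suc_eq)
  ultimately show ?case by blast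
qed

definition basis_mat :: "nat \<Rightarrow> (nat \<Rightarrow> real Matrix.vec) \<Rightarrow> real mat" where
  "basis_mat n v = Matrix.mat n n (\<lambda>(r, k). vec_index (v k) r)"

lemma basis_mat_orthogonal:
  assumes "orthonormal n n v"
  shows "transpose_mat (basis_mat n v) * basis_mat n v = 1\<^sub>m n"
    "basis_mat n v * transpose_mat (basis_mat n v) = 1\<^sub>m n"
proof -
  have col: "Matrix.col (basis_mat n v) k = v k" if "k < n" for k
    using assms that by (intro eq_vecI) (auto simp: orthonormal_def basis_mat_def)
  show 1: "transpose_mat (basis_mat n v) * basis_mat n v = 1\<^sub>m n"
  proof (rule eq_matI)
    fix r k assume "r < dim_row (1\<^sub>m n :: real mat)" "k < dim_col (1\<^sub>m n :: real mat)"
    then have rk: "r < n" "k < n" by auto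
    then have "(transpose_mat (basis_mat n v) * basis_mat n v) $$ (r, k) = scalar_prod (v r) (v k)"
      using col by (simp add: basis_mat_def)
    then show "(transpose_mat (basis_mat n v) * basis_mat n v) $$ (r, k) = 1\<^sub>m n $$ (r, k)"
      using assms rk by (simp add: orthonormal_def)
  qed (auto simp: basis_mat_def)
  show "basis_mat n v * transpose_mat (basis_mat n v) = 1\<^sub>m n"
    by (rule mat_mult_left_right_inverse[OF _ _ 1]) (auto simp: basis_mat_def)
qed

text \<open>
  For a square matrix \<open>V\<^sup>T V = 1\<close> implies \<open>V V\<^sup>T = 1\<close>; inserting the latter between the two vectors
  is the expansion in the orthonormal basis.
\<close>
lemma parseval:
  assumes v: "orthonormal n n v" and x: "x \<in> carrier_vec n" and y: "y \<in> carrier_vec n"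
  shows "scalar_prod x y = (\<Sum>k<n. scalar_prod (v k) x * scalar_prod (v k) y)"
proof -
  let ?V = "basis_mat n v"
  have V: "?V \<in> carrier_mat n n" by (simp add: basis_mat_def)
  have row: "vec_index (transpose_mat ?V *\<^sub>v x) k = scalar_prod (v k) x" if "k < n" "x \<in> carrier_vec n" for k x
  proof -
    have "Matrix.col ?V k = v k"
      using v that by (intro eq_vecI) (auto simp: orthonormal_def basis_mat_def)
    then show ?thesis using that V by (simp add: basis_mat_def)
  qed
  have "scalar_prod x y = scalar_prod x (1\<^sub>m n *\<^sub>v y)" using y by simp
  also have "\<dots> = scalar_prod x (?V *\<^sub>v (transpose_mat ?V *\<^sub>v y))"
    unfolding basis_mat_orthogonal(2)[OF v, symmetric]
    using V y by (subst assoc_mult_mat_vec[of _ n n _ n]) auto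
  also have "\<dots> = scalar_prod (transpose_mat ?V *\<^sub>v x) (transpose_mat ?V *\<^sub>v y)"
    using V x y by (intro transpose_vec_mult_scalar[symmetric]) auto
  also have "\<dots> = (\<Sum>k<n. scalar_prod (v k) x * scalar_prod (v k) y)"
    using row x y V by (simp add: scalar_prod_def[of "transpose_mat ?V *\<^sub>v x"] atLeast0LessThan)
  finally show ?thesis .
qed

text \<open>
  The matrix is similar to the diagonal matrix of the eigenvalues, and similar matrices share their
  characteristic polynomial. This ties the eigenvalues of a basis to the multiset of roots.
\<close>
lemma proots_char_poly_eigenbasis:
  assumes A: "A \<in> carrier_mat n n" and v: "orthonormal n n v"
    and ev: "\<And>k. k < n \<Longrightarrow> A *\<^sub>v v k = \<mu> k \<cdot>\<^sub>v v k"
  shows "proots (char_poly A) = mset (map \<mu> [0..<n])"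
proof -
  let ?V = "basis_mat n v"
  define D where "D = Matrix.mat n n (\<lambda>(i, j). if i = j then \<mu> i else 0)"
  have V: "?V \<in> carrier_mat n n" and D: "D \<in> carrier_mat n n" by (auto simp: basis_mat_def D_def)
  have col: "Matrix.col ?V k = v k" if "k < n" for k
    using v that by (intro eq_vecI) (auto simp: orthonormal_def basis_mat_def)
  have AV: "A * ?V = ?V * D"
  proof (rule eq_matI)
    fix r k assume "r < dim_row (?V * D)" "k < dim_col (?V * D)"
    then have rk: "r < n" "k < n" using V D by auto
    have "(A * ?V) $$ (r, k) = vec_index (A *\<^sub>v v k) r" using rk A V col by simp
    also have "\<dots> = \<mu> k * vec_index (v k) r"
    proof -
      have "v k \<in> carrier_vec n" using v rk by (simp add: orthonormal_def)
      then show ?thesis unfolding ev[OF rk(2)] using rk by simp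
    qed
    also have "\<dots> = (\<Sum>l<n. vec_index (v l) r * (if l = k then \<mu> l else 0))"
      using rk by (simp add: if_distrib[of "\<lambda>x. _ * x"] cong: if_cong)
    also have "\<dots> = (?V * D) $$ (r, k)" using rk
      by (simp add: scalar_prod_def basis_mat_def D_def atLeast0LessThan)
    finally show "(A * ?V) $$ (r, k) = (?V * D) $$ (r, k)" .
  qed (use A V D in auto)
  have "A = A * (?V * transpose_mat ?V)" using A by (simp add: basis_mat_orthogonal(2)[OF v])
  also have "\<dots> = ?V * D * transpose_mat ?V"
    unfolding AV[symmetric] using A V by (intro assoc_mult_mat[of _ n n _ n _ n, symmetric]) auto
  finally have "similar_mat_wit A D ?V (transpose_mat ?V)"
    using A V D basis_mat_orthogonal[OF v] by (intro similar_mat_witI) auto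
  then have "char_poly A = char_poly D" by (intro char_poly_similar) (auto simp: similar_mat_def)
  also have "\<dots> = (\<Prod>a\<leftarrow>diag_mat D. [:- a, 1:])"
    using D by (intro char_poly_upper_triangular) (auto simp: D_def upper_triangular_def)
  also have "diag_mat D = map \<mu> [0..<n]" using D by (auto simp: diag_mat_def D_def)
  finally have "char_poly A = (\<Prod>p\<leftarrow>map (\<lambda>a. [:- a, 1:]) (map \<mu> [0..<n]). p)" by simp
  also have "proots \<dots> = sum_list (map proots (map (\<lambda>a. [:- a, 1:]) (map \<mu> [0..<n])))"
    by (intro proots_prod_list) auto
  also have "\<dots> = mset (map \<mu> [0..<n])"
    by (induction n) (auto simp: )
  finally show ?thesis .
qed

text \<open>
  The eigenvalues of any orthonormal eigenbasis are the roots of the characteristic polynomial, so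
  permuting the basis makes its eigenvalues decreasing.
\<close>
theorem spectral_eigval:
  assumes A: "A \<in> sym_mats n"
  obtains v where "orthonormal n n v" "\<And>k. k < n \<Longrightarrow> A *\<^sub>v v k = eigval A (Suc k) \<cdot>\<^sub>v v k"
    "\<And>k l. k \<le> l \<Longrightarrow> l < n \<Longrightarrow> eigval A (Suc l) \<le> eigval A (Suc k)"
proof -
  have Ac: "A \<in> carrier_mat n n" using A by (simp add: sym_mats_def)
  obtain w \<mu> where w: "orthonormal n n w" "\<And>k. k < n \<Longrightarrow> A *\<^sub>v w k = \<mu> k \<cdot>\<^sub>v w k"
    using orthonormal_eigensystem[OF A, of n] by auto
  define xs where "xs = map \<mu> [0..<n]"
  define ys where "ys = rev (sorted_list_of_multiset (proots (char_poly A)))"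
  have ys: "ys = rev (sort xs)"
  proof -
    have "proots (char_poly A) = mset xs"
      unfolding xs_def using Ac w by (rule proots_char_poly_eigenbasis)
    then show ?thesis by (simp add: ys_def)
  qed
  then have "mset ys = mset xs" by simp
  then obtain p where p: "p permutes {..<length xs}" "permute_list p xs = ys"
    by (rule mset_eq_permutation)
  have len: "length xs = n" by (simp add: xs_def)
  have ysk: "ys ! k = \<mu> (p k)" "p k < n" if "k < n" for k
  proof -
    show pk: "p k < n" using permutes_in_image[OF p(1), of k] that len by simp
    have "ys ! k = xs ! p k" using p that len by (auto simp: permute_list_nth)
    then show "ys ! k = \<mu> (p k)" using pk by (simp add: xs_def)
  qed
  have ev: "eigval A (Suc k) = ys ! k" for k by (simp add: eigval_def ys_def)
  have inj: "p k = p l \<longleftrightarrow> k = l" for k l using permutes_inj[OF p(1)] by (auto simp: inj_def)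
  show ?thesis
  proof
    show "orthonormal n n (\<lambda>k. w (p k))" using w(1) ysk(2) inj by (auto simp: orthonormal_def)
    show "A *\<^sub>v w (p k) = eigval A (Suc k) \<cdot>\<^sub>v w (p k)" if "k < n" for k
      using w(2) ysk[OF that] ev by simp
    show "eigval A (Suc l) \<le> eigval A (Suc k)" if "k \<le> l" "l < n" for k l
      unfolding ev ys using that len sorted_rev_nth_mono[of "rev (sort xs)" k l] by simp
  qed
qed

section \<open>Chebyshev polynomials\<close>

fun cheb :: "nat \<Rightarrow> real poly" where
  "cheb 0 = 1"
| "cheb (Suc 0) = [:0, 1:]"
| "cheb (Suc (Suc n)) = [:0, 2:] * cheb (Suc n) - cheb n"

lemma degree_cheb: "degree (cheb n) \<le> n"
proof (induction n rule: cheb.induct)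
  case (3 n)
  have "degree ([:0, 2:] * cheb (Suc n)) \<le> Suc (Suc n)"
    using degree_mult_le[of "[:0, 2:] :: real poly" "cheb (Suc n)"] 3 by simp
  then show ?case using 3 by (auto intro: degree_diff_le)
qed auto

lemma cheb_cos: "poly (cheb n) (cos t) = cos (real n * t)"
proof (induction n rule: cheb.induct)
  case (3 n)
  have "cos (real (Suc (Suc n)) * t) + cos (real n * t) = 2 * cos t * cos (real (Suc n) * t)"
    using cos_plus_cos[of "real (Suc (Suc n)) * t" "real n * t"] by (simp add: algebra_simps add_divide_distrib)
  then show ?case using 3 by (simp add: algebra_simps)
qed auto

lemma cheb_cosh: "poly (cheb n) (cosh t) = cosh (real n * t)"
proof (induction n rule: cheb.induct)
  case (3 n)
  have "cosh (real (Suc n) * t + t) + cosh (real (Suc n) * t - t) = 2 * cosh t * cosh (real (Suc n) * t)"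
    unfolding cosh_add cosh_diff by simp
  then show ?case using 3 by (simp add: algebra_simps)
qed auto

lemma abs_cheb_le_1:
  assumes "\<bar>x\<bar> \<le> 1"
  shows "\<bar>poly (cheb n) x\<bar> \<le> 1"
  using cheb_cos[of n "arccos x"] assms by (simp add: cos_arccos_abs)

lemma cheb_mono:
  assumes "1 \<le> x" "x \<le> y"
  shows "0 < poly (cheb n) x" "poly (cheb n) x \<le> poly (cheb n) y"
proof -
  have c: "cosh (arcosh x) = x" "cosh (arcosh y) = y" "0 \<le> arcosh x" "0 \<le> arcosh y"
    using assms by (auto simp: cosh_arcosh_real)
  then have 1: "arcosh x \<le> arcosh y" "0 \<le> arcosh x"
    using assms cosh_real_nonneg_le_iff[of "arcosh x" "arcosh y"] by auto
  have x: "poly (cheb n) x = cosh (real n * arcosh x)" using cheb_cosh[of n "arcosh x"] assms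
    by (simp add: cosh_arcosh_real)
  have y: "poly (cheb n) y = cosh (real n * arcosh y)" using cheb_cosh[of n "arcosh y"] assms
    by (simp add: cosh_arcosh_real)
  show "0 < poly (cheb n) x" unfolding x by (rule cosh_real_pos)
  show "poly (cheb n) x \<le> poly (cheb n) y" unfolding x y
    using 1 by (subst cosh_real_nonneg_le_iff) (auto intro: mult_left_mono)
qed

text \<open>
  The right-hand side is \<open>2 artanh r\<close>; the difference of the two sides has derivative
  \<open>2 x\<^sup>2 / (1 - x\<^sup>2) \<ge> 0\<close>.
\<close>
lemma two_artanh_le:
  fixes r :: real
  assumes "0 \<le> r" "r < 1"
  shows "2 * r \<le> ln ((1 + r) / (1 - r))"
proof -
  define f where "f = (\<lambda>r::real. ln (1 + r) - ln (1 - r) - 2 * r)"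
  have "f 0 \<le> f r"
  proof (rule DERIV_nonneg_imp_nondecreasing[OF assms(1)])
    fix x assume x: "0 \<le> x" "x \<le> r"
    have "(f has_real_derivative (1 / (1 + x) + 1 / (1 - x) - 2)) (at x)"
      unfolding f_def using x assms by (auto intro!: derivative_eq_intros)
    moreover have "1 / (1 + x) + 1 / (1 - x) - 2 = 2 * x\<^sup>2 / ((1 + x) * (1 - x))"
    proof -
      have "1 + x \<noteq> 0" "1 - x \<noteq> 0" using x assms by auto
      then show ?thesis by (simp add: divide_simps) (simp add: power2_eq_square algebra_simps)
    qed
    moreover have "0 \<le> 2 * x\<^sup>2 / ((1 + x) * (1 - x))" using x assms by simp
    ultimately show "\<exists>y. (f has_real_derivative y) (at x) \<and> 0 \<le> y" by metis
  qed
  then show ?thesis using assms by (simp add: f_def ln_div)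
qed

text \<open>
  The argument is \<open>cosh t\<close> for \<open>t = ln ((1 + r) / (1 - r)) = 2 artanh r\<close>, so the value is
  \<open>cosh (d t) \<ge> exp (d t) / 2\<close>.
\<close>
lemma cheb_growth:
  fixes r :: real
  assumes "0 \<le> r" "r < 1"
  shows "exp (2 * real d * r) / 2 \<le> poly (cheb d) ((1 + r\<^sup>2) / (1 - r\<^sup>2))"
proof -
  define w where "w = (1 + r) / (1 - r)"
  have w: "w > 0" using assms by (simp add: w_def)
  have "cosh (ln w) = (w + inverse w) / 2" using cosh_ln_real[OF w] .
  also have "\<dots> = (1 + r\<^sup>2) / (1 - r\<^sup>2)"
  proof -
    have "1 - r\<^sup>2 = (1 - r) * (1 + r)" by (simp add: power2_eq_square algebra_simps)
    moreover have "w + inverse w = ((1 + r)\<^sup>2 + (1 - r)\<^sup>2) / ((1 - r) * (1 + r))"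
      using assms by (simp add: w_def field_simps power2_eq_square)
    moreover have "(1 + r)\<^sup>2 + (1 - r)\<^sup>2 = 2 * (1 + r\<^sup>2)" by (simp add: power2_eq_square algebra_simps)
    ultimately have "w + inverse w = 2 * (1 + r\<^sup>2) / (1 - r\<^sup>2)" by (simp only:)
    moreover have "x / 2 = p / q" if "x = 2 * p / q" for x p q :: real using that by simp
    ultimately show ?thesis by metis
  qed
  finally have "poly (cheb d) ((1 + r\<^sup>2) / (1 - r\<^sup>2)) = cosh (real d * ln w)"
    using cheb_cosh[of d "ln w"] by simp
  moreover have "exp (2 * real d * r) \<le> exp (real d * ln w)"
    using two_artanh_le[OF assms] mult_left_mono[of "2 * r" "ln w" "real d"] by (simp add: w_def mult_ac)
  moreover have "exp (real d * ln w) / 2 \<le> cosh (real d * ln w)"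
    unfolding cosh_def by simp
  ultimately show ?thesis by linarith
qed

text \<open>
  The filter polynomial: of modulus at most \<open>1\<close> on the unwanted part \<open>[a, b - \<epsilon> (b - a)]\<close> of the spectrum and
  exponentially large from \<open>b\<close> on. It is the Chebyshev polynomial composed with the affine map
  sending the interval onto \<open>[-1, 1]\<close>; this map sends \<open>b\<close> to \<open>(1 + \<epsilon>) / (1 - \<epsilon>)\<close>.
\<close>
lemma cheb_filter:
  fixes a b \<epsilon> :: real
  assumes "a < b" "0 < \<epsilon>" "\<epsilon> < 1"
  obtains q where "degree q \<le> d"
    "\<And>x. a \<le> x \<Longrightarrow> x \<le> b - \<epsilon> * (b - a) \<Longrightarrow> \<bar>poly q x\<bar> \<le> 1"
    "\<And>x. b \<le> x \<Longrightarrow> exp (4 * real d * sqrt \<epsilon>) / 4 \<le> (poly q x)\<^sup>2"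
proof -
  define s where "s = 2 / ((1 - \<epsilon>) * (b - a))"
  have s: "s > 0" using assms by (simp add: s_def)
  define q where "q = pcompose (cheb d) [:- s * a - 1, s:]"
  have q: "poly q x = poly (cheb d) (s * (x - a) - 1)" for x
    by (simp add: q_def poly_pcompose algebra_simps)
  show ?thesis
  proof
    have "degree q \<le> degree (cheb d) * degree [:- s * a - 1, s:]"
      unfolding q_def by (rule degree_pcompose_le)
    then show "degree q \<le> d" using degree_cheb[of d] s by simp
  next
    fix x assume x: "a \<le> x" "x \<le> b - \<epsilon> * (b - a)"
    have "s * (x - a) \<le> s * ((1 - \<epsilon>) * (b - a))"
      using x s by (intro mult_left_mono) (auto simp: algebra_simps)
    also have "\<dots> = 2" using assms unfolding s_def by (subst times_divide_eq_left) (subst nonzero_mult_div_cancel_right, auto)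
    finally have "s * (x - a) \<le> 2" .
    moreover have "0 \<le> s * (x - a)" using x s by simp
    ultimately show "\<bar>poly q x\<bar> \<le> 1" unfolding q by (intro abs_cheb_le_1) auto
  next
    fix x assume x: "b \<le> x"
    have r: "(sqrt \<epsilon>)\<^sup>2 = \<epsilon>" "0 \<le> sqrt \<epsilon>" "sqrt \<epsilon> < 1" using assms by auto
    have e: "s * (b - a) - 1 = (1 + \<epsilon>) / (1 - \<epsilon>)"
    proof -
      have "b - a \<noteq> 0" "1 - \<epsilon> \<noteq> 0" using assms by auto
      moreover have "2 / (p * q) * q - 1 = (2 - p) / p" if "p \<noteq> 0" "q \<noteq> 0" for p q :: real
        using that by (simp add: field_simps)
      ultimately have "s * (b - a) - 1 = (2 - (1 - \<epsilon>)) / (1 - \<epsilon>)" unfolding s_def by blast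
      then show ?thesis by simp
    qed
    have "1 \<le> (1 + \<epsilon>) / (1 - \<epsilon>)" using assms by simp
    moreover have "(1 + \<epsilon>) / (1 - \<epsilon>) \<le> s * (x - a) - 1" unfolding e[symmetric] using x s by simp
    ultimately have "poly (cheb d) ((1 + \<epsilon>) / (1 - \<epsilon>)) \<le> poly q x" unfolding q by (rule cheb_mono)
    with cheb_growth[of "sqrt \<epsilon>" d] r have "exp (2 * real d * sqrt \<epsilon>) / 2 \<le> poly q x" by simp
    then have "(exp (2 * real d * sqrt \<epsilon>) / 2)\<^sup>2 \<le> (poly q x)\<^sup>2" by (rule power_mono) simp
    moreover have "(exp (2 * real d * sqrt \<epsilon>) / 2)\<^sup>2 = exp (4 * real d * sqrt \<epsilon>) / 4"
      by (simp add: power2_eq_square mult_exp_exp)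
    ultimately show "exp (4 * real d * sqrt \<epsilon>) / 4 \<le> (poly q x)\<^sup>2" by simp
  qed
qed

section \<open>Ritz values and a pointwise error bound\<close>

locale eigenbasis =
  fixes n :: nat and A :: "real mat" and v :: "nat \<Rightarrow> real Matrix.vec"
  assumes n_pos: "0 < n"
    and A_sym: "A \<in> sym_mats n"
    and v_orthonormal: "orthonormal n n v"
    and A_v: "\<And>k. k < n \<Longrightarrow> A *\<^sub>v v k = eigval A (Suc k) \<cdot>\<^sub>v v k"
    and eigval_antimono: "\<And>k l. k \<le> l \<Longrightarrow> l < n \<Longrightarrow> eigval A (Suc l) \<le> eigval A (Suc k)"
begin

text \<open>
  Indices of the basis start at \<open>0\<close>, those of \<open>eigval\<close> at \<open>1\<close>.
\<close>
abbreviation lam :: "nat \<Rightarrow> real" where "lam k \<equiv> eigval A (Suc k)"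

lemma A_carrier: "A \<in> carrier_mat n n" using A_sym by (simp add: sym_mats_def)

lemma dim_A [simp]: "dim_row A = n" "dim_col A = n" using A_carrier by auto

lemma v_carrier: "k < n \<Longrightarrow> v k \<in> carrier_vec n" using v_orthonormal by (simp add: orthonormal_def)

lemma lam_last: "eigval A n = lam (n - 1)" using n_pos by simp

lemma lam_ge_last: "k < n \<Longrightarrow> eigval A n \<le> lam k" unfolding lam_last by (rule eigval_antimono) auto

lemma lam_le_first: "k < n \<Longrightarrow> lam k \<le> eigval A 1" using eigval_antimono[of 0 k] by simp

lemma v_A:
  assumes "k < n" "x \<in> carrier_vec n"
  shows "scalar_prod (v k) (A *\<^sub>v x) = lam k * scalar_prod (v k) x"
proof -
  have "scalar_prod (v k) (A *\<^sub>v x) = scalar_prod (A *\<^sub>v v k) x"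
    using sym_mats_scalar_prod[OF A_sym v_carrier[OF assms(1)] assms(2)] by simp
  then show ?thesis using A_v[OF assms(1)] v_carrier[OF assms(1)] assms(2) by simp
qed

lemma v_pow_A:
  assumes "k < n" "b \<in> carrier_vec n"
  shows "scalar_prod (v k) ((A ^\<^sub>m j) *\<^sub>v b) = lam k ^ j * scalar_prod (v k) b"
proof (induction j)
  case 0
  then show ?case using assms A_carrier by simp
next
  case (Suc j)
  then show ?case unfolding pow_mat_Suc_mult_vec[OF A_carrier assms(2)]
    using assms A_carrier by (subst v_A) auto
qed

text \<open>
  In the eigenbasis, \<open>p(A) b\<close> has the components \<open>p(\<lambda>) \<cdot> \<langle>v, b\<rangle>\<close>: questions on Krylov spaces
  become questions on polynomials at the eigenvalues.
\<close>
lemma v_krylov: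
  assumes "k < n" "b \<in> carrier_vec n"
  shows "scalar_prod (v k) (comb n m c (\<lambda>j. (A ^\<^sub>m j) *\<^sub>v b))
    = (\<Sum>j<m. c j * lam k ^ j) * scalar_prod (v k) b"
  using assms A_carrier v_carrier
  by (subst scalar_prod_comb) (auto simp: v_pow_A sum_distrib_right mult.assoc)

lemma norm2: "x \<in> carrier_vec n \<Longrightarrow> scalar_prod x x = (\<Sum>k<n. (scalar_prod (v k) x)\<^sup>2)"
  using parseval[OF v_orthonormal, of x x] by (simp add: power2_eq_square)

lemma energy: "x \<in> carrier_vec n \<Longrightarrow> scalar_prod x (A *\<^sub>v x) = (\<Sum>k<n. lam k * (scalar_prod (v k) x)\<^sup>2)"
  using parseval[OF v_orthonormal, of x "A *\<^sub>v x"] A_carrier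
  by (simp add: v_A power2_eq_square mult_ac)

text \<open>
  Comparing a Rayleigh quotient with a number is a sign condition on a diagonal quadratic form.
\<close>
lemma rayleigh_ge_iff:
  assumes "x \<in> carrier_vec n" "x \<noteq> 0\<^sub>v n"
  shows "\<rho> \<le> rayleigh A x \<longleftrightarrow> 0 \<le> (\<Sum>k<n. (lam k - \<rho>) * (scalar_prod (v k) x)\<^sup>2)"
    "\<rho> < rayleigh A x \<longleftrightarrow> 0 < (\<Sum>k<n. (lam k - \<rho>) * (scalar_prod (v k) x)\<^sup>2)"
    "rayleigh A x \<le> \<rho> \<longleftrightarrow> (\<Sum>k<n. (lam k - \<rho>) * (scalar_prod (v k) x)\<^sup>2) \<le> 0"
proof -
  have "0 < scalar_prod x x" by (rule scalar_prod_self_pos[OF assms])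
  moreover have "(\<Sum>k<n. (lam k - \<rho>) * (scalar_prod (v k) x)\<^sup>2)
      = scalar_prod x (A *\<^sub>v x) - \<rho> * scalar_prod x x"
    unfolding energy[OF assms(1)] norm2[OF assms(1)]
    by (simp add: left_diff_distrib sum_subtractf sum_distrib_left)
  ultimately show "\<rho> \<le> rayleigh A x \<longleftrightarrow> 0 \<le> (\<Sum>k<n. (lam k - \<rho>) * (scalar_prod (v k) x)\<^sup>2)"
    "\<rho> < rayleigh A x \<longleftrightarrow> 0 < (\<Sum>k<n. (lam k - \<rho>) * (scalar_prod (v k) x)\<^sup>2)"
    "rayleigh A x \<le> \<rho> \<longleftrightarrow> (\<Sum>k<n. (lam k - \<rho>) * (scalar_prod (v k) x)\<^sup>2) \<le> 0"
    unfolding rayleigh_def by (auto simp: pos_le_divide_eq pos_less_divide_eq pos_divide_le_eq)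
qed

lemma rayleigh_bounds:
  assumes "x \<in> carrier_vec n" "x \<noteq> 0\<^sub>v n"
  shows "eigval A n \<le> rayleigh A x" "rayleigh A x \<le> eigval A 1"
  unfolding rayleigh_ge_iff(1)[OF assms] rayleigh_ge_iff(3)[OF assms]
  using lam_ge_last lam_le_first
  by (auto intro!: sum_nonneg sum_nonpos mult_nonneg_nonneg mult_nonpos_nonneg)

definition feasible :: "nat \<Rightarrow> nat \<Rightarrow> real Matrix.vec \<Rightarrow> real Matrix.vec set set" where
  "feasible m i b = {U \<in> subspaces_of_dim n i. U \<subseteq> krylov m A b}"

lemma ritz_eq: "ritz m i A b = (SUP U \<in> feasible m i b. INF x \<in> U - {0\<^sub>v n}. rayleigh A x)"
  by (simp add: ritz_def feasible_def)

lemma subspace_carrier: "U \<in> subspaces_of_dim n i \<Longrightarrow> U \<subseteq> carrier_vec n"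
  by (auto simp: subspaces_of_dim_iff)

lemma subspace_nontrivial:
  assumes "U \<in> subspaces_of_dim n i" "0 < i"
  shows "U - {0\<^sub>v n} \<noteq> {}"
proof -
  obtain u where u: "indep n i u" "U = range (\<lambda>c. comb n i c u)"
    using assms by (auto simp: subspaces_of_dim_iff)
  have "comb n i (\<lambda>_. 1) u \<noteq> 0\<^sub>v n" using u(1) assms(2) by (auto simp: indep_def)
  then show ?thesis using u(2) by auto
qed

lemma INF_rayleigh_le:
  assumes "U \<in> subspaces_of_dim n i" "x \<in> U" "x \<noteq> 0\<^sub>v n"
  shows "(INF x \<in> U - {0\<^sub>v n}. rayleigh A x) \<le> rayleigh A x"
proof (rule cINF_lower)
  show "bdd_below (rayleigh A ` (U - {0\<^sub>v n}))"
    using rayleigh_bounds(1) subspace_carrier[OF assms(1)] by (intro bdd_belowI2[of _ "eigval A n"]) auto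
qed (use assms in auto)

text \<open>
  The easy half of the Courant--Fischer principle: \<open>i - 1\<close> orthogonality conditions leave a nonzero
  vector in an \<open>i\<close>-dimensional space, and its Rayleigh quotient only sees eigenvalues from the
  \<open>i\<close>-th on.
\<close>
lemma INF_rayleigh_le_eigval:
  assumes "U \<in> subspaces_of_dim n i" "1 \<le> i" "i \<le> n"
  shows "(INF x \<in> U - {0\<^sub>v n}. rayleigh A x) \<le> eigval A i"
proof -
  obtain u where u: "\<And>l. l < i \<Longrightarrow> u l \<in> carrier_vec n" "indep n i u" "U = range (\<lambda>c. comb n i c u)"
    using assms by (auto simp: subspaces_of_dim_iff)
  obtain c where c: "\<exists>l<i. c l \<noteq> 0" "\<And>r. r < i - 1 \<Longrightarrow> (\<Sum>l<i. c l * scalar_prod (v r) (u l)) = 0"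
    using underdetermined_system[of "i - 1" i "\<lambda>r l. scalar_prod (v r) (u l)"] assms by auto
  let ?x = "comb n i c u"
  have x: "?x \<in> U" "?x \<noteq> 0\<^sub>v n" using u c by (auto simp: indep_def)
  have vx: "scalar_prod (v k) ?x = 0" if "k < i - 1" for k
    using c(2)[OF that] that assms u v_carrier[of k] by (subst scalar_prod_comb) auto
  have "(lam k - eigval A i) * (scalar_prod (v k) ?x)\<^sup>2 \<le> 0" if "k < n" for k
  proof (cases "k < i - 1")
    case False
    then have "lam k \<le> eigval A i" using eigval_antimono[of "i - 1" k] that assms by simp
    then show ?thesis by (intro mult_nonpos_nonneg) auto
  qed (simp add: vx)
  then have "rayleigh A ?x \<le> eigval A i"
    using x by (subst rayleigh_ge_iff(3)) (auto intro!: sum_nonpos)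
  then show ?thesis using INF_rayleigh_le[OF assms(1) x] by simp
qed

lemma ritz_le_eigval:
  assumes "feasible m i b \<noteq> {}" "1 \<le> i" "i \<le> n"
  shows "ritz m i A b \<le> eigval A i"
  unfolding ritz_eq using assms INF_rayleigh_le_eigval
  by (intro cSUP_least) (auto simp: feasible_def)

text \<open>
  One trial space bounds the Ritz value from below; the supremum is over a bounded set by
  \<open>INF_rayleigh_le_eigval\<close>.
\<close>
lemma ritz_ge:
  assumes U: "U \<in> feasible m i b" and i: "1 \<le> i" "i \<le> n"
    and \<rho>: "\<And>x. x \<in> U \<Longrightarrow> x \<noteq> 0\<^sub>v n \<Longrightarrow> \<rho> \<le> rayleigh A x"
  shows "\<rho> \<le> ritz m i A b"
proof -
  have "\<rho> \<le> (INF x \<in> U - {0\<^sub>v n}. rayleigh A x)"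
    using U subspace_nontrivial[of U i] i \<rho> by (intro cINF_greatest) (auto simp: feasible_def)
  also have "\<dots> \<le> ritz m i A b" unfolding ritz_eq
    using INF_rayleigh_le_eigval i
    by (intro cSUP_upper U bdd_aboveI2[of _ _ "eigval A i"]) (auto simp: feasible_def)
  finally show ?thesis .
qed

lemma rel_err_bounds:
  assumes "feasible m i b \<noteq> {}" "1 \<le> i" "i \<le> n"
  shows "0 \<le> rel_err m i A b" "rel_err m i A b \<le> 1"
proof -
  obtain U where U: "U \<in> feasible m i b" using assms by auto
  have "eigval A n \<le> ritz m i A b"
    using U subspace_carrier by (intro ritz_ge[OF U assms(2,3)] rayleigh_bounds) (auto simp: feasible_def)
  moreover have "ritz m i A b \<le> eigval A i" by (rule ritz_le_eigval[OF assms])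
  ultimately show "0 \<le> rel_err m i A b" "rel_err m i A b \<le> 1"
    by (auto simp: rel_err_def divide_le_eq_1)
qed

lemma eigval_separation:
  assumes i: "i \<le> n" and g: "0 < gap i A" and kl: "k < i" "l < i" "k \<noteq> l"
  shows "2 * gap i A * (eigval A 1 - eigval A n) \<le> \<bar>lam k - lam l\<bar>"
proof -
  have *: "2 * gap i A * (eigval A 1 - eigval A n) \<le> lam k - lam l" if kl: "k < l" "l < i" for k l
  proof -
    have i2: "i \<ge> 2" using kl by simp
    let ?f = "\<lambda>k. (eigval A (k - 1) - eigval A k) / (eigval A 1 - eigval A (dim_row A))"
    have "Min (?f ` {2..i}) \<le> ?f (k + 2)"
      by (rule Min_le[OF finite_imageI imageI]) (use kl in auto)
    then have le: "2 * gap i A \<le> (lam k - lam (Suc k)) / (eigval A 1 - eigval A n)"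
      using i2 by (simp add: gap_def)
    then have "0 < (lam k - lam (Suc k)) / (eigval A 1 - eigval A n)" using g by linarith
    moreover have "0 \<le> eigval A 1 - eigval A n" using lam_ge_last[of 0] n_pos by simp
    ultimately have "0 < eigval A 1 - eigval A n" by (cases "eigval A 1 = eigval A n") auto
    then have "2 * gap i A * (eigval A 1 - eigval A n) \<le> lam k - lam (Suc k)"
      using le by (simp add: pos_le_divide_eq)
    moreover have "lam l \<le> lam (Suc k)" using kl i by (intro eigval_antimono) auto
    ultimately show ?thesis by simp
  qed
  show ?thesis using *[of k l] *[of l k] kl by (cases "k < l") (auto simp: abs_if)
qed

text \<open>
  The trial space consists of the vectors \<open>(q R)(A) b\<close>, where \<open>q\<close> is the Chebyshev filter of degree
  \<open>d\<close> for the interval from \<open>\<lambda>\<^sub>n\<close> to \<open>\<lambda>\<^sub>i\<close> and \<open>R\<close> runs through the polynomials of degree less than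
  \<open>i\<close>. Writing \<open>R\<close> in the Lagrange basis at \<open>\<lambda>\<^sub>1, \<dots>, \<lambda>\<^sub>i\<close> with coefficients \<open>c\<close>, the leading
  components are \<open>q(\<lambda>\<^sub>k) c\<^sub>k \<langle>v\<^sub>k, b\<rangle>\<close>, bounded below by the growth of \<open>q\<close> and by \<open>t\<close>; elsewhere
  \<open>R\<^sup>2 \<le> L \<Sum>c\<^sub>k\<^sup>2\<close> with \<open>L = i / (2 gap) ^ (2 (i - 1))\<close>, because differences of distinct nodes are at least
  \<open>2 gap (\<lambda>\<^sub>1 - \<lambda>\<^sub>n)\<close>. So lowering the target from \<open>\<lambda>\<^sub>i - \<epsilon> (\<lambda>\<^sub>i - \<lambda>\<^sub>n)\<close> by the second summand of the
  bound (times \<open>\<lambda>\<^sub>i - \<lambda>\<^sub>n\<close>) makes the leading components outweigh all eigenvalues below the target.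
\<close>
theorem rel_err_le_components:
  assumes i: "1 \<le> i" "i \<le> n" and g: "0 < gap i A"
    and b: "b \<in> carrier_vec n" "scalar_prod b b = 1"
    and t: "0 < t" "\<And>k. k < i \<Longrightarrow> t \<le> \<bar>scalar_prod (v k) b\<bar>"
    and \<epsilon>: "0 < \<epsilon>" "\<epsilon> < 1" and ne: "eigval A n < eigval A i"
  shows "feasible (d + i) i b \<noteq> {}"
    "rel_err (d + i) i A b \<le> \<epsilon> + 4 * (real i * (1 / (2 * gap i A)) ^ (2 * (i - 1))) * exp (- (4 * real d * sqrt \<epsilon>)) / t\<^sup>2"
proof -
  define \<gamma> where "\<gamma> = 2 * gap i A"
  have \<gamma>: "0 < \<gamma>" using g by (simp add: \<gamma>_def)
  define span where "span = eigval A 1 - eigval A n"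
  define g where "g = eigval A i - eigval A n"
  have g: "0 < g" using ne by (simp add: g_def)
  have "i - 1 < n" using i by linarith
  then have span: "0 < span" using lam_le_first[of "i - 1"] i ne by (simp add: span_def)
  have sep: "\<gamma> * span \<le> \<bar>lam k - lam l\<bar>" if "k < i" "l < i" "k \<noteq> l" for k l
    unfolding \<gamma>_def span_def using eigval_separation[OF i(2) assms(3) that] by simp
  have sep0: "lam k \<noteq> lam l" if "k < i" "l < i" "k \<noteq> l" for k l
  proof
    assume "lam k = lam l"
    then have "\<gamma> * span \<le> 0" using sep[OF that] by simp
    then show False using mult_pos_pos[OF \<gamma> span] by linarith
  qed
  define \<beta> where "\<beta> = (\<lambda>k. scalar_prod (v k) b)"
  have \<beta>: "(\<Sum>k<n. (\<beta> k)\<^sup>2) = 1" using norm2[OF b(1)] b(2) by (simp add: \<beta>_def)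
  obtain q where q: "degree q \<le> d"
    "\<And>x. eigval A n \<le> x \<Longrightarrow> x \<le> eigval A i - \<epsilon> * g \<Longrightarrow> \<bar>poly q x\<bar> \<le> 1"
    "\<And>x. eigval A i \<le> x \<Longrightarrow> exp (4 * real d * sqrt \<epsilon>) / 4 \<le> (poly q x)\<^sup>2"
    using cheb_filter[OF ne \<epsilon>, of d] unfolding g_def by blast
  define K where "K = exp (4 * real d * sqrt \<epsilon>) / 4"
  have K: "0 < K" by (simp add: K_def)
  \<comment> \<open>the Lagrange basis polynomials at the leading eigenvalues\<close>
  define ell where "ell = (\<lambda>k. \<Prod>l\<in>{..<i} - {k}. Polynomial.smult (1 / (lam k - lam l)) [:- lam l, 1:])"
  have poly_ell: "poly (ell k) x = (\<Prod>l\<in>{..<i} - {k}. (x - lam l) / (lam k - lam l))" for k x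
    by (simp add: ell_def poly_prod diff_divide_distrib)
  have ell_delta: "poly (ell k) (lam j) = (if k = j then 1 else 0)" if "k < i" "j < i" for k j
  proof (cases "k = j")
    case True
    then show ?thesis unfolding poly_ell using sep0 that by (auto intro!: prod.neutral)
  next
    case False
    then have "(\<Prod>l\<in>{..<i} - {k}. (lam j - lam l) / (lam k - lam l)) = 0"
      using that by (intro prod_zero) auto
    then show ?thesis unfolding poly_ell using False by simp
  qed
  have deg_ell: "degree (ell k) \<le> i - 1" if "k < i" for k
  proof -
    have "degree (ell k) \<le> (\<Sum>l\<in>{..<i} - {k}. degree (Polynomial.smult (1 / (lam k - lam l)) [:- lam l, 1:]))"
      unfolding ell_def using degree_prod_sum_le[of "{..<i} - {k}" "\<lambda>l. Polynomial.smult (1 / (lam k - lam l)) [:- lam l, 1:]"]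
      by (simp add: o_def)
    also have "\<dots> \<le> (\<Sum>l\<in>{..<i} - {k}. 1)" by (intro sum_mono) (auto intro: degree_smult_le[THEN order_trans])
    finally show ?thesis using that by simp
  qed
  define L where "L = real i * (1 / \<gamma>) ^ (2 * (i - 1))"
  have L: "0 < L" using i \<gamma> by (simp add: L_def)
  have ell_bound: "(poly (ell k) (lam j))\<^sup>2 \<le> (1 / \<gamma>) ^ (2 * (i - 1))" if "k < i" "j < n" for k j
  proof -
    have "\<bar>poly (ell k) (lam j)\<bar> \<le> (\<Prod>l\<in>{..<i} - {k}. 1 / \<gamma>)"
      unfolding poly_ell abs_prod
    proof (rule prod_mono)
      fix l assume l: "l \<in> {..<i} - {k}"
      have "\<bar>lam j - lam l\<bar> \<le> span" unfolding span_def
        using lam_le_first[of j] lam_le_first[of l] lam_ge_last[of j] lam_ge_last[of l] that l i by auto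
      moreover have s: "\<gamma> * span \<le> \<bar>lam k - lam l\<bar>" using sep[of k l] that l by auto
      moreover have "0 < \<bar>lam k - lam l\<bar>" using s mult_pos_pos[OF \<gamma> span] by linarith
      ultimately have "\<bar>lam j - lam l\<bar> / \<bar>lam k - lam l\<bar> \<le> span / (\<gamma> * span)"
        using \<gamma> span by (intro frac_le) auto
      then show "0 \<le> \<bar>(lam j - lam l) / (lam k - lam l)\<bar> \<and> \<bar>(lam j - lam l) / (lam k - lam l)\<bar> \<le> 1 / \<gamma>"
        using span by (simp add: abs_divide)
    qed
    also have "\<dots> = (1 / \<gamma>) ^ (i - 1)" using that by simp
    finally have "\<bar>poly (ell k) (lam j)\<bar>\<^sup>2 \<le> ((1 / \<gamma>) ^ (i - 1))\<^sup>2" by (rule power_mono) simp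
    then show ?thesis by (simp add: power_mult[symmetric] mult.commute)
  qed
  define u where "u = (\<lambda>k. comb n (d + i) (coeff (q * ell k)) (\<lambda>j. (A ^\<^sub>m j) *\<^sub>v b))"
  have u: "u k \<in> carrier_vec n" for k by (simp add: u_def)
  have vu: "scalar_prod (v j) (u k) = poly q (lam j) * poly (ell k) (lam j) * \<beta> j" if "k < i" "j < n" for j k
  proof -
    have "degree (q * ell k) < d + i"
      using degree_mult_le[of q "ell k"] q(1) deg_ell[OF that(1)] i by linarith
    then have "(\<Sum>l<d + i. coeff (q * ell k) l * lam j ^ l) = poly (q * ell k) (lam j)"
      unfolding poly_altdef by (intro sum.mono_neutral_right) (auto simp: coeff_eq_0)
    then show ?thesis unfolding u_def by (subst v_krylov) (use that b \<beta>_def in auto)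
  qed
  define R where "R = (\<lambda>c x. \<Sum>k<i. c k * poly (ell k) x)"
  have vx: "scalar_prod (v j) (comb n i c u) = poly q (lam j) * R c (lam j) * \<beta> j" if "j < n" for j c
    using that v_carrier u by (subst scalar_prod_comb) (auto simp: vu R_def sum_distrib_left sum_distrib_right mult_ac)
  have R_node: "R c (lam j) = c j" if "j < i" for j c
  proof -
    have "R c (lam j) = (\<Sum>k<i. if k = j then c k else 0)"
      unfolding R_def using that by (intro sum.cong) (auto simp: ell_delta)
    then show ?thesis using that by simp
  qed
  have q_top: "K \<le> (poly q (lam j))\<^sup>2" if "j < i" for j
    unfolding K_def using that i eigval_antimono[of j "i - 1"] by (intro q(3)) simp
  have \<beta>_top: "t\<^sup>2 \<le> (\<beta> j)\<^sup>2" if "j < i" for j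
    using power_mono[OF t(2)[OF that], of 2] t(1) by (simp add: \<beta>_def)
  have R_bound: "(R c (lam j))\<^sup>2 \<le> L * (\<Sum>k<i. (c k)\<^sup>2)" if "j < n" for c j
  proof -
    have "(R c (lam j))\<^sup>2 \<le> (\<Sum>k<i. (c k)\<^sup>2) * (\<Sum>k<i. (poly (ell k) (lam j))\<^sup>2)"
      unfolding R_def by (rule Cauchy_Schwarz_ineq_sum)
    also have "(\<Sum>k<i. (poly (ell k) (lam j))\<^sup>2) \<le> (\<Sum>k<i. (1 / \<gamma>) ^ (2 * (i - 1)))"
      using ell_bound that by (intro sum_mono) auto
    finally have "(R c (lam j))\<^sup>2 \<le> (\<Sum>k<i. (c k)\<^sup>2) * (\<Sum>k<i. (1 / \<gamma>) ^ (2 * (i - 1)))"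
      by (simp add: mult_left_mono sum_nonneg)
    then show ?thesis by (simp add: L_def mult.commute)
  qed
  \<comment> \<open>The excess of the leading components over the target must pay for the rest of the spectrum: \<open>X K t\<^sup>2 = L\<close>.\<close>
  define X where "X = L / (K * t\<^sup>2)"
  have X: "0 < X" using L K t by (simp add: X_def)
  have Xg: "0 < X * g" and \<epsilon>g: "0 < \<epsilon> * g" using X g \<epsilon> by auto
  define \<rho> where "\<rho> = eigval A i - (\<epsilon> + X) * g"
  have ind: "indep n i u"
    unfolding indep_def
  proof (intro allI impI)
    fix c j assume c: "comb n i c u = 0\<^sub>v n" and j: "j < i"
    then have "poly q (lam j) * c j * \<beta> j = 0"
      using vx[of j c] v_carrier[of j] R_node[OF j] i by simp
    moreover have "poly q (lam j) \<noteq> 0" using q_top[OF j] K by auto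
    moreover have "\<beta> j \<noteq> 0" using \<beta>_top[OF j] t(1) by auto
    ultimately show "c j = 0" by simp
  qed
  define U where "U = range (\<lambda>c. comb n i c u)"
  have "U \<in> subspaces_of_dim n i" unfolding subspaces_of_dim_iff U_def using u ind by blast
  moreover have "U \<subseteq> krylov (d + i) A b"
    unfolding krylov_eq[OF A_carrier b(1)] U_def
    using comb_comb[of i u n "d + i" "\<lambda>k. coeff (q * ell k)"] by (auto simp: u_def)
  ultimately have U: "U \<in> feasible (d + i) i b" by (simp add: feasible_def)
  then show "feasible (d + i) i b \<noteq> {}" by auto
  have "\<rho> \<le> ritz (d + i) i A b"
  proof (rule ritz_ge[OF U i])
    fix x assume "x \<in> U" and x0: "x \<noteq> 0\<^sub>v n"
    then obtain c where x: "x = comb n i c u" by (auto simp: U_def)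
    define S where "S = (\<Sum>k<i. (c k)\<^sup>2)"
    have S: "0 \<le> S" by (simp add: S_def sum_nonneg)
    define f where "f = (\<lambda>j. (lam j - \<rho>) * (poly q (lam j) * R c (lam j) * \<beta> j)\<^sup>2)"
    have top: "g * L * (c j)\<^sup>2 \<le> f j" if j: "j < i" for j
    proof -
      have "eigval A i \<le> lam j" using eigval_antimono[of j "i - 1"] j i by simp
      then have 1: "X * g \<le> lam j - \<rho>" using \<epsilon>g by (simp add: \<rho>_def distrib_right)
      have "K * t\<^sup>2 \<le> (poly q (lam j))\<^sup>2 * (\<beta> j)\<^sup>2"
        using q_top[OF j] \<beta>_top[OF j] K by (intro mult_mono) auto
      then have 2: "K * t\<^sup>2 * (c j)\<^sup>2 \<le> (poly q (lam j) * R c (lam j) * \<beta> j)\<^sup>2"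
        unfolding R_node[OF j] using mult_right_mono[of "K * t\<^sup>2" "(poly q (lam j))\<^sup>2 * (\<beta> j)\<^sup>2" "(c j)\<^sup>2"]
        by (simp add: power_mult_distrib mult_ac)
      have "(X * g) * (K * t\<^sup>2 * (c j)\<^sup>2) \<le> f j" unfolding f_def
        using 1 2 Xg K by (intro mult_mono) auto
      moreover have "(X * g) * (K * t\<^sup>2 * (c j)\<^sup>2) = g * L * (c j)\<^sup>2"
        using K t by (simp add: X_def field_simps)
      ultimately show ?thesis by simp
    qed
    \<comment> \<open>Eigenvalues within \<open>\<epsilon> g\<close> of the \<open>i\<close>-th one lie above the target; on the others \<open>q\<close> is at most 1.\<close>
    have bot: "- (g * L * S) * (\<beta> j)\<^sup>2 \<le> f j" if j: "i \<le> j" "j < n" for j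
    proof (cases "lam j \<le> eigval A i - \<epsilon> * g")
      case True
      have "\<bar>poly q (lam j)\<bar> \<le> 1" using q(2)[OF _ True] lam_ge_last j by simp
      then have "(poly q (lam j))\<^sup>2 \<le> 1" by (simp add: abs_square_le_1)
      then have "(poly q (lam j))\<^sup>2 * (R c (lam j))\<^sup>2 \<le> 1 * (L * S)"
        using R_bound[OF j(2), of c] by (intro mult_mono) (auto simp: S_def)
      then have "(poly q (lam j) * R c (lam j) * \<beta> j)\<^sup>2 \<le> L * S * (\<beta> j)\<^sup>2"
        by (simp add: power_mult_distrib mult_right_mono)
      then have 1: "g * (poly q (lam j) * R c (lam j) * \<beta> j)\<^sup>2 \<le> g * (L * S * (\<beta> j)\<^sup>2)"
        using g by (intro mult_left_mono) auto
      have "- g \<le> lam j - \<rho>"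
        using lam_ge_last[OF j(2)] \<epsilon>g Xg by (simp add: \<rho>_def g_def distrib_right)
      then have "- g * (poly q (lam j) * R c (lam j) * \<beta> j)\<^sup>2 \<le> f j"
        unfolding f_def by (rule mult_right_mono) simp
      then show ?thesis using 1 by (simp add: mult_ac)
    next
      case False
      then have "\<rho> \<le> lam j" using Xg by (simp add: \<rho>_def distrib_right)
      then have "0 \<le> f j" by (simp add: f_def)
      moreover have "0 \<le> g * L * S * (\<beta> j)\<^sup>2" using g L S by simp
      ultimately show ?thesis by simp
    qed
    have split: "{..<n} = {..<i} \<union> {i..<n}" using i by auto
    have "0 \<le> g * L * S * (1 - (\<Sum>j\<in>{i..<n}. (\<beta> j)\<^sup>2))"
    proof -
      have "(\<Sum>j\<in>{i..<n}. (\<beta> j)\<^sup>2) \<le> (\<Sum>j<n. (\<beta> j)\<^sup>2)" by (intro sum_mono2) auto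
      then show ?thesis using \<beta> g L S by simp
    qed
    also have "\<dots> = (\<Sum>j<i. g * L * (c j)\<^sup>2) + (\<Sum>j\<in>{i..<n}. - (g * L * S) * (\<beta> j)\<^sup>2)"
      unfolding sum_distrib_left[symmetric] S_def[symmetric] by (simp add: algebra_simps)
    also have "\<dots> \<le> (\<Sum>j<i. f j) + (\<Sum>j\<in>{i..<n}. f j)"
      using top bot by (intro add_mono sum_mono) auto
    also have "\<dots> = (\<Sum>j<n. f j)" unfolding split by (subst sum.union_disjoint) auto
    finally have "0 \<le> (\<Sum>j<n. (lam j - \<rho>) * (scalar_prod (v j) x)\<^sup>2)"
      unfolding f_def x by (simp add: vx)
    then show "\<rho> \<le> rayleigh A x" using x0 x by (subst rayleigh_ge_iff(1)) auto
  qed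
  then have "eigval A i - ritz (d + i) i A b \<le> (\<epsilon> + X) * g" by (simp add: \<rho>_def)
  then have "rel_err (d + i) i A b \<le> \<epsilon> + X"
    using g unfolding rel_err_def dim_A g_def[symmetric] by (simp add: pos_divide_le_eq)
  also have "X = 4 * L * exp (- (4 * real d * sqrt \<epsilon>)) / t\<^sup>2"
    by (simp add: X_def K_def exp_minus field_simps)
  finally show "rel_err (d + i) i A b \<le> \<epsilon> + 4 * (real i * (1 / (2 * gap i A)) ^ (2 * (i - 1))) * exp (- (4 * real d * sqrt \<epsilon>)) / t\<^sup>2"
    unfolding L_def \<gamma>_def .
qed

end

section \<open>The uniform measure on the sphere\<close>

abbreviation lborel_n :: "nat set \<Rightarrow> (nat \<Rightarrow> real) measure" where
  "lborel_n I \<equiv> Pi\<^sub>M I (\<lambda>_. lborel)"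

lemma measurable_shear [measurable]:
  assumes "j \<in> I" "k \<in> I"
  shows "(\<lambda>x. x(j := x j + a * x k)) \<in> measurable (lborel_n I) (lborel_n I)"
proof -
  have "(\<lambda>x. \<lambda>l\<in>I. if l = j then x j + a * x k else x l) \<in> measurable (lborel_n I) (lborel_n I)"
    using assms by (intro measurable_restrict) (auto simp: measurable_lborel2)
  moreover have "(\<lambda>l\<in>I. if l = j then x j + a * x k else x l) = x(j := x j + a * x k)"
    if "x \<in> space (lborel_n I)" for x
    using that assms by (auto simp: space_PiM PiE_def extensional_def fun_eq_iff)
  ultimately show ?thesis by (subst (asm) measurable_cong) auto
qed

text \<open>
  Integrating over the coordinate \<open>j\<close> first, a shear is a translation.
\<close>
lemma nn_integral_shear:
  assumes I: "finite I" "j \<in> I" "k \<in> I" "j \<noteq> k" and f [measurable]: "f \<in> borel_measurable (lborel_n I)"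
  shows "(\<integral>\<^sup>+x. f (x(j := x j + a * x k)) \<partial>lborel_n I) = (\<integral>\<^sup>+x. f x \<partial>lborel_n I)"
proof -
  interpret product_sigma_finite "\<lambda>_. lborel" by standard
  define J where "J = I - {j}"
  have J: "finite J" "j \<notin> J" "I = insert j J" using I by (auto simp: J_def)
  have fJ: "f \<in> borel_measurable (lborel_n (insert j J))" using f J by simp
  have g: "(\<lambda>x. f (x(j := x j + a * x k))) \<in> borel_measurable (lborel_n (insert j J))"
    using measurable_compose[OF measurable_shear[OF I(2,3)] f] J(3) by simp
  have "(\<integral>\<^sup>+x. f (x(j := x j + a * x k)) \<partial>lborel_n I)
      = (\<integral>\<^sup>+x. \<integral>\<^sup>+y. f (x(j := y + a * x k)) \<partial>lborel \<partial>lborel_n J)"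
    unfolding J(3) using I(4) by (subst product_nn_integral_insert[OF J(1,2) g]) auto
  also have "\<dots> = (\<integral>\<^sup>+x. \<integral>\<^sup>+y. f (x(j := y)) \<partial>lborel \<partial>lborel_n J)"
  proof (rule nn_integral_cong)
    fix x assume "x \<in> space (lborel_n J)"
    then have "(\<lambda>y. f (x(j := y))) \<in> borel_measurable lborel"
      by (intro measurable_compose[OF measurable_component_update fJ]) (use J in auto)
    then have "(\<lambda>y. f (x(j := y))) \<in> borel_measurable borel" by simp
    from nn_integral_real_affine[OF this, of 1 "a * x k"]
    show "(\<integral>\<^sup>+y. f (x(j := y + a * x k)) \<partial>lborel) = (\<integral>\<^sup>+y. f (x(j := y)) \<partial>lborel)"
      by (simp add: add.commute)
  qed
  also have "\<dots> = (\<integral>\<^sup>+x. f x \<partial>lborel_n I)"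
    unfolding J(3) by (rule product_nn_integral_insert[OF J(1,2) fJ, symmetric])
  finally show ?thesis .
qed

text \<open>
  A rotation by an angle other than \<open>\<pi>\<close> is a product of three shears; the outer ones have the factor
  \<open>s / (1 + c)\<close>, the tangent of half the angle.
\<close>
lemma nn_integral_plane_rotation:
  fixes c s :: real
  assumes I: "finite I" "j \<in> I" "k \<in> I" "j \<noteq> k" and f [measurable]: "f \<in> borel_measurable (lborel_n I)"
    and cs: "c\<^sup>2 + s\<^sup>2 = 1" "c \<noteq> -1"
  shows "(\<integral>\<^sup>+x. f (x(j := c * x j - s * x k, k := s * x j + c * x k)) \<partial>lborel_n I) = (\<integral>\<^sup>+x. f x \<partial>lborel_n I)"
proof -
  define \<tau> where "\<tau> = s / (1 + c)"
  define S1 where "S1 = (\<lambda>x :: nat \<Rightarrow> real. x(j := x j + (- \<tau>) * x k))"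
  define S2 where "S2 = (\<lambda>x :: nat \<Rightarrow> real. x(k := x k + s * x j))"
  have m: "S1 \<in> measurable (lborel_n I) (lborel_n I)" "S2 \<in> measurable (lborel_n I) (lborel_n I)"
    unfolding S1_def S2_def by (intro measurable_shear I)+
  have c1: "1 + c \<noteq> 0" using cs by (metis add.commute add_eq_0_iff2)
  have "s * s = (1 - c) * (1 + c)" using cs by (simp add: power2_eq_square algebra_simps)
  then have t1: "\<tau> * s = 1 - c" using c1 by (simp add: \<tau>_def)
  have t2: "\<tau> * (1 + c) = s" using c1 by (simp add: \<tau>_def)
  have t3: "\<tau> + \<tau> * c = s" using t2 by (simp add: algebra_simps)
  have eq: "S1 (S2 (S1 x)) = x(j := c * x j - s * x k, k := s * x j + c * x k)" for x
  proof -
    have k: "x k + s * (x j - \<tau> * x k) = s * x j + c * x k"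
    proof -
      have "x k + s * (x j - \<tau> * x k) = s * x j + (1 - \<tau> * s) * x k" by (simp add: algebra_simps)
      then show ?thesis using t1 by simp
    qed
    have "x j - \<tau> * x k - \<tau> * (s * x j + c * x k) = (1 - \<tau> * s) * x j - (\<tau> + \<tau> * c) * x k"
      by (simp add: algebra_simps)
    then have "x j - \<tau> * x k - \<tau> * (s * x j + c * x k) = c * x j - s * x k" using t1 t3 by simp
    then show ?thesis using I(4) k by (auto simp: S1_def S2_def fun_eq_iff)
  qed
  have 1: "(\<integral>\<^sup>+x. g (S1 x) \<partial>lborel_n I) = (\<integral>\<^sup>+x. g x \<partial>lborel_n I)"
    if "g \<in> borel_measurable (lborel_n I)" for g
    unfolding S1_def by (rule nn_integral_shear[OF I that])
  have 2: "(\<integral>\<^sup>+x. g (S2 x) \<partial>lborel_n I) = (\<integral>\<^sup>+x. g x \<partial>lborel_n I)"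
    if "g \<in> borel_measurable (lborel_n I)" for g
    unfolding S2_def by (rule nn_integral_shear[OF I(1,3,2) I(4)[symmetric] that])
  have "(\<integral>\<^sup>+x. f x \<partial>lborel_n I) = (\<integral>\<^sup>+x. f (S1 x) \<partial>lborel_n I)" by (rule 1[OF f, symmetric])
  also have "\<dots> = (\<integral>\<^sup>+x. f (S1 (S2 x)) \<partial>lborel_n I)"
    by (rule 2[OF measurable_compose[OF m(1) f], symmetric])
  also have "\<dots> = (\<integral>\<^sup>+x. f (S1 (S2 (S1 x))) \<partial>lborel_n I)"
    by (rule 1[OF measurable_compose[OF m(2) measurable_compose[OF m(1) f]], symmetric])
  finally show ?thesis unfolding eq by simp
qed

definition slab :: "nat \<Rightarrow> real \<Rightarrow> (nat \<Rightarrow> real) \<Rightarrow> (nat \<Rightarrow> real) set" where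
  "slab n t w = {x \<in> space (lborel_n {..<n}). \<bar>\<Sum>j<n. w j * x j\<bar> \<le> t \<and> (\<Sum>j<n. (x j)\<^sup>2) \<le> 1}"

lemma slab_measurable [measurable]: "slab n t w \<in> sets (lborel_n {..<n})"
  unfolding slab_def by measurable

text \<open>
  Rotations in the planes of the coordinates \<open>0\<close> and \<open>k\<close> remove the components of the normal vector one
  by one, until it is a multiple of the first unit vector. They preserve the ball and the volume.
\<close>
lemma emeasure_slab_rotate:
  assumes w: "(\<Sum>j<n. (w j)\<^sup>2) = 1" and z: "\<And>j. k < j \<Longrightarrow> j < n \<Longrightarrow> w j = 0" and n: "k < n"
  shows "emeasure (lborel_n {..<n}) (slab n t w) = emeasure (lborel_n {..<n}) (slab n t (\<lambda>j. if j = 0 then 1 else 0))"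
  using w z n
proof (induction k arbitrary: w)
  case 0
  have "(\<Sum>j<n. g j) = g 0" if "\<And>j. j > 0 \<Longrightarrow> j < n \<Longrightarrow> g j = 0" for g :: "nat \<Rightarrow> real"
    using that 0(3) by (subst sum.mono_neutral_right[of _ "{0}"]) auto
  note s = this
  have "(w 0)\<^sup>2 = 1" using 0 s[of "\<lambda>j. (w j)\<^sup>2"] by simp
  then have "\<bar>w 0\<bar> = 1" by (auto simp: power2_eq_1_iff)
  moreover have "(\<Sum>j<n. w j * x j) = w 0 * x 0" "(\<Sum>j<n. (if j = 0 then 1 else 0) * x j) = x 0" for x
    using 0 s[of "\<lambda>j. w j * x j"] s[of "\<lambda>j. (if j = 0 then 1 else 0) * x j"] by simp_all
  ultimately have "slab n t w = slab n t (\<lambda>j. if j = 0 then 1 else 0)"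
    unfolding slab_def by (simp add: abs_mult)
  then show ?case by simp
next
  case (Suc k)
  show ?case
  proof (cases "w (Suc k) = 0")
    case True
    then have "w j = 0" if "k < j" "j < n" for j
      using Suc.prems(2)[of j] that by (cases "j = Suc k") auto
    then show ?thesis using Suc.prems by (intro Suc.IH) auto
  next
    case False
    define r where "r = sqrt ((w 0)\<^sup>2 + (w (Suc k))\<^sup>2)"
    have r2: "r\<^sup>2 = (w 0)\<^sup>2 + (w (Suc k))\<^sup>2" by (simp add: r_def)
    have r: "r > 0" using False by (simp add: r_def sum_power2_gt_zero_iff)
    define c s where "c = w 0 / r" and "s = - (w (Suc k) / r)"
    have "c\<^sup>2 = (w 0)\<^sup>2 / r\<^sup>2" "s\<^sup>2 = (w (Suc k))\<^sup>2 / r\<^sup>2"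
      by (simp_all add: c_def s_def power_divide)
    then have "c\<^sup>2 + s\<^sup>2 = r\<^sup>2 / r\<^sup>2" unfolding r2 by (simp only: add_divide_distrib)
    then have cs: "c\<^sup>2 + s\<^sup>2 = 1" using r by simp
    have s0: "s \<noteq> 0" using False r by (simp add: s_def)
    then have c: "c \<noteq> -1" using cs by auto
    define w' where "w' = w(0 := r, Suc k := 0)"
    define R where "R = (\<lambda>x :: nat \<Rightarrow> real. x(0 := c * x 0 - s * x (Suc k), Suc k := s * x 0 + c * x (Suc k)))"
    have split: "(\<Sum>j<n. g j) = g 0 + g (Suc k) + (\<Sum>j\<in>{..<n} - {0, Suc k}. g j)" for g :: "nat \<Rightarrow> real"
      using Suc.prems(3) by (subst sum.subset_diff[of "{0, Suc k}"]) auto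
    have w'1: "(\<Sum>j<n. (w' j)\<^sup>2) = 1"
      using Suc.prems(1) r2 unfolding split by (simp add: w'_def)
    have R1: "(\<Sum>j<n. w' j * R x j) = (\<Sum>j<n. w j * x j)" for x
    proof -
      have "r * (c * x 0 - s * x (Suc k)) = w 0 * x 0 + w (Suc k) * x (Suc k)"
        using r by (simp add: c_def s_def field_simps)
      then show ?thesis unfolding split by (simp add: w'_def R_def)
    qed
    have R2: "(\<Sum>j<n. (R x j)\<^sup>2) = (\<Sum>j<n. (x j)\<^sup>2)" for x
    proof -
      have "(c * x 0 - s * x (Suc k))\<^sup>2 + (s * x 0 + c * x (Suc k))\<^sup>2 = (c\<^sup>2 + s\<^sup>2) * ((x 0)\<^sup>2 + (x (Suc k))\<^sup>2)"
        by (simp add: power2_eq_square algebra_simps)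
      then show ?thesis unfolding split cs by (simp add: R_def)
    qed
    have Rsp: "R x \<in> space (lborel_n {..<n}) \<longleftrightarrow> x \<in> space (lborel_n {..<n})" for x
      using Suc.prems(3) by (auto simp: R_def space_PiM PiE_def extensional_def)
    have "emeasure (lborel_n {..<n}) (slab n t w) = (\<integral>\<^sup>+x. indicator (slab n t w) x \<partial>lborel_n {..<n})"
      by simp
    also have "\<dots> = (\<integral>\<^sup>+x. indicator (slab n t w') (R x) \<partial>lborel_n {..<n})"
      by (rule nn_integral_cong) (auto simp: indicator_def slab_def Rsp R1 R2)
    also have "\<dots> = (\<integral>\<^sup>+x. indicator (slab n t w') x \<partial>lborel_n {..<n})"
      unfolding R_def using Suc.prems(3) cs c by (intro nn_integral_plane_rotation) auto
    also have "\<dots> = emeasure (lborel_n {..<n}) (slab n t w')" by simp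
    also have "\<dots> = emeasure (lborel_n {..<n}) (slab n t (\<lambda>j. if j = 0 then 1 else 0))"
    proof (rule Suc.IH)
      show "w' j = 0" if "k < j" "j < n" for j
        using Suc.prems(2)[of j] that by (cases "j = Suc k") (auto simp: w'_def)
    qed (use w'1 Suc.prems in auto)
    finally show ?thesis .
  qed
qed

lemma emeasure_axis_slab:
  assumes n: "0 < n" and t: "0 \<le> t"
  shows "emeasure (lborel_n {..<n}) (slab n t (\<lambda>j. if j = 0 then 1 else 0)) \<le> ennreal (2 * t * unit_ball_vol (real (n - 1)))"
proof -
  interpret product_sigma_finite "\<lambda>_. lborel" by standard
  define J where "J = {..<n} - {0}"
  have J: "finite J" "0 \<notin> J" "{..<n} = insert 0 J" "card J = n - 1" using n by (auto simp: J_def)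
  let ?S = "slab n t (\<lambda>j. if j = 0 then 1 else 0)"
  let ?B = "{f. sqrt (\<Sum>i\<in>J. (f i)\<^sup>2) \<le> 1} \<inter> space (lborel_n J)"
  have meas: "(\<lambda>x. indicator ?S x :: ennreal) \<in> borel_measurable (lborel_n (insert 0 J))"
    unfolding J(3)[symmetric] by measurable
  have "emeasure (lborel_n {..<n}) ?S = (\<integral>\<^sup>+x. indicator ?S x \<partial>lborel_n (insert 0 J))"
    unfolding J(3)[symmetric] by simp
  also have "\<dots> = (\<integral>\<^sup>+x. \<integral>\<^sup>+y. indicator ?S (x(0 := y)) \<partial>lborel \<partial>lborel_n J)"
    by (rule product_nn_integral_insert[OF J(1,2) meas])
  also have "\<dots> \<le> (\<integral>\<^sup>+x. \<integral>\<^sup>+y. indicator ?B x * indicator {-t..t} y \<partial>lborel \<partial>lborel_n J)"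
  proof (intro nn_integral_mono)
    fix x y assume x: "x \<in> space (lborel_n J)"
    have e0: "(\<Sum>j<n. (if j = 0 then 1 else 0) * (x(0 := y)) j) = y"
    proof -
      have "(\<Sum>j<n. (if j = 0 then 1 else 0) * (x(0 := y)) j) = (\<Sum>j<n. if j = 0 then y else 0)"
        by (rule sum.cong) auto
      then show ?thesis using n by simp
    qed
    have e1: "(\<Sum>j<n. ((x(0 := y)) j)\<^sup>2) = y\<^sup>2 + (\<Sum>j\<in>J. (x j)\<^sup>2)"
    proof -
      have "(\<Sum>j\<in>J. ((x(0 := y)) j)\<^sup>2) = (\<Sum>j\<in>J. (x j)\<^sup>2)"
        using J(2) by (intro sum.cong) auto
      then show ?thesis unfolding J(3) sum.insert[OF J(1,2)] by simp
    qed
    have "x(0 := y) \<in> ?S \<Longrightarrow> x \<in> ?B \<and> y \<in> {-t..t}"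
    proof -
      assume "x(0 := y) \<in> ?S"
      then have *: "\<bar>y\<bar> \<le> t" "y\<^sup>2 + (\<Sum>j\<in>J. (x j)\<^sup>2) \<le> 1"
        unfolding slab_def mem_Collect_eq e0 e1 by auto
      then have "(\<Sum>j\<in>J. (x j)\<^sup>2) \<le> 1" using zero_le_power2[of y] by linarith
      then show "x \<in> ?B \<and> y \<in> {-t..t}" using x *(1) by (auto simp: abs_le_iff)
    qed
    then show "indicator ?S (x(0 := y)) \<le> (indicator ?B x * indicator {-t..t} y :: ennreal)"
      by (cases "x(0 := y) \<in> ?S") simp_all
  qed
  also have "\<dots> = (\<integral>\<^sup>+x. indicator ?B x * ennreal (2 * t) \<partial>lborel_n J)"
  proof (rule nn_integral_cong)
    fix x
    have "(\<integral>\<^sup>+y. indicator ?B x * indicator {-t..t} y \<partial>lborel) = indicator ?B x * emeasure lborel {-t..t}"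
      by (rule nn_integral_cmult_indicator) simp
    then show "(\<integral>\<^sup>+y. indicator ?B x * indicator {-t..t} y \<partial>lborel) = indicator ?B x * ennreal (2 * t)"
      using t by simp
  qed
  also have "\<dots> = emeasure (lborel_n J) ?B * ennreal (2 * t)"
    by (subst nn_integral_multc) auto
  also have "emeasure (lborel_n J) ?B = ennreal (unit_ball_vol (real (n - 1)))"
    using emeasure_cball_aux[OF J(1), of 1] J(4) by simp
  also have "ennreal (unit_ball_vol (real (n - 1))) * ennreal (2 * t) = ennreal (2 * t * unit_ball_vol (real (n - 1)))"
    using t by (simp add: ennreal_mult[symmetric] mult.commute)
  finally show ?thesis .
qed

text \<open>
  Logarithmic convexity of the Gamma function at the midpoint of \<open>x\<close> and \<open>x + 1\<close>.
\<close>
lemma Gamma_half_step: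
  fixes x :: real
  assumes x: "0 < x"
  shows "Gamma (x + 1/2) \<le> Gamma x * sqrt x"
proof -
  have pos: "0 < Gamma x" "0 < Gamma (x + 1/2)" using x by (auto intro!: Gamma_real_pos)
  have "(ln \<circ> Gamma) ((1 - 1/2) *\<^sub>R x + (1/2) *\<^sub>R (x + 1))
      \<le> (1 - 1/2) * (ln \<circ> Gamma) x + (1/2) * (ln \<circ> Gamma) (x + 1)"
    using x by (intro convex_onD[OF log_convex_Gamma_real]) simp_all
  moreover have "(1 - 1/2) *\<^sub>R x + (1/2) *\<^sub>R (x + 1) = x + 1/2" by (simp add: field_simps)
  ultimately have le: "ln (Gamma (x + 1/2)) \<le> (ln (Gamma x) + ln (Gamma (x + 1))) / 2" by simp
  have G1: "Gamma (x + 1) = x * Gamma x" using x by (intro Gamma_plus1) (auto elim: nonpos_Ints_cases)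
  have l1: "ln (x * Gamma x) = ln x + ln (Gamma x)" using x pos by (intro ln_mult_pos) auto
  have l2: "ln (Gamma x * sqrt x) = ln (Gamma x) + ln x / 2"
    using x pos by (subst ln_mult_pos) (auto simp: ln_sqrt)
  have "ln (Gamma (x + 1/2)) \<le> ln (Gamma x * sqrt x)" using le unfolding G1 l1 l2 by (simp add: field_simps)
  then show ?thesis using x pos by (subst (asm) ln_le_cancel_iff) auto
qed

lemma unit_ball_vol_ratio:
  assumes "0 < n"
  shows "unit_ball_vol (real (n - 1)) \<le> sqrt (real n) * unit_ball_vol (real n)"
proof -
  obtain k where n: "n = Suc k" using assms by (cases n) auto
  define x :: real where "x = real k / 2 + 1"
  have x: "0 < x" by (simp add: x_def)
  have n1: "1 \<le> real n" using n by simp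
  have "x \<le> 2 * real n" by (simp add: x_def n)
  also have "\<dots> \<le> pi * real n" using pi_ge_two by (intro mult_right_mono) auto
  finally have sx: "sqrt x \<le> sqrt pi * sqrt (real n)" by (simp add: real_sqrt_mult[symmetric])
  have pos: "0 < Gamma x" "0 < Gamma (x + 1/2)" using x by (auto intro!: Gamma_real_pos)
  have "Gamma (x + 1/2) \<le> Gamma x * (sqrt pi * sqrt (real n))"
    using Gamma_half_step[OF x] mult_left_mono[OF sx, of "Gamma x"] pos(1) by linarith
  then have G: "1 / Gamma x \<le> sqrt (real n) * (sqrt pi / Gamma (x + 1/2))"
    using pos by (simp add: divide_simps mult_ac)
  have e: "real n / 2 + 1 = x + 1/2" by (simp add: x_def n add_divide_distrib)
  have p: "pi powr (real n / 2) = pi powr (real k / 2) * sqrt pi"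
    by (simp add: n add_divide_distrib powr_add powr_half_sqrt)
  have "pi powr (real k / 2) * (1 / Gamma x) \<le> pi powr (real k / 2) * (sqrt (real n) * (sqrt pi / Gamma (x + 1/2)))"
    using G by (rule mult_left_mono) simp
  then have "pi powr (real k / 2) / Gamma x
      \<le> sqrt (real n) * (pi powr (real k / 2) * sqrt pi / Gamma (x + 1/2))" by (simp add: mult_ac)
  moreover have "unit_ball_vol (real (n - 1)) = pi powr (real k / 2) / Gamma x"
    by (simp add: unit_ball_vol_def n x_def)
  moreover have "unit_ball_vol (real n) = pi powr (real k / 2) * sqrt pi / Gamma (x + 1/2)"
    unfolding unit_ball_vol_def e p ..
  ultimately show ?thesis by simp
qed

lemma punctured_ball_measurable: "punctured_ball n \<in> sets (lborel_n {..<n})"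
proof -
  have "punctured_ball n = {x \<in> space (lborel_n {..<n}). 0 < (\<Sum>j<n. (x j)\<^sup>2) \<and> (\<Sum>j<n. (x j)\<^sup>2) \<le> 1}"
    by (auto simp: punctured_ball_def space_PiM)
  also have "\<dots> \<in> sets (lborel_n {..<n})" by measurable
  finally show ?thesis .
qed

text \<open>
  Removing the centre does not change the volume, as a point is a null set in positive dimension.
\<close>
lemma emeasure_punctured_ball:
  assumes "0 < n"
  shows "emeasure (lborel_n {..<n}) (punctured_ball n) = ennreal (unit_ball_vol (real n))"
proof -
  interpret product_sigma_finite "\<lambda>_. lborel" by standard
  let ?M = "lborel_n {..<n}"
  let ?B = "{f. sqrt (\<Sum>i\<in>{..<n}. (f i)\<^sup>2) \<le> 1} \<inter> space ?M"
  let ?O = "PiE {..<n} (\<lambda>_. {0 :: real})"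
  have O: "?O \<in> sets ?M" by (intro sets_PiM_I_finite) auto
  have "emeasure ?M ?O = (\<Prod>j<n. emeasure lborel {0 :: real})" by (intro emeasure_PiM) auto
  then have O0: "emeasure ?M ?O = 0" using assms by simp
  have B: "?B \<in> sets ?M" by measurable
  have "punctured_ball n = ?B - ?O"
  proof (intro equalityI subsetI)
    fix x assume x: "x \<in> punctured_ball n"
    then have "x \<notin> ?O" by (auto simp: punctured_ball_def PiE_def Pi_def)
    then show "x \<in> ?B - ?O" using x by (auto simp: punctured_ball_def space_PiM)
  next
    fix x assume x: "x \<in> ?B - ?O"
    then have e: "x \<in> {..<n} \<rightarrow>\<^sub>E UNIV" by (auto simp: space_PiM)
    have "\<exists>j<n. x j \<noteq> 0"
    proof (rule ccontr)
      assume "\<not> (\<exists>j<n. x j \<noteq> 0)"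
      then have "x = (\<lambda>j\<in>{..<n}. 0)" using e by (auto simp: PiE_iff fun_eq_iff extensional_def)
      then have "x \<in> ?O" by auto
      then show False using x by blast
    qed
    then obtain j where j: "j < n" "x j \<noteq> 0" by blast
    have "0 < (\<Sum>j<n. (x j)\<^sup>2)" using j by (intro sum_pos2[of _ j]) auto
    then show "x \<in> punctured_ball n" using x e by (auto simp: punctured_ball_def)
  qed
  then have "emeasure ?M (punctured_ball n) = emeasure ?M ?B"
    using emeasure_Diff_null_set[of ?O ?M ?B] O O0 B by (simp add: null_sets_def)
  also have "\<dots> = ennreal (unit_ball_vol (real n))"
    using emeasure_cball_aux[of "{..<n}" 1] by simp
  finally show ?thesis .
qed

lemma measurable_coordinate:
  assumes "j < n"
  shows "(\<lambda>b. vec_index b j) \<in> borel_measurable (restrict_space (vec_borel n) (unit_sphere n))"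
proof (rule measurable_restrict_space1)
  have "(\<lambda>x. \<lambda>j\<in>{..<n}. vec_index x j) \<in> measurable (vec_borel n) (Pi\<^sub>M {..<n} (\<lambda>_. borel))"
    unfolding vec_borel_def by (rule measurable_vimage_algebra1) (auto simp: space_PiM)
  from measurable_compose[OF this measurable_component_singleton[of j]]
  show "(\<lambda>b. vec_index b j) \<in> borel_measurable (vec_borel n)" using assms by simp
qed

lemma space_sphere: "space (restrict_space (vec_borel n) (unit_sphere n)) = unit_sphere n"
  by (auto simp: space_restrict_space vec_borel_def unit_sphere_def)

lemma space_uniform_sphere [simp]: "space (uniform_sphere n) = unit_sphere n"
  by (simp add: uniform_sphere_def space_sphere)

lemma sets_uniform_sphere [simp, measurable_cong]: "sets (uniform_sphere n) = sets (restrict_space (vec_borel n) (unit_sphere n))"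
  by (simp add: uniform_sphere_def)

abbreviation radial :: "nat \<Rightarrow> (nat \<Rightarrow> real) \<Rightarrow> real Matrix.vec" where
  "radial n x \<equiv> Matrix.vec n (\<lambda>j. x j / sqrt (\<Sum>k<n. (x k)\<^sup>2))"

lemma measurable_radial:
  "radial n \<in> measurable (restrict_space (lborel_n {..<n}) (punctured_ball n)) (restrict_space (vec_borel n) (unit_sphere n))"
proof (rule measurable_restrict_space2)
  show "radial n \<in> space (restrict_space (lborel_n {..<n}) (punctured_ball n)) \<rightarrow> unit_sphere n"
  proof
    fix x assume "x \<in> space (restrict_space (lborel_n {..<n}) (punctured_ball n))"
    then have p: "0 < (\<Sum>k<n. (x k)\<^sup>2)" by (auto simp: space_restrict_space punctured_ball_def)
    have "scalar_prod (radial n x) (radial n x) = (\<Sum>j<n. (x j)\<^sup>2 / (\<Sum>k<n. (x k)\<^sup>2))"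
      using p by (simp add: scalar_prod_def atLeast0LessThan power2_eq_square)
    also have "\<dots> = 1" using p by (simp add: sum_divide_distrib[symmetric])
    finally show "radial n x \<in> unit_sphere n" by (simp add: unit_sphere_def)
  qed
  show "radial n \<in> measurable (restrict_space (lborel_n {..<n}) (punctured_ball n)) (vec_borel n)"
    unfolding vec_borel_def
  proof (rule measurable_vimage_algebra2)
    have [measurable]: "(\<lambda>x. x j) \<in> borel_measurable (lborel_n {..<n})" if "j < n" for j
      using that by (auto simp: measurable_lborel2[symmetric] intro!: measurable_component_singleton)
    have "(\<lambda>x. \<lambda>j\<in>{..<n}. x j / sqrt (\<Sum>k<n. (x k)\<^sup>2)) \<in> measurable (lborel_n {..<n}) (Pi\<^sub>M {..<n} (\<lambda>_. borel))"
      by (intro measurable_restrict) measurable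
    then have "(\<lambda>x. \<lambda>j\<in>{..<n}. vec_index (radial n x) j) \<in> measurable (lborel_n {..<n}) (Pi\<^sub>M {..<n} (\<lambda>_. borel))"
      by (simp cong: restrict_cong)
    then show "(\<lambda>x. \<lambda>j\<in>{..<n}. vec_index (radial n x) j) \<in>
        measurable (restrict_space (lborel_n {..<n}) (punctured_ball n)) (Pi\<^sub>M {..<n} (\<lambda>_. borel))"
      by (rule measurable_restrict_space1)
  qed auto
qed

lemma emeasure_uniform_sphere:
  assumes E: "E \<in> sets (uniform_sphere n)" and n: "0 < n"
  shows "emeasure (uniform_sphere n) E
    = emeasure (lborel_n {..<n}) {x \<in> punctured_ball n. radial n x \<in> E} / ennreal (unit_ball_vol (real n))"
proof -
  let ?M = "lborel_n {..<n}" and ?B = "punctured_ball n"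
  let ?R = "restrict_space ?M ?B"
  have B: "?B \<inter> space ?M \<in> sets ?M" using punctured_ball_measurable[of n] by (auto simp: sets.Int_space_eq2)
  have sR: "space ?R = ?B"
    using sets.sets_into_space[OF punctured_ball_measurable[of n]] by (auto simp: space_restrict_space)
  have BR: "?B \<in> sets ?R" using sets.top[of ?R] unfolding sR .
  have pre: "radial n -` E \<inter> ?B = {x \<in> ?B. radial n x \<in> E}" by auto
  have preR: "{x \<in> ?B. radial n x \<in> E} \<in> sets ?R"
    using measurable_sets[OF measurable_radial, of E n] E unfolding sR pre by simp
  have "emeasure (uniform_sphere n) E = emeasure (uniform_measure ?R ?B) {x \<in> ?B. radial n x \<in> E}"
    unfolding uniform_sphere_def using E measurable_radial[of n]
    by (subst emeasure_distr) (auto simp: sR pre[symmetric] Int_commute)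
  also have "\<dots> = emeasure ?R (?B \<inter> {x \<in> ?B. radial n x \<in> E}) / emeasure ?R ?B"
    using BR preR by (rule emeasure_uniform_measure)
  also have "?B \<inter> {x \<in> ?B. radial n x \<in> E} = {x \<in> ?B. radial n x \<in> E}" by auto
  also have "emeasure ?R {x \<in> ?B. radial n x \<in> E} = emeasure ?M {x \<in> ?B. radial n x \<in> E}"
    using B by (intro emeasure_restrict_space) auto
  also have "emeasure ?R ?B = emeasure ?M ?B"
    using B by (intro emeasure_restrict_space) auto
  finally show ?thesis unfolding emeasure_punctured_ball[OF n] .
qed

lemma prob_space_uniform_sphere:
  assumes "0 < n"
  shows "prob_space (uniform_sphere n)"
proof
  let ?E = "unit_sphere n"
  have E: "?E \<in> sets (uniform_sphere n)" using sets.top[of "uniform_sphere n"] by simp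
  have "radial n x \<in> ?E" if "x \<in> punctured_ball n" for x
    using measurable_space[OF measurable_radial, of x n] that
      sets.sets_into_space[OF punctured_ball_measurable[of n]]
    by (auto simp: space_restrict_space space_sphere)
  then have "{x \<in> punctured_ball n. radial n x \<in> ?E} = punctured_ball n" by auto
  moreover have "unit_ball_vol (real n) \<noteq> 0" using unit_ball_vol_pos[of "real n"] by linarith
  ultimately show "emeasure (uniform_sphere n) (space (uniform_sphere n)) = 1"
    using emeasure_uniform_sphere[OF E assms] emeasure_punctured_ball[OF assms]
    by (simp add: divide_ennreal)
qed

text \<open>
  If \<open>x\<close> is in the unit ball and the direction of \<open>x\<close> is nearly orthogonal to \<open>w\<close>, then so is \<open>x\<close>
  itself. After a rotation this is a slab of thickness \<open>2 t\<close> about a coordinate hyperplane, of volume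
  at most \<open>2 t\<close> times that of the ball of one dimension less, and the ratio of the volumes of the
  balls is at most \<open>sqrt n\<close>.
\<close>
theorem uniform_sphere_slab:
  assumes n: "0 < n" and w: "w \<in> carrier_vec n" "scalar_prod w w = 1" and t: "0 \<le> t"
  shows "measure (uniform_sphere n) {b \<in> space (uniform_sphere n). \<bar>scalar_prod w b\<bar> < t} \<le> 2 * t * sqrt (real n)"
proof -
  let ?M = "lborel_n {..<n}" and ?w = "vec_index w"
  let ?E = "{b \<in> space (uniform_sphere n). \<bar>scalar_prod w b\<bar> < t}"
  interpret prob_space "uniform_sphere n" by (rule prob_space_uniform_sphere[OF n])
  have sp: "scalar_prod w b = (\<Sum>j<n. vec_index w j * vec_index b j)" if "b \<in> carrier_vec n" for b
    using that by (simp add: scalar_prod_def atLeast0LessThan)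
  note [measurable] = measurable_coordinate
  have "?E = {b \<in> space (uniform_sphere n). \<bar>\<Sum>j<n. vec_index w j * vec_index b j\<bar> < t}"
    by (auto simp: unit_sphere_def sp)
  also have "\<dots> \<in> sets (uniform_sphere n)" by measurable
  finally have E: "?E \<in> sets (uniform_sphere n)" .
  have sub: "{x \<in> punctured_ball n. radial n x \<in> ?E} \<subseteq> slab n t ?w"
  proof
    fix x assume "x \<in> {x \<in> punctured_ball n. radial n x \<in> ?E}"
    then have x: "x \<in> punctured_ball n" and a: "\<bar>scalar_prod w (radial n x)\<bar> < t" by auto
    define r where "r = sqrt (\<Sum>k<n. (x k)\<^sup>2)"
    have r: "0 < r" "r \<le> 1" using x by (auto simp: punctured_ball_def r_def)
    have "scalar_prod w (radial n x) = (\<Sum>j<n. vec_index w j * x j) / r"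
      by (subst sp) (simp_all add: r_def sum_divide_distrib)
    then have "\<bar>\<Sum>j<n. vec_index w j * x j\<bar> / r < t" using a r by (simp add: abs_divide)
    then have "\<bar>\<Sum>j<n. vec_index w j * x j\<bar> \<le> t * r" using r by (simp add: pos_divide_less_eq)
    also have "\<dots> \<le> t" using t r by (simp add: mult_left_le)
    finally show "x \<in> slab n t ?w" using x by (auto simp: slab_def punctured_ball_def space_PiM)
  qed
  have w1: "(\<Sum>j<n. (?w j)\<^sup>2) = 1" using sp[OF w(1)] w(2) by (simp add: power2_eq_square)
  have V: "unit_ball_vol (real n) \<noteq> 0" using unit_ball_vol_pos[of "real n"] by linarith
  have "emeasure ?M {x \<in> punctured_ball n. radial n x \<in> ?E} \<le> emeasure ?M (slab n t ?w)"
    by (rule emeasure_mono[OF sub slab_measurable])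
  also have "\<dots> = emeasure ?M (slab n t (\<lambda>j. if j = 0 then 1 else 0))"
    using n by (intro emeasure_slab_rotate[OF w1, of "n - 1"]) auto
  also have "\<dots> \<le> ennreal (2 * t * unit_ball_vol (real (n - 1)))" by (rule emeasure_axis_slab[OF n t])
  also have "\<dots> \<le> ennreal (2 * t * (sqrt (real n) * unit_ball_vol (real n)))"
    using t unit_ball_vol_ratio[OF n] by (intro ennreal_leI mult_left_mono) auto
  finally have "emeasure (uniform_sphere n) ?E
      \<le> ennreal (2 * t * (sqrt (real n) * unit_ball_vol (real n))) / ennreal (unit_ball_vol (real n))"
    unfolding emeasure_uniform_sphere[OF E n] by (rule divide_right_mono_ennreal)
  also have "\<dots> = ennreal (2 * t * sqrt (real n))"
    using V t unit_ball_vol_pos[of "real n"] by (subst divide_ennreal) auto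
  finally show ?thesis using t by (simp add: emeasure_eq_measure)
qed

section \<open>Measurability of the Ritz values\<close>

lemma rat_sequence:
  fixes x :: real
  shows "\<exists>r. (\<forall>N. r N \<in> \<rat>) \<and> r \<longlonglongrightarrow> x"
proof -
  have "\<forall>N. \<exists>r. r \<in> \<rat> \<and> x < r \<and> r < x + inverse (real (Suc N))"
    using Rats_dense_in_real[of x] by (metis less_add_same_cancel1 inverse_positive_iff_positive of_nat_0_less_iff zero_less_Suc)
  then obtain r where r: "\<And>N. r N \<in> \<rat>" "\<And>N. x < r N" "\<And>N. r N < x + inverse (real (Suc N))" by metis
  have "r \<longlonglongrightarrow> x"
  proof (rule tendsto_sandwich)
    show "(\<lambda>N. x) \<longlonglongrightarrow> x" by simp
    show "(\<lambda>N. x + inverse (real (Suc N))) \<longlonglongrightarrow> x"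
      using tendsto_add[OF tendsto_const[of x] LIMSEQ_inverse_real_of_nat] by simp
  qed (use r in \<open>auto intro!: always_eventually less_imp_le\<close>)
  then show ?thesis using r by blast
qed

text \<open>
  Diagonal dominance: the deviation from the identity contributes at most
  \<open>(\<Sum>|c|)\<^sup>2 / (2 i) \<le> \<Sum>c\<^sup>2 / 2\<close> by Cauchy--Schwarz.
\<close>
lemma near_identity_posdef:
  fixes G :: "nat \<Rightarrow> nat \<Rightarrow> real"
  assumes G: "\<And>k l. k < i \<Longrightarrow> l < i \<Longrightarrow> \<bar>G k l - (if k = l then 1 else 0)\<bar> < 1 / (2 * real i)"
    and c: "\<exists>l<i. c l \<noteq> 0"
  shows "0 < (\<Sum>k<i. \<Sum>l<i. c k * c l * G k l)"
proof -
  let ?S = "\<Sum>k<i. (c k)\<^sup>2"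
  have i: "0 < i" using c by auto
  have S: "0 < ?S" using c by (auto intro!: sum_pos2)
  have "(\<Sum>k<i. \<bar>c k\<bar>)\<^sup>2 \<le> real i * ?S"
    using Cauchy_Schwarz_ineq_sum[of "\<lambda>_. 1" "\<lambda>k. \<bar>c k\<bar>" "{..<i}"] by simp
  then have 1: "(\<Sum>k<i. \<Sum>l<i. \<bar>c k\<bar> * \<bar>c l\<bar>) * (1 / (2 * real i)) \<le> ?S / 2"
    using i by (simp add: sum_product[symmetric] power2_eq_square[symmetric] divide_le_eq mult_ac)
  have "(\<Sum>k<i. \<Sum>l<i. c k * c l * (if k = l then 1 else 0)) - (\<Sum>k<i. \<Sum>l<i. \<bar>c k\<bar> * \<bar>c l\<bar>) * (1 / (2 * real i))
     \<le> (\<Sum>k<i. \<Sum>l<i. c k * c l * G k l)"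
    unfolding sum_distrib_right sum_subtractf[symmetric]
  proof (intro sum_mono)
    fix k l assume kl: "k \<in> {..<i}" "l \<in> {..<i}"
    have "\<bar>c k * c l * (G k l - (if k = l then 1 else 0))\<bar> \<le> \<bar>c k\<bar> * \<bar>c l\<bar> * (1 / (2 * real i))"
      unfolding abs_mult using G[of k l] kl by (intro mult_left_mono) auto
    then show "c k * c l * (if k = l then 1 else 0) - \<bar>c k\<bar> * \<bar>c l\<bar> * (1 / (2 * real i)) \<le> c k * c l * G k l"
      by (simp only: right_diff_distrib abs_le_iff) linarith
  qed
  moreover have "(\<Sum>k<i. \<Sum>l<i. c k * c l * (if k = l then 1 else 0)) = ?S"
  proof (rule sum.cong)
    fix k assume "k \<in> {..<i}"
    then have "(\<Sum>l<i. c k * c l * (if k = l then 1 else 0)) = (\<Sum>l<i. if k = l then c k * c l else 0)"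
      by (intro sum.cong) auto
    then show "(\<Sum>l<i. c k * c l * (if k = l then 1 else 0)) = (c k)\<^sup>2"
      using \<open>k \<in> {..<i}\<close> by (simp add: power2_eq_square)
  qed simp
  ultimately show ?thesis using 1 S by linarith
qed

text \<open>
  An orthonormal eigenbasis of the form, rescaled by the square roots of the (positive) eigenvalues,
  is orthonormal for the form.
\<close>
lemma posdef_normalize:
  fixes G :: "nat \<Rightarrow> nat \<Rightarrow> real"
  assumes sym: "\<And>k l. G k l = G l k"
    and pos: "\<And>c. \<exists>l<i. c l \<noteq> 0 \<Longrightarrow> 0 < (\<Sum>k<i. \<Sum>l<i. c k * c l * G k l)"
  shows "\<exists>T. \<forall>k<i. \<forall>l<i. (\<Sum>r<i. \<Sum>s<i. T k r * T l s * G r s) = (if k = l then 1 else 0)"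
proof -
  define B where "B = Matrix.mat i i (\<lambda>(k, l). G k l)"
  have "transpose_mat B = B"
  proof (rule eq_matI)
    fix k l assume "k < dim_row B" "l < dim_col B"
    then show "transpose_mat B $$ (k, l) = B $$ (k, l)" using sym[of k l] by (simp add: B_def)
  qed (simp_all add: B_def)
  then have B: "B \<in> sym_mats i" by (simp add: sym_mats_def B_def)
  obtain w where w: "orthonormal i i w" "\<And>k. k < i \<Longrightarrow> B *\<^sub>v w k = eigval B (Suc k) \<cdot>\<^sub>v w k"
    "\<And>k l. k \<le> l \<Longrightarrow> l < i \<Longrightarrow> eigval B (Suc l) \<le> eigval B (Suc k)"
    using spectral_eigval[OF B] by blast
  define \<mu> where "\<mu> k = eigval B (Suc k)" for k
  have wc: "w k \<in> carrier_vec i" if "k < i" for k using w(1) that by (simp add: orthonormal_def)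
  have form: "(\<Sum>r<i. \<Sum>s<i. vec_index (w k) r * vec_index (w l) s * G r s) = \<mu> l * (if k = l then 1 else 0)"
    if "k < i" "l < i" for k l
  proof -
    have "(\<Sum>r<i. \<Sum>s<i. vec_index (w k) r * vec_index (w l) s * G r s) = scalar_prod (w k) (B *\<^sub>v w l)"
      using wc[OF that(1)] wc[OF that(2)]
      by (simp add: scalar_prod_def B_def atLeast0LessThan sum_distrib_left mult_ac)
    also have "\<dots> = \<mu> l * scalar_prod (w k) (w l)"
      using w(2)[OF that(2)] wc[OF that(1)] wc[OF that(2)] by (simp add: \<mu>_def)
    finally show ?thesis using w(1) that by (simp add: orthonormal_def)
  qed
  have \<mu>: "0 < \<mu> k" if k: "k < i" for k
  proof -
    have "\<exists>l<i. vec_index (w k) l \<noteq> 0"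
    proof (rule ccontr)
      assume "\<not> (\<exists>l<i. vec_index (w k) l \<noteq> 0)"
      then have "scalar_prod (w k) (w k) = 0" using wc[OF k] by (simp add: scalar_prod_def)
      then show False using w(1) k by (simp add: orthonormal_def)
    qed
    from pos[OF this] show ?thesis using form[OF k k] by simp
  qed
  have "(\<Sum>r<i. \<Sum>s<i. (vec_index (w k) r / sqrt (\<mu> k)) * (vec_index (w l) s / sqrt (\<mu> l)) * G r s)
      = (if k = l then 1 else 0)" if kl: "k < i" "l < i" for k l
  proof -
    have "(\<Sum>r<i. \<Sum>s<i. (vec_index (w k) r / sqrt (\<mu> k)) * (vec_index (w l) s / sqrt (\<mu> l)) * G r s)
      = (\<Sum>r<i. \<Sum>s<i. vec_index (w k) r * vec_index (w l) s * G r s) / (sqrt (\<mu> k) * sqrt (\<mu> l))"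
      unfolding sum_divide_distrib by (intro sum.cong refl) simp
    also have "\<dots> = (if k = l then 1 else 0)"
    proof (cases "k = l")
      case True
      have sq: "sqrt (\<mu> l) * sqrt (\<mu> l) = \<mu> l" using \<mu>[OF kl(2)] by simp
      have "\<mu> l \<noteq> 0" using \<mu>[OF kl(2)] by simp
      then show ?thesis unfolding form[OF kl] unfolding True sq by simp
    next
      case False
      then show ?thesis unfolding form[OF kl] by simp
    qed
    finally show ?thesis .
  qed
  note key = this
  define T where "T = (\<lambda>k r. vec_index (w k) r / sqrt (\<mu> k))"
  show ?thesis
  proof (rule exI[of _ T], intro allI impI)
    fix k l assume "k < i" "l < i"
    then show "(\<Sum>r<i. \<Sum>s<i. T k r * T l s * G r s) = (if k = l then 1 else 0)"
      unfolding T_def by (rule key)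
  qed
qed

context eigenbasis
begin

text \<open>
  For \<open>x = p(A) b\<close> and \<open>y = p'(A) b\<close> with coefficients \<open>c\<close> and \<open>c'\<close> this is \<open>\<langle>x, (A - q) y\<rangle>\<close>.
\<close>
definition gram :: "nat \<Rightarrow> real \<Rightarrow> real Matrix.vec \<Rightarrow> (nat \<Rightarrow> real) \<Rightarrow> (nat \<Rightarrow> real) \<Rightarrow> real" where
  "gram m q b c c' = (\<Sum>k<n. (lam k - q) * (\<Sum>j<m. c j * lam k ^ j) * (\<Sum>j<m. c' j * lam k ^ j) * (scalar_prod (v k) b)\<^sup>2)"

lemma gram_sym: "gram m q b c c' = gram m q b c' c"
  unfolding gram_def by (rule sum.cong) (auto simp: mult_ac)

lemma gram_linear: "gram m q b (\<lambda>j. \<Sum>l<i. d l * P l j) (\<lambda>j. \<Sum>l<i. e l * P l j)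
    = (\<Sum>k<i. \<Sum>l<i. d k * e l * gram m q b (P k) (P l))"
proof -
  define \<alpha> where "\<alpha> k x = (\<Sum>j<m. P k j * x ^ j)" for k and x :: real
  have lin: "(\<Sum>j<m. (\<Sum>l<i. d l * P l j) * x ^ j) = (\<Sum>l<i. d l * \<alpha> l x)" for d and x :: real
    unfolding \<alpha>_def sum_distrib_right sum_distrib_left by (subst sum.swap) (simp add: mult.assoc)
  define F where "F k l r = d k * e l * ((lam r - q) * \<alpha> k (lam r) * \<alpha> l (lam r) * (scalar_prod (v r) b)\<^sup>2)" for k l r
  have "(\<Sum>k<i. \<Sum>l<i. d k * e l * gram m q b (P k) (P l)) = (\<Sum>k<i. \<Sum>l<i. \<Sum>r<n. F k l r)"
    unfolding gram_def F_def \<alpha>_def by (simp only: sum_distrib_left)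
  also have "\<dots> = (\<Sum>k<i. \<Sum>r<n. \<Sum>l<i. F k l r)" by (intro sum.cong refl sum.swap)
  also have "\<dots> = (\<Sum>r<n. \<Sum>k<i. \<Sum>l<i. F k l r)" by (rule sum.swap)
  also have "\<dots> = (\<Sum>r<n. (lam r - q) * (\<Sum>l<i. d l * \<alpha> l (lam r)) * (\<Sum>l<i. e l * \<alpha> l (lam r)) * (scalar_prod (v r) b)\<^sup>2)"
  proof (rule sum.cong[OF refl])
    fix r
    have "(\<Sum>l<i. d l * \<alpha> l (lam r)) * (\<Sum>l<i. e l * \<alpha> l (lam r))
        = (\<Sum>k<i. \<Sum>l<i. (d k * \<alpha> k (lam r)) * (e l * \<alpha> l (lam r)))" by (rule sum_product)
    then have "(lam r - q) * (\<Sum>l<i. d l * \<alpha> l (lam r)) * (\<Sum>l<i. e l * \<alpha> l (lam r)) * (scalar_prod (v r) b)\<^sup>2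
        = (lam r - q) * (scalar_prod (v r) b)\<^sup>2 * (\<Sum>k<i. \<Sum>l<i. (d k * \<alpha> k (lam r)) * (e l * \<alpha> l (lam r)))"
      by (simp only: mult_ac)
    then show "(\<Sum>k<i. \<Sum>l<i. F k l r)
        = (lam r - q) * (\<Sum>l<i. d l * \<alpha> l (lam r)) * (\<Sum>l<i. e l * \<alpha> l (lam r)) * (scalar_prod (v r) b)\<^sup>2"
      unfolding F_def by (simp only: sum_distrib_left mult_ac)
  qed
  finally show ?thesis unfolding gram_def lin by (rule sym)
qed

lemma gram_krylov:
  assumes "b \<in> carrier_vec n"
  shows "gram m q b c c
    = (\<Sum>k<n. (lam k - q) * (scalar_prod (v k) (comb n m c (\<lambda>j. (A ^\<^sub>m j) *\<^sub>v b)))\<^sup>2)"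
  unfolding gram_def using assms by (intro sum.cong) (auto simp: v_krylov power2_eq_square)

definition above :: "nat \<Rightarrow> nat \<Rightarrow> real \<Rightarrow> real Matrix.vec \<Rightarrow> bool" where
  "above m i q b \<longleftrightarrow> (\<exists>U\<in>feasible m i b. \<forall>x\<in>U - {0\<^sub>v n}. q < rayleigh A x)"

text \<open>
  Existence of a feasible space on which all Rayleigh quotients exceed \<open>q\<close> means that the form
  \<open>\<langle>x, (A - q) x\<rangle>\<close>, pulled back to coefficient vectors, is positive definite on the span of \<open>i\<close> of them.
  Positivity also forces the corresponding vectors to be independent.
\<close>
lemma above_iff_posdef:
  assumes b: "b \<in> carrier_vec n"
  shows "above m i q b \<longleftrightarrow>
    (\<exists>P. \<forall>c. (\<exists>l<i. c l \<noteq> 0) \<longrightarrow> 0 < (\<Sum>k<i. \<Sum>l<i. c k * c l * gram m q b (P k) (P l)))"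
proof
  let ?K = "\<lambda>j. (A ^\<^sub>m j) *\<^sub>v b"
  assume "above m i q b"
  then obtain U u where U: "U \<subseteq> krylov m A b" "\<And>x. x \<in> U \<Longrightarrow> x \<noteq> 0\<^sub>v n \<Longrightarrow> q < rayleigh A x"
    and u: "\<And>l. l < i \<Longrightarrow> u l \<in> carrier_vec n" "indep n i u" "U = range (\<lambda>c. comb n i c u)"
    by (auto simp: above_def feasible_def subspaces_of_dim_iff)
  have ex: "\<exists>p. u l = comb n m p ?K" if "l < i" for l
  proof -
    have "u l = comb n i (\<lambda>r. if r = l then 1 else 0) u"
    proof (rule eq_vecI)
      fix r assume "r < dim_vec (comb n i (\<lambda>r. if r = l then 1 else 0) u)"
      then have r: "r < n" by simp
      have "(\<Sum>k<i. (if k = l then 1 else 0) * vec_index (u k) r) = (\<Sum>k<i. if k = l then vec_index (u k) r else 0)"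
        by (rule sum.cong) auto
      then show "vec_index (u l) r = vec_index (comb n i (\<lambda>r. if r = l then 1 else 0) u) r"
        using r that by simp
    qed (use u that in auto)
    then have "u l \<in> krylov m A b" using U(1) u(3) by auto
    then show ?thesis unfolding krylov_eq[OF A_carrier b] by auto
  qed
  define P where "P l = (SOME p. u l = comb n m p ?K)" for l
  have P: "u l = comb n m (P l) ?K" if "l < i" for l
    unfolding P_def using ex[OF that] by (rule someI_ex)
  have "0 < (\<Sum>k<i. \<Sum>l<i. c k * c l * gram m q b (P k) (P l))" if c: "\<exists>l<i. c l \<noteq> 0" for c
  proof -
    let ?x = "comb n i c u"
    have "?x \<noteq> 0\<^sub>v n" using u(2) c by (auto simp: indep_def)
    moreover have "?x \<in> U" using u(3) by auto
    ultimately have "0 < (\<Sum>k<n. (lam k - q) * (scalar_prod (v k) ?x)\<^sup>2)"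
      using U(2) by (subst rayleigh_ge_iff(2)[symmetric]) auto
    also have "?x = comb n m (\<lambda>j. \<Sum>l<i. c l * P l j) ?K" using P by (intro comb_comb) auto
    finally show ?thesis
      unfolding gram_krylov[OF b, symmetric] gram_linear[where d = c and e = c and P = P and i = i] .
  qed
  then show "\<exists>P. \<forall>c. (\<exists>l<i. c l \<noteq> 0) \<longrightarrow> 0 < (\<Sum>k<i. \<Sum>l<i. c k * c l * gram m q b (P k) (P l))"
    by (intro exI[of _ P] allI impI)
next
  let ?K = "\<lambda>j. (A ^\<^sub>m j) *\<^sub>v b"
  assume "\<exists>P. \<forall>c. (\<exists>l<i. c l \<noteq> 0) \<longrightarrow> 0 < (\<Sum>k<i. \<Sum>l<i. c k * c l * gram m q b (P k) (P l))"
  then obtain P where P: "\<And>c. \<exists>l<i. c l \<noteq> 0 \<Longrightarrow> 0 < (\<Sum>k<i. \<Sum>l<i. c k * c l * gram m q b (P k) (P l))"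
    by blast
  define u where "u l = comb n m (P l) ?K" for l
  have x: "comb n i c u = comb n m (\<lambda>j. \<Sum>l<i. c l * P l j) ?K" for c
    by (rule comb_comb) (simp add: u_def)
  have pos: "0 < (\<Sum>k<n. (lam k - q) * (scalar_prod (v k) (comb n i c u))\<^sup>2)" if "\<exists>l<i. c l \<noteq> 0" for c
    using P[OF that] unfolding x gram_krylov[OF b, symmetric] gram_linear[where d = c and e = c and P = P and i = i] .
  have "indep n i u" unfolding indep_def
  proof (intro allI impI, rule ccontr)
    fix c l assume "comb n i c u = 0\<^sub>v n" "l < i" "c l \<noteq> 0"
    then show False using pos[of c] v_carrier by auto
  qed
  then have "range (\<lambda>c. comb n i c u) \<in> subspaces_of_dim n i"
    unfolding subspaces_of_dim_iff by (intro exI[of _ u] conjI) (simp_all add: u_def)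
  moreover have "range (\<lambda>c. comb n i c u) \<subseteq> krylov m A b"
    unfolding krylov_eq[OF A_carrier b] using x by auto
  ultimately have F: "range (\<lambda>c. comb n i c u) \<in> feasible m i b" by (simp add: feasible_def)
  have "q < rayleigh A (comb n i c u)" if "comb n i c u \<noteq> 0\<^sub>v n" for c
  proof -
    have "\<exists>l<i. c l \<noteq> 0"
    proof (rule ccontr)
      assume "\<not> (\<exists>l<i. c l \<noteq> 0)"
      then have "comb n i c u = 0\<^sub>v n" by (intro eq_vecI) auto
      then show False using that by simp
    qed
    then show ?thesis using pos that by (subst rayleigh_ge_iff(2)) auto
  qed
  then show "above m i q b" unfolding above_def using F by (intro bexI[OF _ F]) auto
qed

definition rat_coeffs :: "nat \<Rightarrow> nat \<Rightarrow> (nat \<Rightarrow> nat \<Rightarrow> real) set" where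
  "rat_coeffs m i = PiE {..<i} (\<lambda>_. PiE {..<m} (\<lambda>_. \<rat>))"

text \<open>
  A positive definite form can be normalised to the identity matrix, and being close to the identity
  both survives a small change of the coefficients and implies definiteness. Hence rational
  coefficients suffice, which turns the condition on \<open>b\<close> into a countable union of measurable ones.
\<close>
lemma above_iff_rational:
  assumes b: "b \<in> carrier_vec n"
  shows "above m i q b \<longleftrightarrow> (\<exists>P\<in>rat_coeffs m i. \<forall>k\<in>{..<i}. \<forall>l\<in>{..<i}.
     \<bar>gram m q b (P k) (P l) - (if k = l then 1 else 0)\<bar> < 1 / (2 * real i))"
proof
  assume "\<exists>P\<in>rat_coeffs m i. \<forall>k\<in>{..<i}. \<forall>l\<in>{..<i}.
     \<bar>gram m q b (P k) (P l) - (if k = l then 1 else 0)\<bar> < 1 / (2 * real i)"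
  then obtain P where "\<And>k l. k < i \<Longrightarrow> l < i \<Longrightarrow> \<bar>gram m q b (P k) (P l) - (if k = l then 1 else 0)\<bar> < 1 / (2 * real i)"
    by auto
  from near_identity_posdef[OF this] show "above m i q b"
    unfolding above_iff_posdef[OF b] by (intro exI[of _ P]) auto
next
  assume "above m i q b"
  then obtain P where P: "\<And>c. \<exists>l<i. c l \<noteq> 0 \<Longrightarrow> 0 < (\<Sum>k<i. \<Sum>l<i. c k * c l * gram m q b (P k) (P l))"
    unfolding above_iff_posdef[OF b] by blast
  obtain T where T: "\<forall>k<i. \<forall>l<i.
      (\<Sum>r<i. \<Sum>s<i. T k r * T l s * gram m q b (P r) (P s)) = (if k = l then 1 else 0)"
    using posdef_normalize[of "\<lambda>k l. gram m q b (P k) (P l)" i, OF gram_sym P] by blast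
  define Q where "Q k j = (\<Sum>r<i. T k r * P r j)" for k j
  have GQ: "gram m q b (Q k) (Q l) = (if k = l then 1 else 0)" if "k < i" "l < i" for k l
    using T that unfolding Q_def gram_linear by blast
  define r where "r k j = (SOME r. (\<forall>N. r N \<in> \<rat>) \<and> r \<longlonglongrightarrow> Q k j)" for k j
  have r: "r k j N \<in> \<rat>" "r k j \<longlonglongrightarrow> Q k j" for k j N
    unfolding r_def using someI_ex[OF rat_sequence[of "Q k j"]] by blast+
  have lim: "(\<lambda>N. gram m q b (\<lambda>j. r k j N) (\<lambda>j. r l j N)) \<longlonglongrightarrow> gram m q b (Q k) (Q l)" for k l
    unfolding gram_def by (intro tendsto_intros r)
  have "eventually (\<lambda>N. \<forall>k\<in>{..<i}. \<forall>l\<in>{..<i}.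
      \<bar>gram m q b (\<lambda>j. r k j N) (\<lambda>j. r l j N) - (if k = l then 1 else 0)\<bar> < 1 / (2 * real i)) sequentially"
  proof (intro eventually_ball_finite ballI)
    fix k l assume kl: "k \<in> {..<i}" "l \<in> {..<i}"
    then have "0 < 1 / (2 * real i)" by simp
    from tendstoD[OF lim this, of k l]
    show "eventually (\<lambda>N. \<bar>gram m q b (\<lambda>j. r k j N) (\<lambda>j. r l j N) - (if k = l then 1 else 0)\<bar> < 1 / (2 * real i)) sequentially"
      using GQ kl by (simp add: dist_real_def)
  qed auto
  then obtain N where N: "\<forall>k\<in>{..<i}. \<forall>l\<in>{..<i}.
      \<bar>gram m q b (\<lambda>j. r k j N) (\<lambda>j. r l j N) - (if k = l then 1 else 0)\<bar> < 1 / (2 * real i)"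
    using eventually_happens'[OF sequentially_bot] by blast
  define R where "R = (\<lambda>k\<in>{..<i}. \<lambda>j\<in>{..<m}. r k j N)"
  have "R \<in> rat_coeffs m i" unfolding rat_coeffs_def R_def using r by auto
  moreover have "gram m q b (R k) (R l) = gram m q b (\<lambda>j. r k j N) (\<lambda>j. r l j N)" if "k < i" "l < i" for k l
    unfolding gram_def R_def using that by (intro sum.cong) (auto intro!: arg_cong2[of _ _ _ _ "(*)"] sum.cong)
  ultimately show "\<exists>P\<in>rat_coeffs m i. \<forall>k\<in>{..<i}. \<forall>l\<in>{..<i}.
     \<bar>gram m q b (P k) (P l) - (if k = l then 1 else 0)\<bar> < 1 / (2 * real i)"
    using N by (intro bexI[of _ R]) auto
qed

lemma sphere_carrier: "b \<in> unit_sphere n \<Longrightarrow> b \<in> carrier_vec n" by (simp add: unit_sphere_def)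

lemma measurable_component:
  assumes "w \<in> carrier_vec n"
  shows "(\<lambda>b. scalar_prod w b) \<in> borel_measurable (uniform_sphere n)"
proof -
  note [measurable] = measurable_coordinate
  have "(\<lambda>b. \<Sum>j<n. vec_index w j * vec_index b j) \<in> borel_measurable (uniform_sphere n)" by measurable
  then show ?thesis
    by (rule measurable_cong[THEN iffD1, rotated])
      (auto simp: scalar_prod_def atLeast0LessThan unit_sphere_def)
qed

lemma above_measurable: "{b \<in> space (uniform_sphere n). above m i q b} \<in> sets (uniform_sphere n)"
proof -
  have [measurable]: "(\<lambda>b. gram m q b c c') \<in> borel_measurable (uniform_sphere n)" for c c'
    unfolding gram_def using v_carrier by (intro borel_measurable_sum borel_measurable_times borel_measurable_power borel_measurable_const measurable_component) auto
  define near where "near P b \<longleftrightarrow> (\<forall>k\<in>{..<i}. \<forall>l\<in>{..<i}.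
     \<bar>gram m q b (P k) (P l) - (if k = l then 1 else 0)\<bar> < 1 / (2 * real i))" for P b
  have "above m i q b \<longleftrightarrow> (\<exists>P\<in>rat_coeffs m i. near P b)" if "b \<in> space (uniform_sphere n)" for b
    unfolding near_def using that by (intro above_iff_rational sphere_carrier) simp
  then have "{b \<in> space (uniform_sphere n). above m i q b}
      = (\<Union>P\<in>rat_coeffs m i. {b \<in> space (uniform_sphere n). near P b})" by blast
  also have "\<dots> \<in> sets (uniform_sphere n)"
  proof (rule sets.countable_UN'')
    show "countable (rat_coeffs m i)" unfolding rat_coeffs_def
      by (intro countable_PiE finite_lessThan countable_rat)
    show "{b \<in> space (uniform_sphere n). near P b} \<in> sets (uniform_sphere n)" for P
      unfolding near_def by measurable
  qed
  finally show ?thesis .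
qed

text \<open>
  The gap between \<open>a\<close> and the Ritz value leaves room for a rational \<open>q\<close>, so the infimum over a trial
  space need not be attained.
\<close>
lemma less_ritz_iff:
  assumes ne: "feasible m i b \<noteq> {}" and i: "1 \<le> i" "i \<le> n"
  shows "a < ritz m i A b \<longleftrightarrow> (\<exists>q\<in>\<rat>. a < q \<and> above m i q b)"
proof
  assume "a < ritz m i A b"
  moreover have "bdd_above ((\<lambda>U. INF x \<in> U - {0\<^sub>v n}. rayleigh A x) ` feasible m i b)"
    using INF_rayleigh_le_eigval i by (intro bdd_aboveI2[of _ _ "eigval A i"]) (auto simp: feasible_def)
  ultimately obtain U where U: "U \<in> feasible m i b" "a < (INF x \<in> U - {0\<^sub>v n}. rayleigh A x)"
    unfolding ritz_eq using less_cSUP_iff[OF ne] by blast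
  obtain q where q: "q \<in> \<rat>" "a < q" "q < (INF x \<in> U - {0\<^sub>v n}. rayleigh A x)"
    using Rats_dense_in_real[OF U(2)] by auto
  have "q < rayleigh A x" if "x \<in> U - {0\<^sub>v n}" for x
    using INF_rayleigh_le[of U i x] U(1) that q(3) by (auto simp: feasible_def)
  then show "\<exists>q\<in>\<rat>. a < q \<and> above m i q b" using q U by (auto simp: above_def)
next
  assume "\<exists>q\<in>\<rat>. a < q \<and> above m i q b"
  then obtain q U where q: "a < q" "U \<in> feasible m i b" "\<And>x. x \<in> U - {0\<^sub>v n} \<Longrightarrow> q < rayleigh A x"
    by (auto simp: above_def)
  have "q \<le> ritz m i A b" using q by (intro ritz_ge[OF q(2) i]) (auto intro: less_imp_le)
  then show "a < ritz m i A b" using q by simp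
qed

lemma feasible_iff_above:
  "feasible m i b \<noteq> {} \<longleftrightarrow> (\<exists>q\<in>\<rat>. above m i q b)"
proof
  assume "feasible m i b \<noteq> {}"
  then obtain U where U: "U \<in> feasible m i b" by auto
  obtain q where q: "q \<in> \<rat>" "q < eigval A n" using Rats_dense_in_real[of "eigval A n - 1" "eigval A n"] by auto
  have "q < rayleigh A x" if "x \<in> U - {0\<^sub>v n}" for x
    using rayleigh_bounds(1)[of x] subspace_carrier[of U i] U that q by (fastforce simp: feasible_def)
  then show "\<exists>q\<in>\<rat>. above m i q b" using q U by (auto simp: above_def)
qed (auto simp: above_def)

text \<open>
  On the vectors whose Krylov space has dimension at least \<open>i\<close> use \<open>less_ritz_iff\<close>; on the others the Ritz
  value is the supremum of the empty set, a constant.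
\<close>
theorem ritz_measurable:
  assumes i: "1 \<le> i" "i \<le> n"
  shows "ritz m i A \<in> borel_measurable (uniform_sphere n)"
proof (rule borel_measurable_iff_greater[THEN iffD2], intro allI)
  fix a
  let ?S = "uniform_sphere n" and ?z = "Sup {} :: real"
  let ?D = "\<Union>q\<in>\<rat>. {b \<in> space ?S. above m i q b}"
  let ?E = "\<Union>q\<in>\<rat> \<inter> {a<..}. {b \<in> space ?S. above m i q b}"
  have D: "?D \<in> sets ?S" "?E \<in> sets ?S"
    by (intro sets.countable_UN'' countable_rat above_measurable countable_Int1)+
  have z: "ritz m i A b = ?z" if "feasible m i b = {}" for b using that by (simp add: ritz_eq)
  have "{b \<in> space ?S. a < ritz m i A b} = (if a < ?z then ?E \<union> (space ?S - ?D) else ?E)"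
  proof (intro equalityI subsetI)
    fix b assume b: "b \<in> {b \<in> space ?S. a < ritz m i A b}"
    show "b \<in> (if a < ?z then ?E \<union> (space ?S - ?D) else ?E)"
    proof (cases "feasible m i b = {}")
      case True
      then have "a < ?z" "b \<notin> ?D" using b z[OF True] feasible_iff_above[of m i b] by auto
      then show ?thesis using b by simp
    next
      case False
      then have "b \<in> ?E" using less_ritz_iff[OF False i] b by auto
      then show ?thesis by simp
    qed
  next
    fix b assume b: "b \<in> (if a < ?z then ?E \<union> (space ?S - ?D) else ?E)"
    show "b \<in> {b \<in> space ?S. a < ritz m i A b}"
    proof (cases "feasible m i b = {}")
      case True
      then have "b \<notin> ?E" using feasible_iff_above[of m i b] by auto
      then have "a < ?z" "b \<in> space ?S" using b by (auto split: if_splits)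
      then show ?thesis using z[OF True] by simp
    next
      case False
      then have "b \<in> ?D \<or> b \<notin> space ?S" using feasible_iff_above[of m i b] by auto
      then have "b \<in> ?E" using b by (auto split: if_splits)
      then show ?thesis using less_ritz_iff[OF False i] by auto
    qed
  qed
  also have "\<dots> \<in> sets ?S"
    using sets.Un[OF D(2) sets.compl_sets[OF D(1)]] D(2) by (cases "a < ?z") (simp_all only: if_True if_False)
  finally show "{b \<in> space ?S. a < ritz m i A b} \<in> sets ?S" .
qed

lemma rel_err_measurable:
  assumes "1 \<le> i" "i \<le> n"
  shows "rel_err m i A \<in> borel_measurable (uniform_sphere n)"
  unfolding rel_err_def[abs_def] using ritz_measurable[OF assms, of m] by measurable

end

section \<open>The exceptional set\<close>

text \<open>
  With \<open>x\<close> either summand, \<open>(x / (a + b)) powr p \<le> x / (a + b)\<close>, and these two fractions add up to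
  \<open>1\<close>. This splits the moment over the exceptional set and its complement.
\<close>
lemma powr_add_superadditive:
  fixes a b p :: real
  assumes "0 \<le> a" "0 \<le> b" "1 \<le> p"
  shows "a powr p + b powr p \<le> (a + b) powr p"
proof (cases "a + b = 0")
  case True
  then have "a = 0" "b = 0" using assms by auto
  then show ?thesis by simp
next
  case False
  then have s: "0 < a + b" using assms by linarith
  have le: "x powr p \<le> x / (a + b) * (a + b) powr p" if "0 \<le> x" "x \<le> a + b" for x
  proof -
    have "(x / (a + b)) powr p \<le> x / (a + b)"
      using powr_mono'[of 1 p "x / (a + b)"] that s assms by simp
    then have "(x / (a + b)) powr p * (a + b) powr p \<le> x / (a + b) * (a + b) powr p"
      by (rule mult_right_mono) simp
    moreover have "(x / (a + b)) powr p * (a + b) powr p = x powr p"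
      using that s by (simp add: powr_mult[symmetric])
    ultimately show ?thesis by (simp only:)
  qed
  have "a powr p + b powr p \<le> a / (a + b) * (a + b) powr p + b / (a + b) * (a + b) powr p"
    using le[of a] le[of b] assms by simp
  also have "\<dots> = (a + b) powr p" using s by (simp add: distrib_right[symmetric] add_divide_distrib[symmetric])
  finally show ?thesis .
qed

text \<open>
  Bounding all \<open>i\<close> components and all \<open>i\<close> Lagrange polynomials costs powers of \<open>i\<close>; they are absorbed
  by the powers of \<open>4\<close> that come with \<open>2 gap\<close> in place of \<open>gap\<close>.
\<close>
lemma le_four_power: "real i \<le> 4 ^ (i - 1)" "real i ^ 3 \<le> 2 * 4 ^ (i - 1)"
proof -
  have *: "real (Suc k) ^ 3 \<le> 2 * 4 ^ k" for k
  proof (induction k)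
    case (Suc k)
    consider "k = 0" | "k = 1" | "2 \<le> k" by linarith
    then show ?case
    proof cases
      case 3
      then have k: "2 \<le> real k" by simp
      have "real (Suc (Suc k)) \<le> (4/3) * real (Suc k)" using k by simp
      then have "real (Suc (Suc k)) ^ 3 \<le> ((4/3) * real (Suc k)) ^ 3" by (rule power_mono) simp
      also have "\<dots> = (64/27) * real (Suc k) ^ 3" unfolding power_mult_distrib by (simp add: power_divide)
      also have "\<dots> \<le> 4 * (2 * 4 ^ k)" using Suc zero_le_power[of "4::real" k] by linarith
      finally show ?thesis by simp
    qed auto
  qed simp
  then show 3: "real i ^ 3 \<le> 2 * 4 ^ (i - 1)" by (cases i) auto
  have "real (Suc k) \<le> 4 ^ k" for k by (induction k) auto
  then show "real i \<le> 4 ^ (i - 1)" by (cases i) auto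
qed

context eigenbasis
begin

sublocale sphere: prob_space "uniform_sphere n" by (rule prob_space_uniform_sphere[OF n_pos])

text \<open>
  The exceptional set: some leading component of \<open>b\<close> is smaller than \<open>t\<close>, so that
  \<open>rel_err_le_components\<close> does not apply.
\<close>
definition small_component :: "nat \<Rightarrow> real \<Rightarrow> real Matrix.vec set" where
  "small_component i t = (\<Union>k<i. {b \<in> space (uniform_sphere n). \<bar>scalar_prod (v k) b\<bar> < t})"

lemma small_slab_measurable:
  "k < n \<Longrightarrow> {b \<in> space (uniform_sphere n). \<bar>scalar_prod (v k) b\<bar> < t} \<in> sets (uniform_sphere n)"
proof -
  assume "k < n"
  note [measurable] = measurable_component[OF v_carrier[OF this]]
  show ?thesis by measurable
qed

lemma small_component_measurable: "i \<le> n \<Longrightarrow> small_component i t \<in> sets (uniform_sphere n)"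
  unfolding small_component_def by (intro sets.finite_UN finite_lessThan small_slab_measurable) auto

lemma prob_small_component:
  assumes "i \<le> n" "0 \<le> t"
  shows "measure (uniform_sphere n) (small_component i t) \<le> 2 * real i * t * sqrt (real n)"
proof -
  have "measure (uniform_sphere n) (small_component i t)
    \<le> (\<Sum>k<i. measure (uniform_sphere n) {b \<in> space (uniform_sphere n). \<bar>scalar_prod (v k) b\<bar> < t})"
    unfolding small_component_def using assms small_slab_measurable
    by (intro sphere.finite_measure_subadditive_finite) auto
  also have "\<dots> \<le> (\<Sum>k<i. 2 * t * sqrt (real n))"
    using assms v_orthonormal by (intro sum_mono uniform_sphere_slab n_pos) (auto simp: orthonormal_def)
  finally show ?thesis by simp
qed

text \<open>
  For \<open>i \<ge> 2\<close> even \<open>2 gap \<le> 1\<close>, since a single difference of eigenvalues is at most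
  \<open>\<lambda>\<^sub>1 - \<lambda>\<^sub>n\<close>.
\<close>
lemma gap_le_1:
  assumes i: "1 \<le> i" "i \<le> n" and g: "0 < gap i A" and ne: "eigval A n < eigval A i"
  shows "gap i A \<le> 1"
proof (cases "i \<ge> 2")
  case True
  have "i - 1 < n" using i by linarith
  then have s: "0 < eigval A 1 - eigval A n" using lam_le_first[of "i - 1"] i ne by simp
  have "2 * gap i A * (eigval A 1 - eigval A n) \<le> \<bar>lam 0 - lam 1\<bar>"
    using True by (intro eigval_separation[OF i(2) g]) auto
  also have "\<dots> \<le> 1 * (eigval A 1 - eigval A n)"
    using lam_le_first[of 1] lam_ge_last[of 1] True i by simp
  finally have "2 * gap i A \<le> 1" using s by (rule mult_right_le_imp_le)
  then show ?thesis using g by simp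
qed (simp add: gap_def)

text \<open>
  Almost surely all leading components are nonzero; then \<open>rel_err_le_components\<close>, with \<open>t\<close> the least of
  them, shows that the Krylov space is large enough.
\<close>
lemma AE_rel_err:
  assumes i: "1 \<le> i" "i \<le> n" "i \<le> m" and g: "0 < gap i A" and ne: "eigval A n < eigval A i"
  shows "AE b in uniform_sphere n. 0 \<le> rel_err m i A b \<and> rel_err m i A b \<le> 1"
proof -
  let ?S = "uniform_sphere n"
  have Z: "{b \<in> space ?S. \<exists>k<i. scalar_prod (v k) b = 0} \<in> sets ?S"
  proof -
    have [measurable]: "(\<lambda>b. scalar_prod (v k) b) \<in> borel_measurable ?S" if "k \<in> {..<i}" for k
      using that i by (intro measurable_component v_carrier) simp
    have "{b \<in> space ?S. \<exists>k\<in>{..<i}. scalar_prod (v k) b = 0} \<in> sets ?S" by measurable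
    then show ?thesis by (simp only: lessThan_iff Bex_def)
  qed
  have "measure ?S {b \<in> space ?S. \<exists>k<i. scalar_prod (v k) b = 0} \<le> 0"
  proof (rule field_le_epsilon)
    fix e :: real assume e: "0 < e"
    define t where "t = e / (2 * real i * sqrt (real n))"
    have t: "0 < t" using e i n_pos by (simp add: t_def)
    have "measure ?S {b \<in> space ?S. \<exists>k<i. scalar_prod (v k) b = 0} \<le> measure ?S (small_component i t)"
      using t by (intro sphere.finite_measure_mono small_component_measurable i) (auto simp: small_component_def)
    also have "\<dots> \<le> 2 * real i * t * sqrt (real n)" using t i by (intro prob_small_component) auto
    also have "\<dots> = 0 + e" using i n_pos by (simp add: t_def)
    finally show "measure ?S {b \<in> space ?S. \<exists>k<i. scalar_prod (v k) b = 0} \<le> 0 + e" .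
  qed
  then have "measure ?S {b \<in> space ?S. \<exists>k<i. scalar_prod (v k) b = 0} = 0"
    using measure_nonneg by (rule antisym)
  then have "emeasure ?S {b \<in> space ?S. \<exists>k<i. scalar_prod (v k) b = 0} = 0"
    by (simp only: sphere.emeasure_eq_measure ennreal_0)
  then show ?thesis
  proof (rule AE_I[rotated])
    show "{b \<in> space ?S. \<exists>k<i. scalar_prod (v k) b = 0} \<in> sets ?S" by (rule Z)
    show "{b \<in> space ?S. \<not> (0 \<le> rel_err m i A b \<and> rel_err m i A b \<le> 1)} \<subseteq> {b \<in> space ?S. \<exists>k<i. scalar_prod (v k) b = 0}"
    proof (rule subsetI)
      fix b assume "b \<in> {b \<in> space ?S. \<not> (0 \<le> rel_err m i A b \<and> rel_err m i A b \<le> 1)}"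
      then have b: "b \<in> space ?S" "\<not> (0 \<le> rel_err m i A b \<and> rel_err m i A b \<le> 1)" by blast+
      show "b \<in> {b \<in> space ?S. \<exists>k<i. scalar_prod (v k) b = 0}"
      proof (rule ccontr)
        assume "b \<notin> {b \<in> space ?S. \<exists>k<i. scalar_prod (v k) b = 0}"
        then have nz: "\<And>k. k < i \<Longrightarrow> scalar_prod (v k) b \<noteq> 0" using b by auto
        define t where "t = Min ((\<lambda>k. \<bar>scalar_prod (v k) b\<bar>) ` {..<i})"
        have "0 \<in> {..<i}" using i by simp
        then have fin: "finite ((\<lambda>k. \<bar>scalar_prod (v k) b\<bar>) ` {..<i})" "(\<lambda>k. \<bar>scalar_prod (v k) b\<bar>) ` {..<i} \<noteq> {}"
          by blast+
        have "0 < t" unfolding t_def Min_gr_iff[OF fin] using nz by auto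
        moreover have "t \<le> \<bar>scalar_prod (v k) b\<bar>" if "k < i" for k
          unfolding t_def using that fin by (intro Min_le) auto
        moreover have "b \<in> carrier_vec n" "scalar_prod b b = 1"
          using b by (auto simp: unit_sphere_def)
        ultimately have "feasible ((m - i) + i) i b \<noteq> {}"
          by (intro rel_err_le_components(1)[OF i(1,2) g _ _ _ _ _ _ ne, where t = t and \<epsilon> = "1/2"]) simp_all
        then have "feasible m i b \<noteq> {}" using i(3) by simp
        then show False using rel_err_bounds[OF _ i(1,2)] b(2) by blast
      qed
    qed
  qed
qed

text \<open>
  The powers of the gap cancel against those in the lower bound of the filter, which leaves
  \<open>i / 4 ^ (i - 1)\<close>.
\<close>
lemma rel_err_good:
  assumes i: "1 \<le> i" "i \<le> n" and g: "0 < gap i A" and ne: "eigval A n < eigval A i"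
    and t: "0 < t" and \<epsilon>: "0 < \<epsilon>" "\<epsilon> < 1"
    and \<kappa>: "exp (- (4 * real d * sqrt \<epsilon>)) \<le> gap i A ^ (2 * (i - 1)) * \<kappa>"
    and b: "b \<in> space (uniform_sphere n) - small_component i t"
  shows "rel_err (d + i) i A b \<le> \<epsilon> + 4 * (real i / 4 ^ (i - 1)) * \<kappa> / t\<^sup>2"
proof -
  have b': "b \<in> carrier_vec n" "scalar_prod b b = 1" using b by (auto simp: unit_sphere_def)
  have bt: "t \<le> \<bar>scalar_prod (v k) b\<bar>" if "k < i" for k using b that by (auto simp: small_component_def not_less)
  define \<gamma> where "\<gamma> = gap i A"
  have \<gamma>: "0 < \<gamma>" using g by (simp add: \<gamma>_def)
  have "rel_err (d + i) i A b \<le> \<epsilon> + 4 * (real i * (1 / (2 * \<gamma>)) ^ (2 * (i - 1))) * exp (- (4 * real d * sqrt \<epsilon>)) / t\<^sup>2"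
    unfolding \<gamma>_def by (rule rel_err_le_components(2)[OF i g b' t bt \<epsilon> ne])
  also have "\<dots> \<le> \<epsilon> + 4 * (real i * (1 / (2 * \<gamma>)) ^ (2 * (i - 1))) * (\<gamma> ^ (2 * (i - 1)) * \<kappa>) / t\<^sup>2"
    using \<kappa> \<gamma> unfolding \<gamma>_def[symmetric] by (intro add_mono divide_right_mono mult_left_mono) auto
  also have "4 * (real i * (1 / (2 * \<gamma>)) ^ (2 * (i - 1))) * (\<gamma> ^ (2 * (i - 1)) * \<kappa>)
      = 4 * (real i * ((1 / (2 * \<gamma>)) * \<gamma>) ^ (2 * (i - 1))) * \<kappa>"
    unfolding power_mult_distrib by (simp only: mult_ac)
  also have "(1 / (2 * \<gamma>)) * \<gamma> = 1 / 2" using \<gamma> by simp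
  also have "(1 / 2 :: real) ^ (2 * (i - 1)) = 1 / 4 ^ (i - 1)" by (simp add: power_mult power_divide)
  finally show ?thesis by simp
qed

lemma rel_err_powr_integrable:
  assumes i: "1 \<le> i" "i \<le> n" "i \<le> m" and g: "0 < gap i A" and ne: "eigval A n < eigval A i"
    and p: "1 \<le> p"
  shows "integrable (uniform_sphere n) (\<lambda>b. rel_err m i A b powr p)"
proof (rule sphere.integrable_const_bound[of _ 1])
  note [measurable] = rel_err_measurable[OF i(1,2), of m]
  show "(\<lambda>b. rel_err m i A b powr p) \<in> borel_measurable (uniform_sphere n)" by measurable
  show "AE b in uniform_sphere n. norm (rel_err m i A b powr p) \<le> 1"
    using AE_rel_err[OF i g ne] by eventually_elim (use p in \<open>auto intro: powr_le1\<close>)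
qed

text \<open>
  On the exceptional set the error is at most \<open>1\<close>, elsewhere at most \<open>x\<close>, so the \<open>p\<close>-th moment is at
  most \<open>\<beta> powr p + x powr p \<le> (\<beta> + x) powr p\<close>.
\<close>
lemma expectation_le:
  assumes i: "1 \<le> i" "i \<le> n" "i \<le> m" and g: "0 < gap i A" and ne: "eigval A n < eigval A i"
    and p: "1 \<le> p" and B: "B \<in> sets (uniform_sphere n)" "measure (uniform_sphere n) B \<le> \<beta> powr p" "0 \<le> \<beta>"
    and x: "\<And>b. b \<in> space (uniform_sphere n) - B \<Longrightarrow> rel_err m i A b \<le> x" "0 \<le> x"
  shows "(\<integral>b. rel_err m i A b powr p \<partial>uniform_sphere n) powr (1 / p) \<le> \<beta> + x"
proof -
  let ?S = "uniform_sphere n"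
  have "(\<integral>b. rel_err m i A b powr p \<partial>?S) \<le> (\<integral>b. indicator B b + x powr p \<partial>?S)"
  proof (rule integral_mono_AE)
    show "integrable ?S (\<lambda>b. rel_err m i A b powr p)" by (rule rel_err_powr_integrable[OF i g ne p])
    show "integrable ?S (\<lambda>b. indicator B b + x powr p :: real)"
      using B by (intro Bochner_Integration.integrable_add sphere.integrable_const) (auto simp: sphere.emeasure_eq_measure)
    show "AE b in ?S. rel_err m i A b powr p \<le> indicator B b + x powr p"
      using AE_rel_err[OF i g ne] AE_space
    proof eventually_elim
      case (elim b)
      show ?case
      proof (cases "b \<in> B")
        case True
        have "rel_err m i A b powr p \<le> 1" using elim p by (intro powr_le1) auto
        then show ?thesis using True by (simp add: add_increasing2)
      next
        case False
        then have "rel_err m i A b powr p \<le> x powr p" using elim x(1)[of b] p by (intro powr_mono2) auto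
        then show ?thesis using False by simp
      qed
    qed
  qed
  also have "\<dots> = measure ?S B + x powr p"
  proof -
    have "B \<inter> unit_sphere n = B" using sets.sets_into_space[OF B(1)] by auto
    moreover have "sphere.prob (unit_sphere n) = 1" using sphere.prob_space by simp
    ultimately show ?thesis
      using B by (subst Bochner_Integration.integral_add) (auto simp: sphere.emeasure_eq_measure)
  qed
  also have "\<dots> \<le> \<beta> powr p + x powr p" using B by simp
  also have "\<dots> \<le> (\<beta> + x) powr p" using B x p by (intro powr_add_superadditive) auto
  finally have "(\<integral>b. rel_err m i A b powr p \<partial>?S) powr (1 / p) \<le> ((\<beta> + x) powr p) powr (1 / p)"
    using p by (intro powr_mono2 integral_nonneg_AE) auto
  also have "\<dots> = \<beta> + x" using p B x by (simp add: powr_powr)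
  finally show ?thesis .
qed

end

section \<open>The moment and the tail bound\<close>

lemma ln_9_ge_2: "2 \<le> ln (9::real)"
proof -
  have "exp (2::real) = exp 1 * exp 1" by (simp add: exp_add[symmetric])
  also have "\<dots> \<le> 3 * 3" using exp_le by (intro mult_mono) auto
  finally have "exp (2::real) \<le> 9" by simp
  then show ?thesis by (simp add: ln_ge_iff)
qed

lemma ln_100_ge_4: "4 \<le> ln (100::real)"
proof -
  have "4 \<le> 2 * ln (9::real)" using ln_9_ge_2 by simp
  also have "\<dots> = ln (9 ^ 2)" by (subst ln_realpow) auto
  also have "\<dots> = ln 81" by simp
  also have "\<dots> \<le> ln 100" by simp
  finally show ?thesis .
qed

context eigenbasis
begin

text \<open>
  With \<open>N\<close> the argument of the logarithm and \<open>d = m - i\<close>, take \<open>\<epsilon> = (ln N)\<^sup>2 / (16 d\<^sup>2)\<close>, so that the filter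
  gains the factor \<open>exp (4 d sqrt \<epsilon>) = N\<close>. The threshold \<open>t\<close> is chosen such that the exceptional set
  has probability at most \<open>6 / d powr (3 p)\<close>, whose \<open>p\<close>-th root is at most \<open>6 / (9 d\<^sup>2)\<close>, and the second summand of the pointwise bound is at most
  \<open>8 / (9 d\<^sup>2)\<close>. Both together cost at most \<open>14 / (9 d\<^sup>2)\<close>, and the difference between the
  constants \<open>0.068\<close> and \<open>1 / 16\<close> pays for this because \<open>ln N \<ge> 20\<close>.
\<close>
lemma moment_bound:
  assumes i: "1 \<le> i" "i \<le> n" and n: "100 \<le> n" and m: "9 + i \<le> m" and p: "1 \<le> p"
    and g: "0 < gap i A" and ne: "eigval A n < eigval A i"
  shows "(\<integral>b. rel_err m i A b powr p \<partial>uniform_sphere n) powr (1 / p)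
    \<le> 0.068 * (ln (gap i A powr (- 2 * (real i - 1)) * real n * (real m - real i) powr (8 * p)))\<^sup>2 / (real m - real i)\<^sup>2"
proof -
  define d where "d = m - i"
  have md: "m = d + i" using m by (simp add: d_def)
  have im: "i \<le> m" by (simp add: md)
  have dr: "real m - real i = real d" by (simp add: md)
  have d9: "9 \<le> real d" using m by (simp add: d_def)
  define \<gamma> where "\<gamma> = gap i A"
  have \<gamma>: "0 < \<gamma>" "\<gamma> \<le> 1" using g gap_le_1[OF i g ne] by (auto simp: \<gamma>_def)
  define \<Lambda> where "\<Lambda> = ln (\<gamma> powr (- 2 * (real i - 1)) * real n * real d powr (8 * p))"
  have \<Lambda>: "\<Lambda> = - 2 * (real i - 1) * ln \<gamma> + ln (real n) + 8 * p * ln (real d)"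
    using \<gamma> n d9 by (simp add: \<Lambda>_def ln_mult ln_powr)
  have "ln 9 \<le> ln (real d)" using d9 by (subst ln_le_cancel_iff) auto
  then have lnd: "2 \<le> ln (real d)" using ln_9_ge_2 by linarith
  have "ln 100 \<le> ln (real n)" using n by simp
  then have "4 \<le> ln (real n)" using ln_100_ge_4 by linarith
  moreover have "0 \<le> - 2 * (real i - 1) * ln \<gamma>"
    using \<gamma> i by (intro mult_nonpos_nonpos) auto
  moreover have "16 \<le> 8 * p * ln (real d)"
    using mult_mono[of 8 "8 * p" 2 "ln (real d)"] p lnd by simp
  ultimately have \<Lambda>20: "20 \<le> \<Lambda>" unfolding \<Lambda> by linarith
  have \<Lambda>2: "400 \<le> \<Lambda>\<^sup>2" using power_mono[OF \<Lambda>20, of 2] by simp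
  define \<epsilon> where "\<epsilon> = \<Lambda>\<^sup>2 / (16 * (real d)\<^sup>2)"
  have \<epsilon>0: "0 < \<epsilon>" using \<Lambda>20 d9 by (simp add: \<epsilon>_def)
  have \<epsilon>_sqrt: "4 * real d * sqrt \<epsilon> = \<Lambda>"
    using \<Lambda>20 d9 by (simp add: \<epsilon>_def real_sqrt_divide real_sqrt_mult)
  have bound: "\<epsilon> + (14/9) * (1 / (real d)\<^sup>2) \<le> 0.068 * \<Lambda>\<^sup>2 / (real d)\<^sup>2"
  proof -
    have "\<epsilon> + (14/9) * (1 / (real d)\<^sup>2) = (\<Lambda>\<^sup>2 / 16 + 14/9) / (real d)\<^sup>2"
      by (simp add: \<epsilon>_def add_divide_distrib)
    also have "\<dots> \<le> (0.068 * \<Lambda>\<^sup>2) / (real d)\<^sup>2" using \<Lambda>2 by (intro divide_right_mono) auto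
    finally show ?thesis .
  qed
  have "(\<integral>b. rel_err m i A b powr p \<partial>uniform_sphere n) powr (1 / p) \<le> 0.068 * \<Lambda>\<^sup>2 / (real d)\<^sup>2"
  proof (cases "\<epsilon> < 1")
    case False
    \<comment> \<open>The interval of the filter is empty, but the claimed bound exceeds 1.\<close>
    have "(\<integral>b. rel_err m i A b powr p \<partial>uniform_sphere n) \<le> (\<integral>b. 1 \<partial>uniform_sphere n)"
    proof (rule integral_mono_AE)
      show "integrable (uniform_sphere n) (\<lambda>b. rel_err m i A b powr p)"
        by (intro rel_err_powr_integrable i im g ne p)
      show "AE b in uniform_sphere n. rel_err m i A b powr p \<le> 1"
        using AE_rel_err[OF i im g ne] by eventually_elim (use p in \<open>auto intro: powr_le1\<close>)
    qed auto
    also have "\<dots> = 1" using sphere.prob_space by simp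
    finally have "(\<integral>b. rel_err m i A b powr p \<partial>uniform_sphere n) powr (1 / p) \<le> 1"
      using p by (intro powr_le1 integral_nonneg_AE) auto
    also have "1 \<le> \<epsilon> + (14/9) * (1 / (real d)\<^sup>2)" using False by (simp add: add_increasing2)
    also note bound
    finally show ?thesis .
  next
    case True
    define t where "t = 3 / (real i * sqrt (real n) * real d powr (3 * p))"
    have t0: "0 < t" using i n d9 by (simp add: t_def)
    define \<kappa> where "\<kappa> = 1 / (real n * real d powr (8 * p))"
    have \<kappa>: "exp (- (4 * real d * sqrt \<epsilon>)) \<le> gap i A ^ (2 * (i - 1)) * \<kappa>"
    proof -
      have e: "2 * (real i - 1) = real (2 * (i - 1))" using i by (simp add: of_nat_diff)
      have "exp \<Lambda> = \<gamma> powr (- 2 * (real i - 1)) * real n * real d powr (8 * p)"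
        unfolding \<Lambda>_def using \<gamma> n d9 by (intro exp_ln) simp
      moreover have "\<gamma> powr (- 2 * (real i - 1)) = 1 / \<gamma> ^ (2 * (i - 1))"
      proof -
        have "\<gamma> powr (- 2 * (real i - 1)) = 1 / \<gamma> powr (2 * (real i - 1))"
          using powr_minus_divide[of \<gamma> "2 * (real i - 1)"] by (simp only: mult_minus_left)
        also have "\<gamma> powr (2 * (real i - 1)) = \<gamma> ^ (2 * (i - 1))"
          unfolding e by (rule powr_realpow[OF \<gamma>(1)])
        finally show ?thesis .
      qed
      moreover have "inverse (1 / x * y * z) = x * (1 / (y * z))" for x y z :: real by simp
      ultimately have "exp (- \<Lambda>) = \<gamma> ^ (2 * (i - 1)) * \<kappa>"
        unfolding exp_minus \<kappa>_def by (simp only:)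
      then show ?thesis unfolding \<epsilon>_sqrt \<gamma>_def by simp
    qed
    define X where "X = 4 * (real i / 4 ^ (i - 1)) * \<kappa> / t\<^sup>2"
    have dp: "real d powr (- 2 * p) \<le> 1 / (real d)\<^sup>2"
    proof -
      have "real d powr (- 2 * p) \<le> real d powr (- 2)" using d9 p by (intro powr_mono) auto
      also have "\<dots> = 1 / (real d)\<^sup>2" using d9 powr_minus_divide[of "real d" 2] by (simp add: powr_numeral)
      finally show ?thesis .
    qed
    have X: "X \<le> (8/9) * (1 / (real d)\<^sup>2)"
    proof -
      have "(real d powr (3 * p))\<^sup>2 = real d powr (6 * p)"
        unfolding power2_eq_square powr_add[symmetric] by simp
      then have t2: "t\<^sup>2 = 9 / ((real i)\<^sup>2 * real n * real d powr (6 * p))"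
        by (simp add: t_def power_divide power_mult_distrib)
      have s: "real d powr (8 * p) = real d powr (6 * p) * real d powr (2 * p)"
        unfolding powr_add[symmetric] by simp
      have minus: "real d powr (- 2 * p) = 1 / real d powr (2 * p)"
        using powr_minus_divide[of "real d" "2 * p"] by (simp only: mult_minus_left)
      have "4 * (x / y) * (1 / (z * (u * w))) / (9 / (x\<^sup>2 * z * u)) = (4/9) * (x ^ 3 / y) * (1 / w)"
        if "z \<noteq> 0" "u \<noteq> 0" for x y z u w :: real
        using that by (simp add: power2_eq_square power3_eq_cube)
      from this[of "real n" "real d powr (6 * p)" "real i" "4 ^ (i - 1)" "real d powr (2 * p)"]
      have "X = (4/9) * ((real i) ^ 3 / 4 ^ (i - 1)) * real d powr (- 2 * p)"
        unfolding X_def t2 \<kappa>_def s minus using n_pos d9 by auto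
      also have "\<dots> \<le> (4/9) * 2 * real d powr (- 2 * p)"
        using le_four_power(2)[of i] by (intro mult_right_mono mult_left_mono) (auto simp: divide_le_eq)
      also have "\<dots> \<le> (4/9) * 2 * (1 / (real d)\<^sup>2)" using dp by simp
      finally show ?thesis by simp
    qed
    have X0: "0 \<le> X" by (simp add: X_def \<kappa>_def)
    define \<beta> where "\<beta> = 6 / real d ^ 3"
    have \<beta>0: "0 \<le> \<beta>" by (simp add: \<beta>_def)
    have \<beta>: "measure (uniform_sphere n) (small_component i t) \<le> \<beta> powr p"
    proof -
      have "measure (uniform_sphere n) (small_component i t) \<le> 2 * real i * t * sqrt (real n)"
        using prob_small_component[OF i(2), of t] t0 by simp
      also have "\<dots> = 6 / real d powr (3 * p)"
      proof -
        have "2 * x * (3 / (x * y * w)) * y = 6 / w" if "x \<noteq> 0" "y \<noteq> 0" for x y w :: real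
          using that by simp
        then show ?thesis unfolding t_def using i n_pos by simp
      qed
      also have "\<dots> \<le> 6 powr p / real d powr (3 * p)"
        using powr_mono[of 1 p 6] p by (intro divide_right_mono) auto
      also have "\<dots> = \<beta> powr p"
      proof -
        have "real d powr 3 = real d ^ 3" using d9 by (intro powr_numeral) auto
        then have "(real d ^ 3) powr p = real d powr (3 * p)" using powr_powr[of "real d" 3 p] by simp
        moreover have "\<beta> powr p = 6 powr p / (real d ^ 3) powr p"
          unfolding \<beta>_def by (rule powr_divide)
        ultimately show ?thesis by simp
      qed
      finally show ?thesis .
    qed
    have \<beta>d: "\<beta> \<le> (6/9) * (1 / (real d)\<^sup>2)"
    proof -
      have "\<beta> = 6 / real d * (1 / (real d)\<^sup>2)" by (simp add: \<beta>_def power3_eq_cube power2_eq_square)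
      also have "\<dots> \<le> 6 / 9 * (1 / (real d)\<^sup>2)" using d9 by (intro mult_right_mono divide_left_mono) auto
      finally show ?thesis .
    qed
    have "(\<integral>b. rel_err m i A b powr p \<partial>uniform_sphere n) powr (1 / p) \<le> \<beta> + (\<epsilon> + X)"
    proof (rule expectation_le[OF i im g ne p small_component_measurable[OF i(2)] \<beta> \<beta>0])
      show "rel_err m i A b \<le> \<epsilon> + X" if "b \<in> space (uniform_sphere n) - small_component i t" for b
        unfolding md X_def using that by (intro rel_err_good i g ne t0 \<epsilon>0 True \<kappa>)
      show "0 \<le> \<epsilon> + X" using \<epsilon>0 X0 by simp
    qed
    also have "\<dots> \<le> \<epsilon> + (14/9) * (1 / (real d)\<^sup>2)" using \<beta>d X by simp
    also note bound
    finally show ?thesis .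
  qed
  then show ?thesis unfolding \<Lambda>_def \<gamma>_def dr .
qed

text \<open>
  Here \<open>\<epsilon> = (3.02 / 4)\<^sup>2 (ln N)\<^sup>2 / d\<^sup>2\<close>, where \<open>(3.02 / 4)\<^sup>2 = 0.570025\<close> is just below \<open>0.571\<close>, and the
  filter gains \<open>N powr 3.02\<close>, which contains the full power of the gap, \<open>n powr 3.02\<close> and \<open>d\<^sup>2\<close>. The
  exponents above \<open>3\<close> leave room for the threshold \<open>n powr (- 1.505)\<close>, whose exceptional probability is
  of smaller order than \<open>1 / n\<close>. The second summand is at most \<open>4 / d\<^sup>2\<close>, covered by the slack
  \<open>0.000975 (ln N)\<^sup>2\<close> once \<open>ln n \<ge> 65\<close>.
\<close>
lemma tail_bound:
  assumes i: "1 \<le> i" "i \<le> n" and n: "65 \<le> ln (real n)" and m: "9 + i \<le> m"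
    and g: "0 < gap i A" and ne: "eigval A n < eigval A i"
  shows "1 - 2 * real i * real n powr (- 1.005)
    \<le> measure (uniform_sphere n) {b \<in> space (uniform_sphere n). rel_err m i A b
      \<le> 0.571 * (ln (gap i A powr (- 2 * (real i - 1) / 3) * real n * (real m - real i) powr (2 / 3)))\<^sup>2 / (real m - real i)\<^sup>2}"
proof -
  define d where "d = m - i"
  have md: "m = d + i" using m by (simp add: d_def)
  have im: "i \<le> m" by (simp add: md)
  have dr: "real m - real i = real d" by (simp add: md)
  have d9: "9 \<le> real d" using m by (simp add: d_def)
  have n1: "1 \<le> real n" using n_pos by simp
  define \<gamma> where "\<gamma> = gap i A"
  have \<gamma>: "0 < \<gamma>" "\<gamma> \<le> 1" using g gap_le_1[OF i g ne] by (auto simp: \<gamma>_def)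
  define \<Lambda> where "\<Lambda> = ln (\<gamma> powr (- 2 * (real i - 1) / 3) * real n * real d powr (2 / 3))"
  have \<Lambda>: "\<Lambda> = (- 2 * (real i - 1) / 3) * ln \<gamma> + ln (real n) + 2 / 3 * ln (real d)"
    using \<gamma> n_pos d9 by (simp add: \<Lambda>_def ln_mult ln_powr)
  have lnd: "0 \<le> ln (real d)" using d9 by simp
  have a: "0 \<le> (- 2 * (real i - 1)) * ln \<gamma>"
    using \<gamma> i by (intro mult_nonpos_nonpos) auto
  have \<Lambda>n: "65 \<le> \<Lambda>" unfolding \<Lambda> using a lnd n by simp
  have \<Lambda>2: "4225 \<le> \<Lambda>\<^sup>2" using power_mono[OF \<Lambda>n, of 2] by simp
  define \<epsilon> where "\<epsilon> = 0.570025 * \<Lambda>\<^sup>2 / (real d)\<^sup>2"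
  have \<epsilon>0: "0 < \<epsilon>" using \<Lambda>n d9 by (simp add: \<epsilon>_def)
  have "\<epsilon> = (0.755 * \<Lambda> / real d)\<^sup>2" by (simp add: \<epsilon>_def power_divide power_mult_distrib)
  then have "sqrt \<epsilon> = 0.755 * \<Lambda> / real d" using \<Lambda>n by simp
  then have \<epsilon>_sqrt: "4 * real d * sqrt \<epsilon> = 3.02 * \<Lambda>" using d9 by simp
  define Bd where "Bd = 0.571 * \<Lambda>\<^sup>2 / (real d)\<^sup>2"
  have bound: "\<epsilon> + 4 / (real d)\<^sup>2 \<le> Bd"
  proof -
    have "\<epsilon> + 4 / (real d)\<^sup>2 = (0.570025 * \<Lambda>\<^sup>2 + 4) / (real d)\<^sup>2" by (simp add: \<epsilon>_def add_divide_distrib)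
    also have "\<dots> \<le> Bd" unfolding Bd_def using \<Lambda>2 by (intro divide_right_mono) auto
    finally show ?thesis .
  qed
  let ?S = "uniform_sphere n"
  let ?G = "{b \<in> space ?S. rel_err m i A b \<le> Bd}"
  note [measurable] = rel_err_measurable[OF i, of m]
  have G: "?G \<in> sets ?S" by measurable
  have "1 - 2 * real i * real n powr (- 1.005) \<le> measure ?S ?G"
  proof (cases "\<epsilon> < 1")
    case False
    \<comment> \<open>again the claimed bound exceeds 1\<close>
    then have Bd1: "1 \<le> Bd" using bound d9 by (smt (verit) divide_nonneg_nonneg zero_le_power2)
    have "AE b in ?S. b \<in> ?G"
      using AE_rel_err[OF i im g ne] AE_space by eventually_elim (use Bd1 in auto)
    then have "measure ?S ?G = 1" using G by (simp add: sphere.prob_eq_1)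
    moreover have "0 \<le> 2 * real i * real n powr (- 1.005)" by simp
    ultimately show ?thesis by linarith
  next
    case True
    define t where "t = real n powr (- 1.505)"
    have t0: "0 < t" using n_pos by (simp add: t_def)
    define \<kappa> where "\<kappa> = real n powr (- 3.02) / (real d)\<^sup>2"
    have \<kappa>: "exp (- (4 * real d * sqrt \<epsilon>)) \<le> gap i A ^ (2 * (i - 1)) * \<kappa>"
    proof -
      have e: "real (2 * (i - 1)) = 2 * (real i - 1)" using i by (simp add: of_nat_diff)
      define a where "a = (- 2 * (real i - 1)) * ln \<gamma>"
      have a0: "0 \<le> a" using a by (simp only: a_def)
      have \<Lambda>a: "\<Lambda> = a / 3 + ln (real n) + 2 / 3 * ln (real d)" unfolding \<Lambda> a_def by simp
      have "ln \<kappa> = - 3.02 * ln (real n) - 2 * ln (real d)"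
        unfolding \<kappa>_def using n_pos d9 by (subst ln_div) (auto simp: ln_powr ln_realpow)
      moreover have "ln (\<gamma> ^ (2 * (i - 1))) = - a"
        unfolding a_def unfolding ln_realpow e by (simp add: algebra_simps)
      moreover have "ln (\<gamma> ^ (2 * (i - 1)) * \<kappa>) = ln (\<gamma> ^ (2 * (i - 1))) + ln \<kappa>"
        using \<gamma>(1) n_pos d9 by (intro ln_mult_pos) (auto simp: \<kappa>_def)
      ultimately have eq: "ln (\<gamma> ^ (2 * (i - 1)) * \<kappa>) = - a + (- 3.02 * ln (real n) - 2 * ln (real d))"
        by (simp only:)
      have "- (3.02 * \<Lambda>) \<le> ln (\<gamma> ^ (2 * (i - 1)) * \<kappa>)"
        unfolding \<Lambda>a eq using a0 lnd by (simp add: field_simps)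
      then have "exp (- (3.02 * \<Lambda>)) \<le> exp (ln (\<gamma> ^ (2 * (i - 1)) * \<kappa>))" by simp
      also have "\<dots> = \<gamma> ^ (2 * (i - 1)) * \<kappa>"
        using \<gamma> n_pos d9 by (intro exp_ln) (simp add: \<kappa>_def)
      finally show ?thesis unfolding \<epsilon>_sqrt \<gamma>_def .
    qed
    have X: "4 * (real i / 4 ^ (i - 1)) * \<kappa> / t\<^sup>2 \<le> 4 / (real d)\<^sup>2"
    proof -
      have "t\<^sup>2 = real n powr (- 3.01)"
        using n_pos by (simp add: t_def powr_realpow[symmetric] powr_powr)
      then have "\<kappa> / t\<^sup>2 = real n powr (- 3.02) / real n powr (- 3.01) / (real d)\<^sup>2" by (simp add: \<kappa>_def)
      also have "\<dots> = real n powr (- 0.01) / (real d)\<^sup>2" by (simp add: powr_diff[symmetric])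
      also have "\<dots> \<le> 1 / (real d)\<^sup>2"
        using powr_mono[of "- 0.01" 0 "real n"] n1 by (intro divide_right_mono) auto
      finally have 1: "\<kappa> / t\<^sup>2 \<le> 1 / (real d)\<^sup>2" .
      have "real i / 4 ^ (i - 1) \<le> 1" using le_four_power(1)[of i] by simp
      then have "real i / 4 ^ (i - 1) * (\<kappa> / t\<^sup>2) \<le> 1 * (1 / (real d)\<^sup>2)"
        using 1 by (intro mult_mono) (auto simp: \<kappa>_def)
      then show ?thesis by simp
    qed
    have "space ?S - small_component i t \<subseteq> ?G"
    proof
      fix b assume b: "b \<in> space ?S - small_component i t"
      have "rel_err m i A b \<le> \<epsilon> + 4 * (real i / 4 ^ (i - 1)) * \<kappa> / t\<^sup>2"
        unfolding md using b by (intro rel_err_good i g ne t0 \<epsilon>0 True \<kappa>)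
      then show "b \<in> ?G" using b X bound by auto
    qed
    then have "measure ?S (space ?S - small_component i t) \<le> measure ?S ?G" using G by (intro sphere.finite_measure_mono)
    moreover have "measure ?S (space ?S - small_component i t) = 1 - measure ?S (small_component i t)"
      by (intro sphere.prob_compl small_component_measurable i)
    moreover have "measure ?S (small_component i t) \<le> 2 * real i * t * sqrt (real n)" using t0 i by (intro prob_small_component) auto
    moreover have "2 * real i * t * sqrt (real n) = 2 * real i * real n powr (- 1.005)"
      by (simp add: t_def powr_half_sqrt[symmetric] powr_add[symmetric] mult.assoc)
    ultimately show ?thesis by linarith
  qed
  then show ?thesis unfolding Bd_def \<Lambda>_def \<gamma>_def dr .
qed

end

lemma eta_limit:
  "(\<lambda>n. real n * (if 65 \<le> ln (real n) then 2 * c * real n powr (- 1.005) else 1)) \<longlonglongrightarrow> 0"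
proof -
  have "((\<lambda>x::real. 2 * c * x powr (- 0.005)) \<longlongrightarrow> 2 * c * 0) at_top"
    by (intro tendsto_mult tendsto_const tendsto_neg_powr filterlim_ident) simp
  then have "(\<lambda>n. 2 * c * real n powr (- 0.005)) \<longlonglongrightarrow> 0"
    using filterlim_compose[OF _ filterlim_real_sequentially] by fastforce
  moreover have "\<forall>\<^sub>F n in sequentially. 2 * c * real n powr (- 0.005)
      = real n * (if 65 \<le> ln (real n) then 2 * c * real n powr (- 1.005) else 1)"
  proof -
    have "\<forall>\<^sub>F n in sequentially. 65 \<le> ln (real n)"
      using filterlim_compose[OF ln_at_top filterlim_real_sequentially] by (simp add: filterlim_at_top)
    then show ?thesis using eventually_gt_at_top[of 0]
    proof eventually_elim
      case (elim n)
      have "real n * real n powr (- 1.005) = real n powr (1 + - 1.005)"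
        using elim by (simp only: powr_add) simp
      then show ?case using elim by (simp add: mult_ac)
    qed
  qed
  ultimately show ?thesis by (rule Lim_transform_eventually)
qed

text \<open>
  If \<open>\<lambda>\<^sub>i = \<lambda>\<^sub>n\<close>, the error is \<open>0\<close> by definition. For the tail, the finitely many \<open>n\<close> with
  \<open>ln n < 65\<close> are given \<open>\<eta> n = 1\<close>, for which nothing has to be shown.
\<close>
theorem theorem5p2:
  fixes i :: nat
  assumes "i \<ge> 1"
  shows "(\<forall>(n::nat) (m::nat) (p::real) (A::real mat).
            n \<ge> 100 \<longrightarrow> i \<le> n \<longrightarrow> m \<ge> 9 + i \<longrightarrow> p \<ge> 1 \<longrightarrow> A \<in> sym_mats n \<longrightarrow>
            (i \<ge> 2 \<longrightarrow> gap i A > 0) \<longrightarrow>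
              integrable (uniform_sphere n) (\<lambda>b. rel_err m i A b powr p) \<and>
              (\<integral>b. rel_err m i A b powr p \<partial>uniform_sphere n) powr (1 / p)
                \<le> 0.068 * (ln (gap i A powr (- 2 * (real i - 1)) * real n
                              * (real m - real i) powr (8 * p)))\<^sup>2 / (real m - real i)\<^sup>2)
       \<and> (\<exists>\<eta> :: nat \<Rightarrow> real. (\<lambda>n. real n * \<eta> n) \<longlonglongrightarrow> 0 \<and>
            (\<forall>(n::nat) (m::nat) (A::real mat).
               n \<ge> 100 \<longrightarrow> i \<le> n \<longrightarrow> m \<ge> 9 + i \<longrightarrow> A \<in> sym_mats n \<longrightarrow>
               (i \<ge> 2 \<longrightarrow> gap i A > 0) \<longrightarrow>
                 measure (uniform_sphere n)
                   {b \<in> space (uniform_sphere n).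
                      rel_err m i A b
                        \<le> 0.571 * (ln (gap i A powr (- 2 * (real i - 1) / 3) * real n
                                      * (real m - real i) powr (2 / 3)))\<^sup>2 / (real m - real i)\<^sup>2}
                   \<ge> 1 - \<eta> n))"
proof -
  have basis: "\<exists>v. eigenbasis n A v" if "100 \<le> n" "A \<in> sym_mats n" for n A
  proof (rule spectral_eigval[OF that(2)])
    fix v assume "orthonormal n n v" "\<And>k. k < n \<Longrightarrow> A *\<^sub>v v k = eigval A (Suc k) \<cdot>\<^sub>v v k"
      "\<And>k l. k \<le> l \<Longrightarrow> l < n \<Longrightarrow> eigval A (Suc l) \<le> eigval A (Suc k)"
    then have "eigenbasis n A v" using that by unfold_locales auto
    then show ?thesis by blast
  qed
  have gp: "0 < gap i A" if "i \<ge> 2 \<longrightarrow> gap i A > 0" for A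
    using that by (cases "i \<ge> 2") (auto simp: gap_def)
  have degenerate: "rel_err m i A b = 0" if "A \<in> sym_mats n" "\<not> eigval A n < eigval A i" "eigenbasis n A v" "i \<le> n" for n m A b v
  proof -
    interpret eigenbasis n A v by fact
    have "i - 1 < n" using assms that by linarith
    then have "eigval A n \<le> eigval A i" using lam_ge_last[of "i - 1"] assms by simp
    then show ?thesis using that by (simp add: rel_err_def)
  qed
  define \<eta> where "\<eta> n = (if 65 \<le> ln (real n) then 2 * real i * real n powr (- 1.005) else 1)" for n
  have moment: "integrable (uniform_sphere n) (\<lambda>b. rel_err m i A b powr p) \<and>
      (\<integral>b. rel_err m i A b powr p \<partial>uniform_sphere n) powr (1 / p)
      \<le> 0.068 * (ln (gap i A powr (- 2 * (real i - 1)) * real n * (real m - real i) powr (8 * p)))\<^sup>2 / (real m - real i)\<^sup>2"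
    if n: "n \<ge> 100" "i \<le> n" and m: "m \<ge> 9 + i" and p: "p \<ge> 1" and A: "A \<in> sym_mats n" and g: "i \<ge> 2 \<longrightarrow> gap i A > 0"
    for n m p A
  proof -
    obtain v where v: "eigenbasis n A v" using basis[OF n(1) A] by blast
    interpret eigenbasis n A v by fact
    show ?thesis
    proof (cases "eigval A n < eigval A i")
      case True
      have "i \<le> m" using m by simp
      then show ?thesis
        using rel_err_powr_integrable[OF assms n(2) _ gp[OF g] True p, of m]
          moment_bound[OF assms n(2) n(1) m p gp[OF g] True] by blast
    next
      case False
      then show ?thesis using degenerate[OF A False v n(2)] by simp
    qed
  qed
  have tail: "1 - \<eta> n \<le> measure (uniform_sphere n) {b \<in> space (uniform_sphere n). rel_err m i A b
      \<le> 0.571 * (ln (gap i A powr (- 2 * (real i - 1) / 3) * real n * (real m - real i) powr (2 / 3)))\<^sup>2 / (real m - real i)\<^sup>2}"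
    if n: "n \<ge> 100" "i \<le> n" and m: "m \<ge> 9 + i" and A: "A \<in> sym_mats n" and g: "i \<ge> 2 \<longrightarrow> gap i A > 0"
    for n m A
  proof (cases "65 \<le> ln (real n)")
    case large: True
    obtain v where v: "eigenbasis n A v" using basis[OF n(1) A] by blast
    interpret eigenbasis n A v by fact
    show ?thesis
    proof (cases "eigval A n < eigval A i")
      case True
      show ?thesis using tail_bound[OF assms n(2) large m gp[OF g] True] large by (simp only: \<eta>_def if_True)
    next
      case False
      have "0 \<le> \<eta> n" by (simp add: \<eta>_def)
      moreover have "measure (uniform_sphere n) (space (uniform_sphere n)) = 1" by (rule sphere.prob_space)
      ultimately show ?thesis using degenerate[OF A False v n(2)] by simp
    qed
  next
    case False
    then show ?thesis by (simp only: \<eta>_def if_False) simp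
  qed
  show ?thesis using moment tail eta_limit[of "real i"] unfolding \<eta>_def[symmetric] by blast
qed

end
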